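(* A directed tree is unary FA-presentable if and only if it is isomorphic to a directed tree obtained by starting from a finite directed tree and attaching to (vertices of) it finitely many shallow stars (each at its centre) and finitely many periodic paths (each at its base).
   Context: A directed graph is a set with a binary edge relation; a directed tree is a directed graph obtained from a tree by assigning a direction to each edge. A structure is unary FA-presentable if there exist a regular language $L\subseteq a^*$ and a surjection $\phi:L\to X$ such that for equality and for the edge relation the set of pairs $(u,v)\in L^2$ whose images are related is regular (the words $\mathrm{conv}(u,v)$ over $\{a,\$\}^2$, reading $u,v$ in parallel and padding the shorter with $\$$, form a regular language). Attaching a directed graph $(T,\eta)$ at a vertex $t\in T$ to a vertex $g$ of $(G,\gamma)$ means taking the disjoint union of the two graphs and identifying $g$ with $t$. A template is $(T,\eta,t_0,t_1)$ with $(T,\eta)$ a finite directed tree, $t_0,t_1\in T$, and $t_0$ a leaf. The graph $\mathcal{S}(T,\eta,t_0,t_1)$ is obtained from countably many disjoint copies $(T^{(j)},\eta^{(j)},t_0^{(j)},t_1^{(j)})$, $j\in\{0,1,2,\dots\}$, by identifying the vertices related by the equivalence relation generated by $\{(t_1^{(j)},t_0^{(j+1)}):j\ge0\}$. If $t_0=t_1$, this is a shallow star; all copies of $t_0$ are identified to one vertex, the centre. If $t_0\ne t_1$, it is a periodic path; its base is the vertex $t_0^{(0)}$. *)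

theory Defs
  imports Main
begin

section \<open>Directed graphs and directed trees\<close>

text \<open>A directed graph is a vertex set V with an edge relation E on V.\<close>
definition directed_graph :: "'a set \<Rightarrow> ('a \<times> 'a) set \<Rightarrow> bool" where
  "directed_graph V E \<longleftrightarrow> E \<subseteq> V \<times> V"

text \<open>Undirected adjacency of the underlying graph.\<close>
definition adj :: "('a \<times> 'a) set \<Rightarrow> ('a \<times> 'a) set" where
  "adj E = E \<union> E\<inverse>"

text \<open>A cycle of the underlying undirected graph: at least three distinct vertices,
  consecutive ones adjacent, and the last adjacent to the first.\<close>
definition is_cycle :: "'a set \<Rightarrow> ('a \<times> 'a) set \<Rightarrow> 'a list \<Rightarrow> bool" where
  "is_cycle V E cs \<longleftrightarrow> length cs \<ge> 3 \<and> distinct cs \<and> set cs \<subseteq> V \<and>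
     (\<forall>i. Suc i < length cs \<longrightarrow> (cs ! i, cs ! Suc i) \<in> adj E) \<and>
     (last cs, hd cs) \<in> adj E"

text \<open>A directed tree: a (nonempty) tree, i.e. connected acyclic simple graph, each of whose
  edges is given exactly one direction (so no loops and no pair of opposite arcs).\<close>
definition directed_tree :: "'a set \<Rightarrow> ('a \<times> 'a) set \<Rightarrow> bool" where
  "directed_tree V E \<longleftrightarrow> directed_graph V E \<and> V \<noteq> {} \<and>
     (\<forall>x. (x, x) \<notin> E) \<and> (\<forall>x y. (x, y) \<in> E \<longrightarrow> (y, x) \<notin> E) \<and>
     (\<forall>x\<in>V. \<forall>y\<in>V. (x, y) \<in> (adj E)\<^sup>*) \<and>
     (\<nexists>cs. is_cycle V E cs)"

definition leaf :: "'a set \<Rightarrow> ('a \<times> 'a) set \<Rightarrow> 'a \<Rightarrow> bool" where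
  "leaf V E x \<longleftrightarrow> x \<in> V \<and> card {y \<in> V. (x, y) \<in> adj E} = 1"

definition graph_iso :: "'a set \<Rightarrow> ('a \<times> 'a) set \<Rightarrow> 'b set \<Rightarrow> ('b \<times> 'b) set \<Rightarrow> bool" where
  "graph_iso V E W F \<longleftrightarrow> (\<exists>f. bij_betw f V W \<and>
     (\<forall>x\<in>V. \<forall>y\<in>V. (x, y) \<in> E \<longleftrightarrow> (f x, f y) \<in> F))"

section \<open>Unary FA-presentability\<close>

text \<open>Regular languages over an alphabet 'b, via deterministic finite automata
  (states 0..n-1, start state 0).\<close>
definition regular :: "'b list set \<Rightarrow> bool" where
  "regular L \<longleftrightarrow> (\<exists>(n::nat) (\<delta>::nat \<Rightarrow> 'b \<Rightarrow> nat) F. 0 < n \<and>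
     (\<forall>q<n. \<forall>c. \<delta> q c < n) \<and> L = {w. foldl \<delta> 0 w \<in> F})"

text \<open>Words over the unary alphabet {a} are elements of type unit list.
  Convolution over {a,$}^2: Some () = a, None = padding symbol $.\<close>
definition conv :: "unit list \<Rightarrow> unit list \<Rightarrow> (unit option \<times> unit option) list" where
  "conv u v = map (\<lambda>i. (if i < length u then Some () else None,
                         if i < length v then Some () else None))
                  [0..<max (length u) (length v)]"

definition unary_FA_presentable :: "'a set \<Rightarrow> ('a \<times> 'a) set \<Rightarrow> bool" where
  "unary_FA_presentable V E \<longleftrightarrow> (\<exists>(L :: unit list set) (\<phi> :: unit list \<Rightarrow> 'a).
     regular L \<and> \<phi> ` L = V \<and>
     regular {conv u v | u v. u \<in> L \<and> v \<in> L \<and> \<phi> u = \<phi> v} \<and>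
     regular {conv u v | u v. u \<in> L \<and> v \<in> L \<and> (\<phi> u, \<phi> v) \<in> E})"

section \<open>Gluing, templates, shallow stars, periodic paths, attachment\<close>

text \<open>Equivalence relation on V generated by S.\<close>
definition equiv_closure :: "'a set \<Rightarrow> ('a \<times> 'a) set \<Rightarrow> ('a \<times> 'a) set" where
  "equiv_closure V S = Id_on V \<union> ((S \<union> S\<inverse>) \<inter> (V \<times> V))\<^sup>+"

text \<open>Quotient of the graph (V,E) by the equivalence generated by S: vertices are the classes,
  and two classes are joined if some representatives are.\<close>
definition quot_graph :: "'a set \<Rightarrow> ('a \<times> 'a) set \<Rightarrow> ('a \<times> 'a) set \<Rightarrow> 'a set set \<times> ('a set \<times> 'a set) set" where
  "quot_graph V E S = (let R = equiv_closure V S in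
     (V // R, {(R `` {x}, R `` {y}) | x y. (x, y) \<in> E}))"

definition template :: "nat set \<Rightarrow> (nat \<times> nat) set \<Rightarrow> nat \<Rightarrow> nat \<Rightarrow> bool" where
  "template T \<eta> t0 t1 \<longleftrightarrow> finite T \<and> directed_tree T \<eta> \<and> t0 \<in> T \<and> t1 \<in> T \<and> leaf T \<eta> t0"

text \<open>S(T,eta,t0,t1): copies (j,t), j = 0,1,2,..., glued by t1^(j) ~ t0^(j+1).
  It is a shallow star if t0 = t1 and a periodic path otherwise.\<close>
definition S_graph :: "nat set \<Rightarrow> (nat \<times> nat) set \<Rightarrow> nat \<Rightarrow> nat \<Rightarrow>
    (nat \<times> nat) set set \<times> ((nat \<times> nat) set \<times> (nat \<times> nat) set) set" where
  "S_graph T \<eta> t0 t1 = quot_graph (UNIV \<times> T) {((j, x), (j, y)) | j x y. (x, y) \<in> \<eta>}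
                                    {((j, t1), (Suc j, t0)) | j. True}"

text \<open>The centre (shallow star) resp. base (periodic path): the vertex t0^(0).\<close>
definition S_root :: "nat set \<Rightarrow> (nat \<times> nat) set \<Rightarrow> nat \<Rightarrow> nat \<Rightarrow> (nat \<times> nat) set" where
  "S_root T \<eta> t0 t1 = equiv_closure (UNIV \<times> T) {((j, t1), (Suc j, t0)) | j. True} `` {(0, t0)}"

definition shallow_star :: "nat set \<Rightarrow> (nat \<times> nat) set \<Rightarrow> nat \<Rightarrow> nat \<Rightarrow> bool" where
  "shallow_star T \<eta> t0 t1 \<longleftrightarrow> template T \<eta> t0 t1 \<and> t0 = t1"

definition periodic_path :: "nat set \<Rightarrow> (nat \<times> nat) set \<Rightarrow> nat \<Rightarrow> nat \<Rightarrow> bool" where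
  "periodic_path T \<eta> t0 t1 \<longleftrightarrow> template T \<eta> t0 t1 \<and> t0 \<noteq> t1"

type_synonym attachment = "nat set \<times> (nat \<times> nat) set \<times> nat \<times> nat \<times> nat"
  \<comment> \<open>(T, eta, t0, t1, g): the graph S(T,eta,t0,t1) attached at its root to vertex g\<close>

type_synonym avert = "nat + nat \<times> (nat \<times> nat) set"

text \<open>Start from (G0,E0) and attach, for each entry (T,eta,t0,t1,g) of the list A, the graph
  S(T,eta,t0,t1) by identifying its centre/base with g: disjoint union, then identification.\<close>
definition assemble :: "nat set \<Rightarrow> (nat \<times> nat) set \<Rightarrow> attachment list \<Rightarrow>
    avert set set \<times> (avert set \<times> avert set) set" where
  "assemble G0 E0 A = quot_graph
     (Inl ` G0 \<union> (\<Union>i<length A. case A ! i of (T, \<eta>, t0, t1, g) \<Rightarrow>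
         (\<lambda>c. Inr (i, c)) ` fst (S_graph T \<eta> t0 t1)))
     ((\<lambda>(x, y). (Inl x, Inl y)) ` E0 \<union> (\<Union>i<length A. case A ! i of (T, \<eta>, t0, t1, g) \<Rightarrow>
         (\<lambda>(c, d). (Inr (i, c), Inr (i, d))) ` snd (S_graph T \<eta> t0 t1)))
     {(Inr (i, case A ! i of (T, \<eta>, t0, t1, g) \<Rightarrow> S_root T \<eta> t0 t1),
       Inl (case A ! i of (T, \<eta>, t0, t1, g) \<Rightarrow> g)) | i. i < length A}"

end

(*
Names of vertices are identified with their lengths, so a presentation is an eventually periodic
binary relation on the natural numbers: it is invariant under (x, y) -> (x + P, y + P) for large
x, y, and under y -> y + P when y is much larger than x.

If it describes a tree, choose each vertex to be its shortest name and root the tree at some r < P.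
Edges between vertices >= P have length < P, as otherwise periodicity gives a 4-cycle.  Far out the
shift by P commutes with taking parents, except that children of vertices below P stay children of
the same vertex.  By pigeonhole, all but finitely many vertices lie below a star vertex (a vertex
whose parent is < P) or below an axial vertex w, one that is an ancestor of w + Q, where
Q = P! * P.  The star vertices fall into finitely many classes modulo Q, each giving a shallow star;
each of the finitely many topmost axial vertices y gives a periodic path whose j-th template copy
consists of the vertices below y + jQ but not below y + (j + 1)Q.

Conversely, listing the copies of all templates round by round makes an assembled graph eventually
periodic.
*)
theory Submission
  imports Defs
begin

text \<open>The obstacle is that only edges are known to be periodic, while the decomposition speaks
  of parents and ancestors, which depend on the root and hence on the bounded range where nothing is
  periodic. A shifted edge is again an edge, but the other end might become the parent, and a branch
  that starts far out may return to small numbers. The remedy is a tower of thresholds above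
  \<open>P\<close>, namely \<open>B\<close> and \<open>l0\<close>, obtained from the finiteness of
  ancestor sets: beyond \<open>hull L\<close> no vertex has a descendant below L, so that whole
  subtrees, and not only single vertices, stay in the periodic range. Beyond \<open>B\<close> the
  shift is compatible with parents; beyond \<open>l0\<close> it carries the subtree at w onto the
  subtree at w + P.

  In the converse direction the difficulty is notational: \<open>assemble\<close> is a quotient of
  graphs whose vertices are already equivalence classes. A normal form for the vertices replaces
  both quotients at once.\<close>

section \<open>Regular relations on unary words\<close>

text \<open>The possibly infinite automaton \<delta>' can be run on representatives:
  \<open>step\<close> makes the fibres of \<alpha> a congruence, and acceptance is constant on each
  fibre.\<close>

lemma regular_if_finite_abstraction:
  assumes fin: "finite (range \<alpha>)"
    and step: "\<And>s c. \<alpha> (\<delta>' (\<alpha> s) c) = \<alpha> (\<delta>' s c)"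
    and F: "\<And>s. \<alpha> s \<in> F \<longleftrightarrow> s \<in> F"
  shows "regular {w. foldl \<delta>' s0 w \<in> F}"
proof -
  obtain xs where xs: "set xs = range \<alpha>" using finite_list[OF fin] by blast
  \<comment> \<open>\<open>regular\<close> fixes the start state as 0, so the representative of
    \<open>s0\<close> is put at the head of the list. It then occurs twice, which is harmless
    because \<delta> picks any suitable index.\<close>
  define ys where "ys = \<alpha> s0 # xs"
  define n where "n = length ys"
  have set_ys: "set ys = range \<alpha>" using xs by (auto simp: ys_def)
  have ex: "\<exists>j<n. ys ! j = \<alpha> s" for s
    using set_ys unfolding n_def by (metis in_set_conv_nth rangeI)
  define \<delta> where "\<delta> q c = (SOME j. j < n \<and> ys ! j = \<alpha> (\<delta>' (ys ! q) c))" for q c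
  have \<delta>: "\<delta> q c < n \<and> ys ! (\<delta> q c) = \<alpha> (\<delta>' (ys ! q) c)" for q c
    unfolding \<delta>_def by (rule someI_ex) (use ex in blast)
  have run: "foldl \<delta> 0 w < n \<and> ys ! (foldl \<delta> 0 w) = \<alpha> (foldl \<delta>' s0 w)" for w
  proof (induction w rule: rev_induct)
    case Nil then show ?case by (simp add: ys_def n_def)
  next
    case (snoc c w) then show ?case using \<delta> step by simp
  qed
  have "{w. foldl \<delta>' s0 w \<in> F} = {w. foldl \<delta> 0 w \<in> {q. ys ! q \<in> F}}"
    using run F by simp
  moreover have "0 < n" by (simp add: n_def ys_def)
  ultimately show ?thesis unfolding regular_def using \<delta> by blast
qed

section \<open>Eventually periodic sets and relations\<close>

text \<open>The state that a unary automaton with a tail of length N and a cycle of length p reaches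
  after x letters.\<close>

definition cyc_red :: "nat \<Rightarrow> nat \<Rightarrow> nat \<Rightarrow> nat" where
  "cyc_red N p x = (if x < N then x else N + (x - N) mod p)"

lemma cyc_red_less: "0 < p \<Longrightarrow> cyc_red N p x < N + p"
  by (auto simp: cyc_red_def)

lemma cyc_red_cases:
  obtains k where "x = cyc_red N p x + k * p" "k = 0 \<or> N \<le> cyc_red N p x"
proof (cases "x < N")
  case True then show ?thesis using that[of 0] by (simp add: cyc_red_def)
next
  case False
  then have "x = cyc_red N p x + ((x - N) div p) * p"
    using mod_div_mult_eq[of "x - N" p] by (simp add: cyc_red_def)
  moreover have "N \<le> cyc_red N p x" using False by (simp add: cyc_red_def)
  ultimately show ?thesis using that by blast
qed

lemma cyc_red_add: "N \<le> x \<Longrightarrow> cyc_red N p (x + k * p) = cyc_red N p x"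
proof -
  assume "N \<le> x"
  then have "x + k * p - N = x - N + k * p" by simp
  then have "(x + k * p - N) mod p = (x - N) mod p" by (metis mod_mult_self1)
  then show ?thesis using \<open>N \<le> x\<close> by (simp add: cyc_red_def)
qed

lemma cyc_red_Suc: "cyc_red N p (Suc (cyc_red N p x)) = cyc_red N p (Suc x)"
proof -
  obtain k where k: "x = cyc_red N p x + k * p" "k = 0 \<or> N \<le> cyc_red N p x"
    by (rule cyc_red_cases)
  show ?thesis
  proof (cases "k = 0")
    case True then show ?thesis using k by simp
  next
    case False
    then have "cyc_red N p (Suc (cyc_red N p x) + k * p) = cyc_red N p (Suc (cyc_red N p x))"
      using k by (intro cyc_red_add) auto
    then show ?thesis using k(1) by simp
  qed
qed

definition eventually_periodic :: "nat \<Rightarrow> nat \<Rightarrow> (nat \<Rightarrow> bool) \<Rightarrow> bool" where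
  "eventually_periodic N p Q \<longleftrightarrow> 0 < p \<and> (\<forall>x\<ge>N. Q (x + p) = Q x)"

text \<open>A synchronous run on two unary words has two phases: both words are read, and then only
  the longer one. The first clause is periodicity in the length of the first phase, the other two in
  the length of the second.\<close>

definition eventually_periodic2 :: "nat \<Rightarrow> nat \<Rightarrow> (nat \<Rightarrow> nat \<Rightarrow> bool) \<Rightarrow> bool" where
  "eventually_periodic2 N p R \<longleftrightarrow> 0 < p \<and>
     (\<forall>x\<ge>N. \<forall>y\<ge>N. R (x + p) (y + p) = R x y) \<and>
     (\<forall>x y. x + N \<le> y \<longrightarrow> R x (y + p) = R x y) \<and>
     (\<forall>x y. y + N \<le> x \<longrightarrow> R (x + p) y = R x y)"

lemma eventually_periodic_mult:
  assumes "eventually_periodic N p Q" "N \<le> x"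
  shows "Q (x + k * p) = Q x"
  using assms
proof (induction k)
  case (Suc k)
  have "Q ((x + k * p) + p) = Q (x + k * p)"
    using Suc.prems unfolding eventually_periodic_def by (meson le_add1 order_trans)
  then show ?case using Suc by (simp add: algebra_simps)
qed simp

lemma eventually_periodic2_mult:
  assumes "eventually_periodic2 N p R"
  shows "N \<le> x \<Longrightarrow> N \<le> y \<Longrightarrow> R (x + k * p) (y + k * p) = R x y"
    and "x + N \<le> y \<Longrightarrow> R x (y + k * p) = R x y"
    and "y + N \<le> x \<Longrightarrow> R (x + k * p) y = R x y"
proof (induction k)
  case (Suc k)
  { case 1
    have "R ((x + k * p) + p) ((y + k * p) + p) = R (x + k * p) (y + k * p)"
      using 1 assms unfolding eventually_periodic2_def by (meson le_add1 order_trans)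
    then show ?case using Suc 1 by (simp add: algebra_simps)
  next
    case 2
    have "R x ((y + k * p) + p) = R x (y + k * p)"
      using 2 assms unfolding eventually_periodic2_def by (meson le_add1 order_trans)
    then show ?case using Suc 2 by (simp add: algebra_simps)
  next
    case 3
    have "R ((x + k * p) + p) y = R (x + k * p) y"
      using 3 assms unfolding eventually_periodic2_def by (meson le_add1 order_trans)
    then show ?case using Suc 3 by (simp add: algebra_simps) }
qed simp_all

lemma eventually_periodic_weaken:
  assumes "eventually_periodic N p Q" "N \<le> N'" "0 < k"
  shows "eventually_periodic N' (k * p) Q"
proof -
  have "Q (x + k * p) = Q x" if "N' \<le> x" for x
    using eventually_periodic_mult[OF assms(1)] that assms(2) by simp
  then show ?thesis using assms by (simp add: eventually_periodic_def)
qed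

lemma eventually_periodic2_weaken:
  assumes "eventually_periodic2 N p R" "N \<le> N'" "0 < k"
  shows "eventually_periodic2 N' (k * p) R"
proof -
  note m = eventually_periodic2_mult[OF assms(1)]
  have "R (x + k * p) (y + k * p) = R x y" if "N' \<le> x" "N' \<le> y" for x y
    using m(1) that assms(2) by simp
  moreover have "R x (y + k * p) = R x y" if "x + N' \<le> y" for x y
    using m(2) that assms(2) by simp
  moreover have "R (x + k * p) y = R x y" if "y + N' \<le> x" for x y
    using m(3) that assms(2) by simp
  ultimately show ?thesis using assms by (simp add: eventually_periodic2_def)
qed

lemma regular_unary_if_eventually_periodic:
  assumes "eventually_periodic N p Q"
  shows "regular {u :: unit list. Q (length u)}"
proof -
  have p: "0 < p" using assms by (simp add: eventually_periodic_def)
  have run: "foldl (\<lambda>s (c::unit). Suc s) 0 u = length u" for u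
    by (induction u rule: rev_induct) auto
  have "range (cyc_red N p) \<subseteq> {..<N + p}" using cyc_red_less[OF p] by auto
  then have "finite (range (cyc_red N p))" by (rule finite_subset) simp
  moreover have "cyc_red N p s \<in> {x. Q x} \<longleftrightarrow> s \<in> {x. Q x}" for s
  proof -
    obtain k where "s = cyc_red N p s + k * p" "k = 0 \<or> N \<le> cyc_red N p s"
      by (rule cyc_red_cases)
    then show ?thesis using eventually_periodic_mult[OF assms, of "cyc_red N p s" k]
      by (metis add.right_neutral mem_Collect_eq mult_0)
  qed
  ultimately have "regular {u. foldl (\<lambda>s (c::unit). Suc s) 0 u \<in> {x. Q x}}"
    by (intro regular_if_finite_abstraction[where \<alpha> = "cyc_red N p"]) (auto simp: cyc_red_Suc)
  then show ?thesis by (simp add: run)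
qed

section \<open>Convolutions as pairs of lengths\<close>

definition conv_len :: "nat \<Rightarrow> nat \<Rightarrow> (unit option \<times> unit option) list" where
  "conv_len x y = conv (replicate x ()) (replicate y ())"

lemma conv_eq_conv_len: "conv u v = conv_len (length u) (length v)"
  by (simp add: conv_len_def conv_def)

lemma conv_len_eq: "conv_len x y = map (\<lambda>i. (if i < x then Some () else None,
    if i < y then Some () else None)) [0..<max x y]"
  by (simp add: conv_len_def conv_def)

lemma conv_len_add:
  "conv_len x (x + d) = replicate x (Some (), Some ()) @ replicate d (None, Some ())"
  "conv_len (x + d) x = replicate x (Some (), Some ()) @ replicate d (Some (), None)"
  by (auto simp: conv_len_eq nth_append intro!: nth_equalityI)

lemma conv_len_inject: "conv_len x y = conv_len x' y' \<longleftrightarrow> x = x' \<and> y = y'"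
proof -
  have "length (filter (\<lambda>c. fst c \<noteq> None) (conv_len x y)) = x \<and>
    length (filter (\<lambda>c. snd c \<noteq> None) (conv_len x y)) = y" for x y
  proof (cases "x \<le> y")
    case True
    then obtain d where "y = x + d" using le_Suc_ex by blast
    then show ?thesis by (simp add: conv_len_add)
  next
    case False
    then obtain d where "x = y + d" by (metis le_Suc_ex nat_le_linear)
    then show ?thesis by (simp add: conv_len_add)
  qed
  then show ?thesis by metis
qed

text \<open>An automaton with infinitely many states that counts both lengths. \<open>None\<close>
  is the sink for words that are not convolutions: those with a letter after padding in the same
  track, or with padding in both tracks at once.\<close>

definition conv_step :: "(nat \<times> nat) option \<Rightarrow> unit option \<times> unit option \<Rightarrow> (nat \<times> nat) option" where
  "conv_step s c = (case s of None \<Rightarrow> None | Some (x, y) \<Rightarrow>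
     (case c of (Some _, Some _) \<Rightarrow> if x = y then Some (Suc x, Suc y) else None
      | (Some _, None) \<Rightarrow> if y \<le> x then Some (Suc x, y) else None
      | (None, Some _) \<Rightarrow> if x \<le> y then Some (x, Suc y) else None
      | (None, None) \<Rightarrow> None))"

lemma conv_step_simps [simp]:
  "conv_step None c = None"
  "conv_step (Some (x, y)) (Some u, Some v) = (if x = y then Some (Suc x, Suc y) else None)"
  "conv_step (Some (x, y)) (Some u, None) = (if y \<le> x then Some (Suc x, y) else None)"
  "conv_step (Some (x, y)) (None, Some v) = (if x \<le> y then Some (x, Suc y) else None)"
  "conv_step (Some (x, y)) (None, None) = None"
  by (simp_all add: conv_step_def)

lemma conv_len_snoc:
  "conv_len (Suc x) (Suc x) = conv_len x x @ [(Some (), Some ())]"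
  "y \<le> x \<Longrightarrow> conv_len (Suc x) y = conv_len x y @ [(Some (), None)]"
  "x \<le> y \<Longrightarrow> conv_len x (Suc y) = conv_len x y @ [(None, Some ())]"
  by (auto simp: conv_len_eq nth_append max_def intro!: nth_equalityI)

lemma conv_run_sound:
  "foldl conv_step (Some (0, 0)) w = Some (x, y) \<Longrightarrow> w = conv_len x y"
proof (induction w arbitrary: x y rule: rev_induct)
  case Nil then show ?case by (simp add: conv_len_eq)
next
  case (snoc c w)
  obtain x' y' where s: "foldl conv_step (Some (0, 0)) w = Some (x', y')"
    using snoc.prems by (cases "foldl conv_step (Some (0, 0)) w") auto
  have w: "w = conv_len x' y'" by (rule snoc.IH[OF s])
  have "conv_step (Some (x', y')) c = Some (x, y)" using snoc.prems s by simp
  then show ?case unfolding w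
    by (auto simp: conv_step_def conv_len_snoc split: prod.splits option.splits if_splits)
qed

lemma conv_run_complete: "foldl conv_step (Some (0, 0)) (conv_len x y) = Some (x, y)"
proof -
  have diag: "foldl conv_step (Some (0, 0)) (conv_len x x) = Some (x, x)" for x
    by (induction x) (auto simp: conv_len_snoc(1) conv_len_eq[of 0 0])
  have "foldl conv_step (Some (0, 0)) (conv_len x (x + d)) = Some (x, x + d)" for x d
    by (induction d) (auto simp: diag conv_len_snoc(2,3))
  moreover have "foldl conv_step (Some (0, 0)) (conv_len (x + d) x) = Some (x + d, x)" for x d
    by (induction d) (auto simp: diag conv_len_snoc(2,3))
  ultimately show ?thesis by (metis le_iff_add linear)
qed

text \<open>The counting automaton is made finite by reducing the smaller length and the difference,
  the two quantities in which R is periodic. Reducing the two lengths separately would lose their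
  difference.\<close>

lemma regular_conv_if_eventually_periodic2:
  assumes per: "eventually_periodic2 N p R"
  shows "regular {conv u v | u v. R (length u) (length v)}"
proof -
  have p: "0 < p" using per by (simp add: eventually_periodic2_def)
  \<comment> \<open>A positive threshold makes 0 the only number reduced to 0.
    \<open>conv_step\<close> asks whether the two lengths agree, so the difference 0 must not be
    merged with the difference p.\<close>
  define M where "M = Suc N"
  have per': "eventually_periodic2 M p R"
    using eventually_periodic2_weaken[OF per, of M 1] by (simp add: M_def)
  define red where "red = cyc_red M p"
  have red0: "red d = 0 \<longleftrightarrow> d = 0" for d by (auto simp: red_def cyc_red_def M_def)
  have redS: "red (Suc (red x)) = red (Suc x)" for x by (simp add: red_def cyc_red_Suc)
  have red_idem: "red (red x) = red x" for x
    unfolding red_def by (metis cyc_red_add cyc_red_cases add.right_neutral mult_0)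
  define \<alpha> where "\<alpha> s = (case s of None \<Rightarrow> None | Some (x, y) \<Rightarrow>
     if x \<le> y then Some (red x, red x + red (y - x)) else Some (red y + red (x - y), red y))" for s
  have rl: "red x < M + p" for x using cyc_red_less[OF p] by (simp add: red_def)
  have rl2: "red x + red y < 2 * (M + p)" for x y using rl[of x] rl[of y] by simp
  have "range \<alpha> \<subseteq> insert None (Some ` ({..<2 * (M + p)} \<times> {..<2 * (M + p)}))"
  proof
    fix t assume "t \<in> range \<alpha>"
    then obtain s where "t = \<alpha> s" by blast
    moreover have "red x < 2 * (M + p)" for x using rl[of x] by simp
    ultimately show "t \<in> insert None (Some ` ({..<2 * (M + p)} \<times> {..<2 * (M + p)}))"
      using rl2 by (cases s) (force simp: \<alpha>_def split: if_splits)+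
  qed
  then have fin: "finite (range \<alpha>)" by (rule finite_subset) simp
  have \<alpha>_le: "\<alpha> (Some (x, x + d)) = Some (red x, red x + red d)" for x d
    by (simp add: \<alpha>_def)
  have \<alpha>_ge: "\<alpha> (Some (x + d, x)) = Some (red x + red d, red x)" for x d
    using red0 by (auto simp: \<alpha>_def)
  have step: "\<alpha> (conv_step (\<alpha> s) c) = \<alpha> (conv_step s c)" for s c
  proof (cases s)
    case None then show ?thesis by (simp add: \<alpha>_def)
  next
    case (Some xy)
    obtain x y where xy: "xy = (x, y)" by force
    obtain c1 c2 where c: "c = (c1, c2)" by force
    show ?thesis
    proof (cases "x \<le> y")
      case True
      then obtain d where d: "y = x + d" using le_Suc_ex by blast
      have "\<alpha> s = Some (red x, red x + red d)" by (simp only: Some xy d \<alpha>_le)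
      moreover have "\<alpha> (Some (Suc (red x), Suc (red x))) = \<alpha> (Some (Suc x, Suc x))"
        using \<alpha>_le[of _ 0] by (simp add: redS red_idem)
      moreover have "\<alpha> (Some (Suc (red x), red x)) = \<alpha> (Some (Suc x, x))"
        using \<alpha>_ge[of _ "Suc 0"] by (simp add: redS red_idem)
      moreover have "\<alpha> (Some (red x, Suc (red x + red d))) = \<alpha> (Some (x, Suc (x + d)))"
        using \<alpha>_le[of _ "Suc _"] by (simp add: redS red_idem)
      ultimately show ?thesis unfolding Some xy d c
        using red0[of d] red0[of 0] by (cases c1; cases c2; cases "d = 0") auto
    next
      case False
      then obtain d where "x = y + d" using le_Suc_ex[of y x] by auto
      then have d: "x = y + d" "0 < d" using False by auto
      then have "\<alpha> s = Some (red y + red d, red y)" by (simp only: Some xy d(1) \<alpha>_ge)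
      moreover have "\<alpha> (Some (Suc (red y + red d), red y)) = \<alpha> (Some (Suc (y + d), y))"
        using \<alpha>_ge[of _ "Suc _"] by (simp add: redS red_idem)
      moreover have "red d \<noteq> 0" using red0[of d] d(2) by simp
      ultimately show ?thesis unfolding Some xy d(1) c using d(2)
        by (cases c1; cases c2) auto
    qed
  qed
  define F where "F = {Some (x, y) | x y. R x y}"
  have R_red: "R (red x) (red x + red d) = R x (x + d) \<and> R (red x + red d) (red x) = R (x + d) x" for x d
  proof -
    obtain a k where k: "red x = a" "x = a + k * p" "k = 0 \<or> M \<le> a"
      unfolding red_def by (rule cyc_red_cases[of x M p]) blast
    obtain b l where l: "red d = b" "d = b + l * p" "l = 0 \<or> M \<le> b"
      unfolding red_def by (rule cyc_red_cases[of d M p]) blast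
    have 1: "R x (x + d) = R a (a + d) \<and> R (x + d) x = R (a + d) a"
    proof (cases "k = 0")
      case True then show ?thesis using k(2) by simp
    next
      case False
      then have "M \<le> a" using k(3) by simp
      then have "R (a + k * p) ((a + d) + k * p) = R a (a + d)"
        "R ((a + d) + k * p) (a + k * p) = R (a + d) a"
        using eventually_periodic2_mult(1)[OF per'] by simp_all
      then show ?thesis by (simp add: k(2) add_ac)
    qed
    have 2: "R a (a + d) = R a (a + b) \<and> R (a + d) a = R (a + b) a"
    proof (cases "l = 0")
      case True then show ?thesis using l(2) by simp
    next
      case False
      then have "M \<le> b" using l(3) by simp
      then have "R a ((a + b) + l * p) = R a (a + b)" "R ((a + b) + l * p) a = R (a + b) a"
        using eventually_periodic2_mult(2,3)[OF per'] by simp_all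
      then show ?thesis by (simp add: l(2) add_ac)
    qed
    show ?thesis using 1 2 k(1) l(1) by simp
  qed
  have F: "\<alpha> s \<in> F \<longleftrightarrow> s \<in> F" for s
  proof (cases s)
    case None then show ?thesis by (simp add: \<alpha>_def F_def)
  next
    case (Some xy)
    obtain x y where xy: "xy = (x, y)" by force
    show ?thesis
    proof (cases "x \<le> y")
      case True
      then obtain d where "y = x + d" using le_Suc_ex by blast
      then show ?thesis using R_red \<alpha>_le by (simp add: Some xy F_def)
    next
      case False
      then obtain d where "x = y + d" by (metis le_Suc_ex nat_le_linear)
      then show ?thesis using R_red \<alpha>_ge by (simp add: Some xy F_def)
    qed
  qed
  have "{conv u v | u v. R (length u) (length v)} = {w. foldl conv_step (Some (0, 0)) w \<in> F}"
  proof (intro set_eqI iffI)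
    fix w assume "w \<in> {conv u v | u v. R (length u) (length v)}"
    then show "w \<in> {w. foldl conv_step (Some (0, 0)) w \<in> F}"
      by (auto simp: conv_eq_conv_len conv_run_complete F_def)
  next
    fix w assume "w \<in> {w. foldl conv_step (Some (0, 0)) w \<in> F}"
    then obtain x y where "w = conv_len x y" "R x y"
      using conv_run_sound by (fastforce simp: F_def)
    then have "w = conv (replicate x ()) (replicate y ()) \<and>
        R (length (replicate x ())) (length (replicate y ()))" by (simp add: conv_len_def)
    then show "w \<in> {conv u v | u v. R (length u) (length v)}" by blast
  qed
  then show ?thesis
    using regular_if_finite_abstraction[where \<delta>' = conv_step, OF fin step F] by simp
qed

section \<open>From automata to periodicity\<close>

text \<open>By pigeonhole the orbit of q is periodic from some index at most n on, with a period d
  \<le> n. As d divides \<open>fact n\<close>, the same threshold and period serve all maps on n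
  states and all starting points.\<close>

lemma funpow_eventually_periodic:
  fixes f :: "nat \<Rightarrow> nat"
  assumes f: "\<And>q. q < n \<Longrightarrow> f q < n" and q: "q < n" and k: "n \<le> k"
  shows "(f ^^ (k + fact n)) q = (f ^^ k) q"
proof -
  have less: "(f ^^ i) q < n" for i by (induction i) (auto simp: q f)
  have "\<not> inj_on (\<lambda>i. (f ^^ i) q) {..n}"
  proof (rule pigeonhole)
    have "(\<lambda>i. (f ^^ i) q) ` {..n} \<subseteq> {..<n}" using less by auto
    then have "card ((\<lambda>i. (f ^^ i) q) ` {..n}) \<le> n" using card_mono[of "{..<n}"] by force
    then show "card {..n} > card ((\<lambda>i. (f ^^ i) q) ` {..n})" by simp
  qed
  then obtain i j where "i \<le> n" "j \<le> n" "i \<noteq> j" "(f ^^ i) q = (f ^^ j) q"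
    by (auto simp: inj_on_def)
  then obtain i d where id: "i + d \<le> n" "0 < d" "(f ^^ (i + d)) q = (f ^^ i) q"
  proof (cases "i < j")
    case True
    then show ?thesis using that[of i "j - i"] \<open>j \<le> n\<close> \<open>(f ^^ i) q = (f ^^ j) q\<close> by simp
  next
    case False
    then show ?thesis using that[of j "i - j"] \<open>i \<le> n\<close> \<open>i \<noteq> j\<close> \<open>(f ^^ i) q = (f ^^ j) q\<close> by simp
  qed
  have step: "(f ^^ (m + d)) q = (f ^^ m) q" if m: "i \<le> m" for m
  proof -
    obtain e where e: "m = e + i" using le_Suc_ex[OF m] by (auto simp: add.commute)
    have "(f ^^ (m + d)) q = (f ^^ e) ((f ^^ (i + d)) q)"
      unfolding e using funpow_add[of e "i + d" f] by (simp add: add.assoc)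
    also have "\<dots> = (f ^^ m) q" unfolding id(3) e by (simp add: funpow_add)
    finally show ?thesis .
  qed
  have steps: "(f ^^ (m + c * d)) q = (f ^^ m) q" if "i \<le> m" for m c
  proof (induction c)
    case (Suc c)
    have "(f ^^ ((m + c * d) + d)) q = (f ^^ (m + c * d)) q" using that by (intro step) simp
    then show ?case using Suc by (simp add: algebra_simps)
  qed simp
  have "d dvd (fact n :: nat)" using id by (intro dvd_fact) auto
  then obtain c where "fact n = c * d" by (metis dvd_def mult.commute)
  then show ?thesis using steps[of k c] id(1) k by simp
qed

lemma foldl_replicate: "foldl \<delta> q (replicate k c) = ((\<lambda>s. \<delta> s c) ^^ k) q"
  by (induction k arbitrary: q) (simp_all add: funpow_Suc_right del: funpow.simps(2))

text \<open>Reading \<open>conv_len\<close> iterates one transition map on the common prefix and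
  another on the overhang, so the two phases are periodic independently of each other.\<close>

lemma eventually_periodic2_if_regular_conv:
  assumes "regular {conv u v | u v. R (length u) (length v)}"
  shows "\<exists>N p. eventually_periodic2 N p R"
proof -
  obtain n :: nat and \<delta> F where n: "0 < n" and \<delta>: "\<And>q c. q < n \<Longrightarrow> \<delta> q c < n"
    and L: "{conv u v | u v. R (length u) (length v)} = {w. foldl \<delta> 0 w \<in> F}"
    using assms unfolding regular_def by blast
  have R: "R x y \<longleftrightarrow> foldl \<delta> 0 (conv_len x y) \<in> F" for x y
  proof -
    have "R x y \<longleftrightarrow> conv_len x y \<in> {conv u v | u v. R (length u) (length v)}"
    proof
      assume "R x y"
      then have "conv_len x y = conv (replicate x ()) (replicate y ()) \<and>
        R (length (replicate x ())) (length (replicate y ()))" by (simp add: conv_len_def)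
      then show "conv_len x y \<in> {conv u v | u v. R (length u) (length v)}" by blast
    qed (auto simp: conv_eq_conv_len conv_len_inject)
    then show ?thesis unfolding L by simp
  qed
  define a where "a = (\<lambda>s. \<delta> s (Some (), Some ()))"
  define b where "b = (\<lambda>s. \<delta> s (None, Some ()))"
  define c where "c = (\<lambda>s. \<delta> s (Some (), None))"
  have R1: "R x (x + d) \<longleftrightarrow> (b ^^ d) ((a ^^ x) 0) \<in> F" for x d
    by (simp add: R conv_len_add foldl_replicate a_def b_def)
  have R2: "R (x + d) x \<longleftrightarrow> (c ^^ d) ((a ^^ x) 0) \<in> F" for x d
    by (simp add: R conv_len_add foldl_replicate a_def c_def)
  have an: "(a ^^ x) 0 < n" for x by (induction x) (auto simp: n a_def \<delta>)
  have pa: "(a ^^ (x + fact n)) 0 = (a ^^ x) 0" if "n \<le> x" for x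
    by (rule funpow_eventually_periodic) (auto simp: a_def \<delta> n that)
  have pb: "(b ^^ (d + fact n)) q = (b ^^ d) q" if "n \<le> d" "q < n" for d q
    by (rule funpow_eventually_periodic) (auto simp: b_def \<delta> n that)
  have pc: "(c ^^ (d + fact n)) q = (c ^^ d) q" if "n \<le> d" "q < n" for d q
    by (rule funpow_eventually_periodic) (auto simp: c_def \<delta> n that)
  have 1: "R (x + fact n) (y + fact n) = R x y" if xy: "n \<le> x" "n \<le> y" for x y
  proof (cases "x \<le> y")
    case True
    then obtain d where d: "y = x + d" using le_Suc_ex by blast
    show ?thesis using R1[of "x + fact n" d] R1[of x d] pa[OF xy(1)] by (simp add: d algebra_simps)
  next
    case False
    then obtain d where d: "x = y + d" by (metis le_Suc_ex nat_le_linear)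
    show ?thesis using R2[of "y + fact n" d] R2[of y d] pa[OF xy(2)] by (simp add: d algebra_simps)
  qed
  have 2: "R x (y + fact n) = R x y" if xy: "x + n \<le> y" for x y
  proof -
    obtain d where d: "y = x + d" using le_Suc_ex[OF add_leD1[OF xy]] by blast
    then have "n \<le> d" using xy by simp
    then show ?thesis using R1[of x "d + fact n"] R1[of x d] pb[of d, OF _ an] by (simp add: d algebra_simps)
  qed
  have 3: "R (y + fact n) x = R y x" if xy: "x + n \<le> y" for x y
  proof -
    obtain d where d: "y = x + d" using le_Suc_ex[OF add_leD1[OF xy]] by blast
    then have "n \<le> d" using xy by simp
    then show ?thesis using R2[of x "d + fact n"] R2[of x d] pc[of d, OF _ an] by (simp add: d algebra_simps)
  qed
  have "eventually_periodic2 n (fact n) R"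
    unfolding eventually_periodic2_def using 1 2 3 by simp
  then show ?thesis by blast
qed

section \<open>A concrete description of the assembled graph\<close>

lemma graph_iso_trans:
  assumes "graph_iso V E W F" "graph_iso W F X G"
  shows "graph_iso V E X G"
proof -
  obtain f where f: "bij_betw f V W" "\<forall>x\<in>V. \<forall>y\<in>V. (x, y) \<in> E \<longleftrightarrow> (f x, f y) \<in> F"
    using assms(1) by (auto simp: graph_iso_def)
  obtain g where g: "bij_betw g W X" "\<forall>x\<in>W. \<forall>y\<in>W. (x, y) \<in> F \<longleftrightarrow> (g x, g y) \<in> G"
    using assms(2) by (auto simp: graph_iso_def)
  have "bij_betw (g \<circ> f) V X" using f(1) g(1) by (rule bij_betw_trans)
  moreover have "\<forall>x\<in>V. \<forall>y\<in>V. (x, y) \<in> E \<longleftrightarrow> ((g \<circ> f) x, (g \<circ> f) y) \<in> G"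
    using f g by (simp add: bij_betw_apply)
  ultimately show ?thesis unfolding graph_iso_def by blast
qed

lemma graph_iso_sym:
  assumes "graph_iso V E W F"
  shows "graph_iso W F V E"
proof -
  obtain f where f: "bij_betw f V W" "\<forall>x\<in>V. \<forall>y\<in>V. (x, y) \<in> E \<longleftrightarrow> (f x, f y) \<in> F"
    using assms by (auto simp: graph_iso_def)
  have "bij_betw (inv_into V f) W V" using f(1) by (rule bij_betw_inv_into)
  moreover have "\<forall>x\<in>W. \<forall>y\<in>W. (x, y) \<in> F \<longleftrightarrow> (inv_into V f x, inv_into V f y) \<in> E"
  proof (intro ballI)
    fix x y assume "x \<in> W" "y \<in> W"
    then have "inv_into V f x \<in> V" "f (inv_into V f x) = x" "inv_into V f y \<in> V" "f (inv_into V f y) = y"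
      using f(1) by (auto simp: bij_betw_def inv_into_into f_inv_into_f)
    then show "(x, y) \<in> F \<longleftrightarrow> (inv_into V f x, inv_into V f y) \<in> E" using f(2) by simp
  qed
  ultimately show ?thesis unfolding graph_iso_def by blast
qed

section \<open>Quotients and normal forms\<close>

lemma equiv_equiv_closure: "equiv V (equiv_closure V S)"
proof (rule equivI)
  show "equiv_closure V S \<subseteq> V \<times> V"
    unfolding equiv_closure_def by (auto dest: tranclD tranclD2)
  show "refl_on V (equiv_closure V S)"
    unfolding equiv_closure_def refl_on_def by auto
  have "sym ((S \<union> S\<inverse>) \<inter> (V \<times> V))" by (auto simp: sym_def)
  then have "sym (((S \<union> S\<inverse>) \<inter> (V \<times> V))\<^sup>+)" by (rule sym_trancl)
  then show "sym (equiv_closure V S)"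
    unfolding equiv_closure_def by (simp add: sym_Un sym_Id_on)
  show "trans (equiv_closure V S)"
    unfolding equiv_closure_def trans_def by (auto intro: trancl_trans)
qed

lemma equiv_closure_base: "(x, y) \<in> S \<Longrightarrow> x \<in> V \<Longrightarrow> y \<in> V \<Longrightarrow> (x, y) \<in> equiv_closure V S"
  unfolding equiv_closure_def by auto

text \<open>f is a normal form: constant along the generators, while every x is linked to the
  representative \<open>s (f x)\<close>. So the kernel of f is neither too small nor too
  large.\<close>

lemma equiv_closure_iff:
  assumes resp: "\<And>x y. (x, y) \<in> S \<Longrightarrow> x \<in> V \<Longrightarrow> y \<in> V \<Longrightarrow> f x = f y"
    and sec: "\<And>x. x \<in> V \<Longrightarrow> (x, s (f x)) \<in> equiv_closure V S"
    and "x \<in> V" "y \<in> V"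
  shows "(x, y) \<in> equiv_closure V S \<longleftrightarrow> f x = f y"
proof
  have "f x = f y" if "(x, y) \<in> ((S \<union> S\<inverse>) \<inter> (V \<times> V))\<^sup>+" for x y
    using that by (induction rule: trancl_induct) (use resp in fastforce)+
  then show "(x, y) \<in> equiv_closure V S \<Longrightarrow> f x = f y"
    by (auto simp: equiv_closure_def)
next
  assume "f x = f y"
  then have "(x, s (f x)) \<in> equiv_closure V S" "(y, s (f x)) \<in> equiv_closure V S"
    using sec[OF \<open>x \<in> V\<close>] sec[OF \<open>y \<in> V\<close>] by simp_all
  then show "(x, y) \<in> equiv_closure V S"
    using equiv_equiv_closure[of V S] by (meson equivE symD transD)
qed

text \<open>This trades classes for values of an invariant f, so that no later argument has to
  handle sets of sets.\<close>

lemma quot_graph_iso: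
  assumes E: "E \<subseteq> V \<times> V"
    and ker: "\<And>x y. x \<in> V \<Longrightarrow> y \<in> V \<Longrightarrow> (x, y) \<in> equiv_closure V S \<longleftrightarrow> f x = f y"
  shows "graph_iso (fst (quot_graph V E S)) (snd (quot_graph V E S))
    (f ` V) ((\<lambda>(x, y). (f x, f y)) ` E)"
proof -
  define R where "R = equiv_closure V S"
  have R: "equiv V R" unfolding R_def by (rule equiv_equiv_closure)
  define h where "h c = f (SOME x. x \<in> c)" for c
  have h: "h (R `` {x}) = f x" if "x \<in> V" for x
  proof -
    have "x \<in> R `` {x}" using R that by (rule equiv_class_self)
    then have "(SOME y. y \<in> R `` {x}) \<in> R `` {x}" by (rule someI)
    then have "(x, SOME y. y \<in> R `` {x}) \<in> R" by simp
    moreover from this have "(SOME y. y \<in> R `` {x}) \<in> V" using equiv_type[OF R] by blast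
    ultimately show ?thesis using ker[OF that] unfolding h_def R_def by metis
  qed
  have cls: "R `` {x} = R `` {y} \<longleftrightarrow> f x = f y" if "x \<in> V" "y \<in> V" for x y
    using ker[OF that] eq_equiv_class_iff[OF R that] by (simp add: R_def)
  have V: "fst (quot_graph V E S) = (\<lambda>x. R `` {x}) ` V"
    by (auto simp: quot_graph_def R_def Let_def quotient_def)
  have F: "snd (quot_graph V E S) = {(R `` {x}, R `` {y}) | x y. (x, y) \<in> E}"
    by (auto simp: quot_graph_def R_def Let_def)
  have "inj_on h ((\<lambda>x. R `` {x}) ` V)"
    by (auto simp: inj_on_def h cls)
  moreover have "h ` (\<lambda>x. R `` {x}) ` V = f ` V"
    unfolding image_image by (rule image_cong) (simp_all add: h)
  ultimately have "bij_betw h (fst (quot_graph V E S)) (f ` V)" by (simp add: V bij_betw_def)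
  moreover have "(R `` {x}, R `` {y}) \<in> snd (quot_graph V E S) \<longleftrightarrow>
      (h (R `` {x}), h (R `` {y})) \<in> (\<lambda>(x, y). (f x, f y)) ` E" if xy: "x \<in> V" "y \<in> V" for x y
  proof
    assume "(R `` {x}, R `` {y}) \<in> snd (quot_graph V E S)"
    then obtain u v where uv: "R `` {x} = R `` {u}" "R `` {y} = R `` {v}" "(u, v) \<in> E"
      by (auto simp: F)
    then have "u \<in> V" "v \<in> V" using E by auto
    then have "f x = f u" "f y = f v" using uv xy cls by simp_all
    then show "(h (R `` {x}), h (R `` {y})) \<in> (\<lambda>(x, y). (f x, f y)) ` E"
      using uv(3) h xy by (auto intro!: image_eqI[of _ _ "(u, v)"])
  next
    assume "(h (R `` {x}), h (R `` {y})) \<in> (\<lambda>(x, y). (f x, f y)) ` E"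
    then obtain u v where uv: "f x = f u" "f y = f v" "(u, v) \<in> E"
      using h xy by auto
    then have "u \<in> V" "v \<in> V" using E by auto
    then have "R `` {x} = R `` {u}" "R `` {y} = R `` {v}" using uv xy cls by simp_all
    then show "(R `` {x}, R `` {y}) \<in> snd (quot_graph V E S)"
      using uv(3) unfolding F by blast
  qed
  ultimately show ?thesis unfolding graph_iso_def V by blast
qed

fun att_verts :: "attachment \<Rightarrow> nat set" where "att_verts (T, \<eta>, t0, t1, g) = T"
fun att_edges :: "attachment \<Rightarrow> (nat \<times> nat) set" where "att_edges (T, \<eta>, t0, t1, g) = \<eta>"
fun att_fst :: "attachment \<Rightarrow> nat" where "att_fst (T, \<eta>, t0, t1, g) = t0"
fun att_snd :: "attachment \<Rightarrow> nat" where "att_snd (T, \<eta>, t0, t1, g) = t1"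
fun att_root :: "attachment \<Rightarrow> nat" where "att_root (T, \<eta>, t0, t1, g) = g"

definition valid_att :: "nat set \<Rightarrow> attachment \<Rightarrow> bool" where
  "valid_att G0 a \<longleftrightarrow> finite (att_verts a) \<and> att_edges a \<subseteq> att_verts a \<times> att_verts a \<and>
     att_fst a \<in> att_verts a \<and> att_snd a \<in> att_verts a \<and> att_root a \<in> G0"

text \<open>Normal form, after all identifications, of the vertex t in the j-th copy of the i-th
  template: Inl is a vertex of the core.\<close>
definition copy_place :: "nat \<Rightarrow> attachment \<Rightarrow> nat \<Rightarrow> nat \<Rightarrow> nat + nat \<times> nat \<times> nat" where
  "copy_place i a j t = (if t = att_fst a then
     if att_fst a = att_snd a \<or> j = 0 then Inl (att_root a) else Inr (i, j - 1, att_snd a)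
     else Inr (i, j, t))"

definition normal_verts :: "nat set \<Rightarrow> attachment list \<Rightarrow> (nat + nat \<times> nat \<times> nat) set" where
  "normal_verts G0 A = Inl ` G0 \<union>
     {Inr (i, j, t) | i j t. i < length A \<and> t \<in> att_verts (A ! i) \<and> t \<noteq> att_fst (A ! i)}"

definition normal_edges ::
    "(nat \<times> nat) set \<Rightarrow> attachment list \<Rightarrow> ((nat + nat \<times> nat \<times> nat) \<times> (nat + nat \<times> nat \<times> nat)) set" where
  "normal_edges E0 A = {(Inl x, Inl y) | x y. (x, y) \<in> E0} \<union>
     {(copy_place i (A ! i) j x, copy_place i (A ! i) j y) | i j x y.
        i < length A \<and> (x, y) \<in> att_edges (A ! i)}"

definition att_rel :: "attachment \<Rightarrow> ((nat \<times> nat) \<times> (nat \<times> nat)) set" where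
  "att_rel a = equiv_closure (UNIV \<times> att_verts a) {((j, att_snd a), (Suc j, att_fst a)) | j. True}"

text \<open>The same choice of representatives as in \<open>copy_place\<close>, but before the root
  is glued to the core: the class of the root is represented by t0 in copy 0.\<close>

definition copy_rep :: "attachment \<Rightarrow> nat \<times> nat \<Rightarrow> nat \<times> nat" where
  "copy_rep a = (\<lambda>(j, t). if t = att_fst a then
     if att_fst a = att_snd a \<or> j = 0 then (0, att_fst a) else (j - 1, att_snd a) else (j, t))"

lemma att_rel_iff:
  assumes a: "valid_att G0 a" and x: "x \<in> UNIV \<times> att_verts a" and y: "y \<in> UNIV \<times> att_verts a"
  shows "(x, y) \<in> att_rel a \<longleftrightarrow> copy_rep a x = copy_rep a y"
  unfolding att_rel_def
proof (rule equiv_closure_iff[where s = id])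
  fix x y assume "(x, y) \<in> {((j, att_snd a), (Suc j, att_fst a)) | j. True}"
  then show "copy_rep a x = copy_rep a y" by (auto simp: copy_rep_def)
next
  let ?V = "(UNIV :: nat set) \<times> att_verts a"
  let ?R = "equiv_closure ?V {((j, att_snd a), (Suc j, att_fst a)) | j. True}"
  have eq: "equiv ?V ?R" by (rule equiv_equiv_closure)
  have refl: "(x, x) \<in> ?R" if "x \<in> ?V" for x using eq that by (meson equivE refl_onD)
  have glue: "((j, att_snd a), (Suc j, att_fst a)) \<in> ?R" for j
    using a by (intro equiv_closure_base) (auto simp: valid_att_def)
  have glue': "((Suc j, att_fst a), (j, att_snd a)) \<in> ?R" for j
    using glue eq by (meson equivE symD)
  fix x assume x: "x \<in> ?V"
  obtain j t where jt: "x = (j, t)" by force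
  \<comment> \<open>Only a star has long chains of gluings, which lead from copy j of t0 down to
    copy 0. In a path every class has at most two elements, and a single gluing suffices.\<close>
  have root: "((j, att_fst a), (0, att_fst a)) \<in> ?R" if star: "att_fst a = att_snd a" for j
  proof (induction j)
    case 0 then show ?case using a by (intro refl) (auto simp: valid_att_def)
  next
    case (Suc j)
    have "((Suc j, att_fst a), (j, att_fst a)) \<in> ?R" using glue'[of j] star by simp
    then show ?case using Suc eq by (meson equivE transD)
  qed
  show "(x, id (copy_rep a x)) \<in> ?R"
  proof (cases "t = att_fst a")
    case False then show ?thesis using refl[OF x] by (simp add: jt copy_rep_def)
  next
    case t: True
    show ?thesis
    proof (cases "att_fst a = att_snd a")
      case True then show ?thesis using root t by (simp add: jt copy_rep_def)
    next
      case False
      then show ?thesis using t refl[OF x] glue'[of "j - 1"]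
        by (cases j) (auto simp: jt copy_rep_def)
    qed
  qed
qed (use x y in auto)

lemma copy_place_rep:
  "copy_place i a j t = (case copy_rep a (j, t) of (j', t') \<Rightarrow>
     if t' = att_fst a then Inl (att_root a) else Inr (i, j', t'))"
  by (auto simp: copy_place_def copy_rep_def)

lemma copy_place_in_normal_verts:
  assumes "valid_att G0 (A ! i)" "i < length A" "t \<in> att_verts (A ! i)"
  shows "copy_place i (A ! i) j t \<in> normal_verts G0 A"
  using assms by (auto simp: copy_place_def normal_verts_def valid_att_def)

lemma assemble_unfold:
  "assemble G0 E0 A = quot_graph
     (Inl ` G0 \<union> {Inr (i, att_rel (A ! i) `` {(j, t)}) | i j t. i < length A \<and> t \<in> att_verts (A ! i)})
     ({(Inl x, Inl y) | x y. (x, y) \<in> E0} \<union>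
       {(Inr (i, att_rel (A ! i) `` {(j, x)}), Inr (i, att_rel (A ! i) `` {(j, y)})) | i j x y.
         i < length A \<and> (x, y) \<in> att_edges (A ! i)})
     {(Inr (i, att_rel (A ! i) `` {(0, att_fst (A ! i))}), Inl (att_root (A ! i))) | i. i < length A}"
proof -
  have V: "(case a of (T, \<eta>, t0, t1, g) \<Rightarrow> (\<lambda>c. Inr (i, c)) ` fst (S_graph T \<eta> t0 t1)) =
      {Inr (i, att_rel a `` {(j, t)}) | j t. t \<in> att_verts a}" for i :: nat and a :: attachment
    by (cases a) (auto simp: S_graph_def quot_graph_def Let_def att_rel_def quotient_def)
  have E: "(case a of (T, \<eta>, t0, t1, g) \<Rightarrow> (\<lambda>(c, d). (Inr (i, c), Inr (i, d))) ` snd (S_graph T \<eta> t0 t1)) =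
      {(Inr (i, att_rel a `` {(j, x)}), Inr (i, att_rel a `` {(j, y)})) | j x y. (x, y) \<in> att_edges a}"
    for i :: nat and a :: attachment
    by (cases a) (auto simp: S_graph_def quot_graph_def Let_def att_rel_def image_iff; blast)
  have r: "(case a of (T, \<eta>, t0, t1, g) \<Rightarrow> S_root T \<eta> t0 t1) = att_rel a `` {(0, att_fst a)}" for a
    by (cases a) (simp add: S_root_def att_rel_def)
  have g: "(case a of (T, \<eta>, t0, t1, g) \<Rightarrow> g) = att_root a" for a :: attachment
    by (cases a) simp
  have I: "(\<lambda>(x, y). (Inl x, Inl y)) ` E0 = {(Inl x, Inl y) | x y. (x, y) \<in> E0}" by auto
  show ?thesis
    unfolding assemble_def V E r g I
    by (rule arg_cong3[where f = quot_graph]) blast+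
qed

text \<open>Both quotients are undone in one step. On the disjoint union, f evaluates
  \<open>copy_place\<close> at an arbitrary member of the class, and s turns a normal form back into
  a class; \<open>equiv_closure_iff\<close> then identifies the kernel of f.\<close>

lemma assemble_iso_normal:
  assumes E0: "E0 \<subseteq> G0 \<times> G0" and A: "\<And>a. a \<in> set A \<Longrightarrow> valid_att G0 a"
  shows "graph_iso (fst (assemble G0 E0 A)) (snd (assemble G0 E0 A))
    (normal_verts G0 A) (normal_edges E0 A)"
proof -
  have Ai: "valid_att G0 (A ! i)" if "i < length A" for i using A that by simp
  define cls where "cls i j t = att_rel (A ! i) `` {(j, t)}" for i j t
  define V :: "avert set" where
    "V = Inl ` G0 \<union> {Inr (i, cls i j t) | i j t. i < length A \<and> t \<in> att_verts (A ! i)}"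
  define E :: "(avert \<times> avert) set" where "E = {(Inl x, Inl y) | x y. (x, y) \<in> E0} \<union>
       {(Inr (i, cls i j x), Inr (i, cls i j y)) | i j x y. i < length A \<and> (x, y) \<in> att_edges (A ! i)}"
  define S :: "(avert \<times> avert) set" where
    "S = {(Inr (i, cls i 0 (att_fst (A ! i))), Inl (att_root (A ! i))) | i. i < length A}"
  have as: "assemble G0 E0 A = quot_graph V E S"
    unfolding assemble_unfold V_def E_def S_def cls_def by simp
  define f :: "avert \<Rightarrow> nat + nat \<times> nat \<times> nat" where "f v = (case v of Inl g \<Rightarrow> Inl g
    | Inr (i, c) \<Rightarrow> (case (SOME x. x \<in> c) of (j, t) \<Rightarrow> copy_place i (A ! i) j t))" for v
  have [simp]: "f (Inl g) = Inl g" for g by (simp add: f_def)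
  have cls_iff: "cls i j t = cls i j' t' \<longleftrightarrow> copy_rep (A ! i) (j, t) = copy_rep (A ! i) (j', t')"
    if "i < length A" "t \<in> att_verts (A ! i)" "t' \<in> att_verts (A ! i)" for i j t j' t'
  proof -
    have "equiv (UNIV \<times> att_verts (A ! i)) (att_rel (A ! i))"
      unfolding att_rel_def by (rule equiv_equiv_closure)
    then show ?thesis unfolding cls_def
      using att_rel_iff[OF Ai] that by (simp add: eq_equiv_class_iff)
  qed
  have f_cls: "f (Inr (i, cls i j t)) = copy_place i (A ! i) j t"
    if i: "i < length A" and t: "t \<in> att_verts (A ! i)" for i j t
  proof -
    obtain j' t' where s: "(SOME x. x \<in> cls i j t) = (j', t')" by force
    have eq: "equiv (UNIV \<times> att_verts (A ! i)) (att_rel (A ! i))"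
      unfolding att_rel_def by (rule equiv_equiv_closure)
    then have "(j, t) \<in> cls i j t" unfolding cls_def using t by (intro equiv_class_self) auto
    then have "(SOME x. x \<in> cls i j t) \<in> cls i j t" by (rule someI)
    then have r: "((j, t), (j', t')) \<in> att_rel (A ! i)" unfolding s by (simp add: cls_def)
    then have "t' \<in> att_verts (A ! i)" using equiv_type[OF eq] by auto
    then have "copy_rep (A ! i) (j, t) = copy_rep (A ! i) (j', t')"
      using att_rel_iff[OF Ai[OF i]] r t by auto
    then show ?thesis by (simp add: f_def s copy_place_rep)
  qed
  define s :: "nat + nat \<times> nat \<times> nat \<Rightarrow> avert" where
    "s w = (case w of Inl g \<Rightarrow> Inl g | Inr (i, j, t) \<Rightarrow> Inr (i, cls i j t))" for w
  have ker: "(x, y) \<in> equiv_closure V S \<longleftrightarrow> f x = f y" if "x \<in> V" "y \<in> V" for x y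
  proof (rule equiv_closure_iff[where s = s])
    fix x y assume "(x, y) \<in> S"
    then obtain i where i: "i < length A" "x = Inr (i, cls i 0 (att_fst (A ! i)))"
      "y = Inl (att_root (A ! i))" by (auto simp: S_def)
    have "f x = copy_place i (A ! i) 0 (att_fst (A ! i))"
      unfolding i(2) using i(1) Ai[OF i(1)] by (intro f_cls) (auto simp: valid_att_def)
    then show "f x = f y" by (simp add: i(3) copy_place_def)
  next
    have refl: "(x, x) \<in> equiv_closure V S" if "x \<in> V" for x
      using equiv_equiv_closure that by (meson equivE refl_onD)
    fix x assume x: "x \<in> V"
    show "(x, s (f x)) \<in> equiv_closure V S"
    proof (cases x)
      case (Inl g)
      then show ?thesis using refl[OF x] by (simp add: s_def)
    next
      case (Inr q)
      then obtain i j t where q: "x = Inr (i, cls i j t)" "i < length A" "t \<in> att_verts (A ! i)"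
        using x by (auto simp: V_def)
      note v = Ai[OF q(2), unfolded valid_att_def]
      obtain j' t' where r: "copy_rep (A ! i) (j, t) = (j', t')" by force
      have t': "t' \<in> att_verts (A ! i)" and rr: "copy_rep (A ! i) (j', t') = (j', t')"
        and root: "t' = att_fst (A ! i) \<Longrightarrow> j' = 0"
        using r q(3) v by (auto simp: copy_rep_def split: if_splits)
      have c: "cls i j t = cls i j' t'" using cls_iff[OF q(2,3) t'] r rr by simp
      have fx: "f x = (if t' = att_fst (A ! i) then Inl (att_root (A ! i)) else Inr (i, j', t'))"
        unfolding q(1) f_cls[OF q(2,3)] copy_place_rep r by simp
      show ?thesis
      proof (cases "t' = att_fst (A ! i)")
        case True
        then have xx: "x = Inr (i, cls i 0 (att_fst (A ! i)))" using root c q(1) by simp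
        have "(x, Inl (att_root (A ! i))) \<in> S" unfolding xx S_def using q(2) by blast
        moreover have "Inl (att_root (A ! i)) \<in> V" using v by (simp add: V_def)
        ultimately show ?thesis using True fx x by (simp add: s_def equiv_closure_base)
      next
        case False
        then have "s (f x) = x" using fx c q(1) by (simp add: s_def)
        then show ?thesis using refl[OF x] by simp
      qed
    qed
  qed (use that in auto)
  have EV: "E \<subseteq> V \<times> V"
  proof -
    have "(x, y) \<in> V \<times> V" if xy: "(x, y) \<in> E" for x y
    proof -
      consider u v where "x = Inl u" "y = Inl v" "(u, v) \<in> E0"
        | i j u v where "x = Inr (i, cls i j u)" "y = Inr (i, cls i j v)" "i < length A"
          "(u, v) \<in> att_edges (A ! i)" using xy by (auto simp: E_def)
      then show ?thesis
      proof cases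
        case 1 then show ?thesis using E0 by (auto simp: V_def)
      next
        case 2
        then have "u \<in> att_verts (A ! i)" "v \<in> att_verts (A ! i)"
          using Ai[OF 2(3)] by (auto simp: valid_att_def)
        then show ?thesis using 2 unfolding V_def by blast
      qed
    qed
    then show ?thesis by auto
  qed
  have fV: "f ` V = normal_verts G0 A"
  proof (intro equalityI subsetI)
    fix w assume "w \<in> f ` V"
    then obtain x where x: "x \<in> V" "w = f x" by blast
    then consider g where "x = Inl g" "g \<in> G0"
      | i j t where "x = Inr (i, cls i j t)" "i < length A" "t \<in> att_verts (A ! i)"
      by (auto simp: V_def)
    then show "w \<in> normal_verts G0 A"
    proof cases
      case 1 then show ?thesis using x by (simp add: normal_verts_def)
    next
      case 2
      then show ?thesis using x(2) f_cls copy_place_in_normal_verts[OF Ai] by simp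
    qed
  next
    fix w assume "w \<in> normal_verts G0 A"
    then consider g where "w = Inl g" "g \<in> G0"
      | i j t where "w = Inr (i, j, t)" "i < length A" "t \<in> att_verts (A ! i)" "t \<noteq> att_fst (A ! i)"
      by (auto simp: normal_verts_def)
    then show "w \<in> f ` V"
    proof cases
      case 1 
      then have "w = f (Inl g)" "Inl g \<in> V" by (auto simp: V_def)
      then show ?thesis by (rule image_eqI)
    next
      case 2
      then have "w = f (Inr (i, cls i j t))" by (simp add: f_cls copy_place_def)
      moreover have "Inr (i, cls i j t) \<in> V" using 2 unfolding V_def by blast
      ultimately show ?thesis by (rule image_eqI)
    qed
  qed
  have fE: "(\<lambda>(x, y). (f x, f y)) ` E = normal_edges E0 A"
  proof (intro equalityI subsetI)
    fix e assume "e \<in> (\<lambda>(x, y). (f x, f y)) ` E"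
    then obtain x y where xy: "(x, y) \<in> E" "e = (f x, f y)" by auto
    then consider u v where "x = Inl u" "y = Inl v" "(u, v) \<in> E0"
      | i j u v where "x = Inr (i, cls i j u)" "y = Inr (i, cls i j v)" "i < length A"
        "(u, v) \<in> att_edges (A ! i)" by (auto simp: E_def)
    then show "e \<in> normal_edges E0 A"
    proof cases
      case 1 then show ?thesis using xy(2) by (simp add: normal_edges_def)
    next
      case 2
      then have "u \<in> att_verts (A ! i)" "v \<in> att_verts (A ! i)"
        using Ai[OF 2(3)] by (auto simp: valid_att_def)
      then have "e = (copy_place i (A ! i) j u, copy_place i (A ! i) j v)"
        using xy(2) 2 by (simp add: f_cls)
      then show ?thesis using 2(3,4) unfolding normal_edges_def by blast
    qed
  next
    fix e assume "e \<in> normal_edges E0 A"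
    then consider u v where "e = (Inl u, Inl v)" "(u, v) \<in> E0"
      | i j u v where "e = (copy_place i (A ! i) j u, copy_place i (A ! i) j v)" "i < length A"
        "(u, v) \<in> att_edges (A ! i)" unfolding normal_edges_def by blast
    then show "e \<in> (\<lambda>(x, y). (f x, f y)) ` E"
    proof cases
      case 1 
      then have "e = (\<lambda>(x, y). (f x, f y)) (Inl u, Inl v)" "(Inl u, Inl v) \<in> E" 
        by (auto simp: E_def)
      then show ?thesis by (rule image_eqI)
    next
      case 2
      then have "u \<in> att_verts (A ! i)" "v \<in> att_verts (A ! i)"
        using Ai[OF 2(2)] by (auto simp: valid_att_def)
      then have "e = (\<lambda>(x, y). (f x, f y)) (Inr (i, cls i j u), Inr (i, cls i j v))"
        using 2 by (simp add: f_cls)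
      moreover have "(Inr (i, cls i j u), Inr (i, cls i j v)) \<in> E" using 2 unfolding E_def by blast
      ultimately show ?thesis by (rule image_eqI)
    qed
  qed
  show ?thesis unfolding as using quot_graph_iso[OF EV ker] by (simp add: fV fE)
qed

section \<open>Assembled graphs are presentable\<close>

lemma unary_FA_presentable_iso:
  assumes iso: "graph_iso V E W F" and pres: "unary_FA_presentable V E" 
  shows "unary_FA_presentable W F"
proof -
  obtain f where f: "bij_betw f V W" "\<forall>x\<in>V. \<forall>y\<in>V. (x, y) \<in> E \<longleftrightarrow> (f x, f y) \<in> F"
    using iso by (auto simp: graph_iso_def)
  obtain L \<phi> where L: "regular L" "\<phi> ` L = V"
    "regular {conv u v | u v. u \<in> L \<and> v \<in> L \<and> \<phi> u = \<phi> v}"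
    "regular {conv u v | u v. u \<in> L \<and> v \<in> L \<and> (\<phi> u, \<phi> v) \<in> E}"
    using pres by (auto simp: unary_FA_presentable_def)
  have in_V: "u \<in> L \<Longrightarrow> \<phi> u \<in> V" for u using L(2) by blast
  have "(f \<circ> \<phi>) ` L = W" using L(2) f(1) by (metis bij_betw_def image_comp)
  moreover have "{conv u v | u v. u \<in> L \<and> v \<in> L \<and> (f \<circ> \<phi>) u = (f \<circ> \<phi>) v} =
      {conv u v | u v. u \<in> L \<and> v \<in> L \<and> \<phi> u = \<phi> v}"
    using in_V f(1) by (auto simp: bij_betw_def inj_on_eq_iff; metis)
  moreover have "{conv u v | u v. u \<in> L \<and> v \<in> L \<and> ((f \<circ> \<phi>) u, (f \<circ> \<phi>) v) \<in> F} =
      {conv u v | u v. u \<in> L \<and> v \<in> L \<and> (\<phi> u, \<phi> v) \<in> E}"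
    using in_V f(2) by (auto; metis)
  ultimately show ?thesis unfolding unary_FA_presentable_def
    using L(1,3,4) by (intro exI[of _ L] exI[of _ "f \<circ> \<phi>"]) simp
qed

lemma unary_FA_presentable_if_code:
  fixes code :: "'a \<Rightarrow> nat"
  assumes inj: "inj_on code V"
    and V: "eventually_periodic N p (\<lambda>x. x \<in> code ` V)"
    and E: "eventually_periodic2 N p (\<lambda>x y. \<exists>v\<in>V. \<exists>w\<in>V. code v = x \<and> code w = y \<and> (v, w) \<in> E)"
  shows "unary_FA_presentable V E"
proof -
  define L :: "unit list set" where "L = {u. length u \<in> code ` V}"
  define \<phi> where "\<phi> = (\<lambda>u :: unit list. inv_into V code (length u))"
  have \<phi>: "\<phi> u \<in> V \<and> code (\<phi> u) = length u" if "u \<in> L" for u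
    using that by (auto simp: L_def \<phi>_def inv_into_into f_inv_into_f)
  have code_\<phi>: "\<phi> u = v" if "v \<in> V" "code v = length u" for u v
    using that inj by (metis \<phi>_def inv_into_f_f)
  have "regular L" unfolding L_def using V by (rule regular_unary_if_eventually_periodic)
  moreover have "\<phi> ` L = V"
  proof (intro equalityI subsetI)
    fix v assume "v \<in> V"
    then have "replicate (code v) () \<in> L" "\<phi> (replicate (code v) ()) = v"
      using code_\<phi> by (auto simp: L_def)
    then show "v \<in> \<phi> ` L" by (metis image_eqI)
  qed (use \<phi> in auto)
  moreover have "regular {conv u v | u v. u \<in> L \<and> v \<in> L \<and> \<phi> u = \<phi> v}"
  proof -
    have *: "u \<in> L \<and> v \<in> L \<and> \<phi> u = \<phi> v \<longleftrightarrow> length u \<in> code ` V \<and> length u = length v" for u v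
    proof
      assume "u \<in> L \<and> v \<in> L \<and> \<phi> u = \<phi> v"
      then show "length u \<in> code ` V \<and> length u = length v" using \<phi>[of u] \<phi>[of v] by (auto simp: L_def)
    next
      assume "length u \<in> code ` V \<and> length u = length v"
      then show "u \<in> L \<and> v \<in> L \<and> \<phi> u = \<phi> v"
        unfolding L_def \<phi>_def by (metis mem_Collect_eq)
    qed
    \<comment> \<open>With the positive threshold \<open>Suc N\<close> the one-sided clauses only
      concern x \<noteq> y, where equality fails before and after the shift.\<close>
    have "eventually_periodic2 (Suc N) p (\<lambda>x y. x \<in> code ` V \<and> x = y)"
      using V unfolding eventually_periodic2_def eventually_periodic_def by auto
    then show ?thesis unfolding * by (rule regular_conv_if_eventually_periodic2)
  qed
  moreover have "regular {conv u v | u v. u \<in> L \<and> v \<in> L \<and> (\<phi> u, \<phi> v) \<in> E}"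
  proof -
    have *: "u \<in> L \<and> v \<in> L \<and> (\<phi> u, \<phi> v) \<in> E \<longleftrightarrow>
        (\<exists>x\<in>V. \<exists>y\<in>V. code x = length u \<and> code y = length v \<and> (x, y) \<in> E)" for u v
    proof
      assume "u \<in> L \<and> v \<in> L \<and> (\<phi> u, \<phi> v) \<in> E"
      then show "\<exists>x\<in>V. \<exists>y\<in>V. code x = length u \<and> code y = length v \<and> (x, y) \<in> E" using \<phi> by blast
    next
      assume "\<exists>x\<in>V. \<exists>y\<in>V. code x = length u \<and> code y = length v \<and> (x, y) \<in> E"
      then obtain x y where "x \<in> V" "y \<in> V" "code x = length u" "code y = length v" "(x, y) \<in> E" by blast
      moreover from this have "\<phi> u = x" "\<phi> v = y" using code_\<phi> by auto
      ultimately show "u \<in> L \<and> v \<in> L \<and> (\<phi> u, \<phi> v) \<in> E" 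
        unfolding L_def by (metis image_eqI mem_Collect_eq)
    qed
    show ?thesis unfolding * using E by (rule regular_conv_if_eventually_periodic2)
  qed
  ultimately show ?thesis unfolding unary_FA_presentable_def by blast
qed

section \<open>Edges under a shift of the copy index\<close>

lemma copy_place_Suc:
  "copy_place k a l x = Inr (i, j, t) \<Longrightarrow> copy_place k a (Suc l) x = Inr (i, Suc j, t)"
  by (auto simp: copy_place_def split: if_splits)

lemma copy_place_Suc_imp:
  assumes "copy_place k a l x = Inr (i, Suc j, t)"
  shows "\<exists>l'. l = Suc l' \<and> copy_place k a l' x = Inr (i, j, t)"
proof (cases "x = att_fst a")
  case True
  then have "k = i" "l - 1 = Suc j" "t = att_snd a" "att_fst a \<noteq> att_snd a"
    using assms by (auto simp: copy_place_def split: if_splits)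
  then have "l = Suc (Suc j) \<and> copy_place k a (Suc j) x = Inr (i, j, t)"
    using True by (simp add: copy_place_def)
  then show ?thesis by blast
next
  case False
  then show ?thesis using assms by (simp add: copy_place_def)
qed

lemma copy_place_bounds: "copy_place k a l x = Inr (i, j, t) \<Longrightarrow> j \<le> l \<and> l \<le> Suc j"
  by (auto simp: copy_place_def split: if_splits)

lemma copy_place_Inl: "copy_place k a (Suc l) x = Inl g \<longleftrightarrow> x = att_fst a \<and> att_fst a = att_snd a \<and> g = att_root a"
  by (auto simp: copy_place_def)

lemma normal_edgesE:
  assumes "(v, w) \<in> normal_edges E0 A"
  obtains (core) x y where "v = Inl x" "w = Inl y" "(x, y) \<in> E0"
  | (copy) k l x y where "v = copy_place k (A ! k) l x" "w = copy_place k (A ! k) l y"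
      "k < length A" "(x, y) \<in> att_edges (A ! k)"
  using assms unfolding normal_edges_def by blast

lemma normal_edges_copyI:
  "k < length A \<Longrightarrow> (x, y) \<in> att_edges (A ! k) \<Longrightarrow>
    (copy_place k (A ! k) l x, copy_place k (A ! k) l y) \<in> normal_edges E0 A"
  unfolding normal_edges_def by blast

text \<open>An edge outside the core comes from a template edge in some copy l, and the same
  template edge in the neighbouring copy gives the shifted edge. In a path t0 of copy l is filed
  under copy l - 1, but consistently so for all l > 0.\<close>

lemma normal_edges_Suc_Suc:
  "(Inr (i, Suc j, t), Inr (i', Suc j', t')) \<in> normal_edges E0 A \<longleftrightarrow>
    (Inr (i, j, t), Inr (i', j', t')) \<in> normal_edges E0 A"
proof
  assume "(Inr (i, Suc j, t), Inr (i', Suc j', t')) \<in> normal_edges E0 A"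
  then show "(Inr (i, j, t), Inr (i', j', t')) \<in> normal_edges E0 A"
  proof (cases rule: normal_edgesE)
    case (copy k l x y)
    then obtain l1 l2 where "l = Suc l1" "copy_place k (A ! k) l1 x = Inr (i, j, t)"
      "l = Suc l2" "copy_place k (A ! k) l2 y = Inr (i', j', t')"
      by (metis copy_place_Suc_imp)
    then show ?thesis using normal_edges_copyI[OF copy(3,4), of l1] by simp
  qed auto
next
  assume "(Inr (i, j, t), Inr (i', j', t')) \<in> normal_edges E0 A"
  then show "(Inr (i, Suc j, t), Inr (i', Suc j', t')) \<in> normal_edges E0 A"
  proof (cases rule: normal_edgesE)
    case (copy k l x y)
    then show ?thesis using normal_edges_copyI[OF copy(3,4), of "Suc l"] by (metis copy_place_Suc)
  qed auto
qed

text \<open>From copy 1 on, only centres of shallow stars are core vertices with edges to a copy,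
  and for them the copy index is irrelevant. Copy 0 is excluded because bases of periodic paths have
  edges into it. The converse relation is included so that both directions of edges are treated at
  once.\<close>

lemma normal_edges_Inl_Suc:
  assumes "F = normal_edges E0 A \<or> F = (normal_edges E0 A)\<inverse>"
  shows "(Inl g, Inr (i, Suc (Suc j), t)) \<in> F \<longleftrightarrow> (Inl g, Inr (i, Suc j, t)) \<in> F"
proof -
  have 1: "(Inl g, Inr (i, Suc j, t)) \<in> normal_edges E0 A \<longleftrightarrow>
    (\<exists>k x y. k < length A \<and> (x, y) \<in> att_edges (A ! k) \<and> x = att_fst (A ! k) \<and>
      att_fst (A ! k) = att_snd (A ! k) \<and> g = att_root (A ! k) \<and> y \<noteq> att_fst (A ! k) \<and> i = k \<and> t = y)" for j
  proof
    assume "(Inl g, Inr (i, Suc j, t)) \<in> normal_edges E0 A"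
    then show "\<exists>k x y. k < length A \<and> (x, y) \<in> att_edges (A ! k) \<and> x = att_fst (A ! k) \<and>
      att_fst (A ! k) = att_snd (A ! k) \<and> g = att_root (A ! k) \<and> y \<noteq> att_fst (A ! k) \<and> i = k \<and> t = y"
    proof (cases rule: normal_edgesE)
      case (copy k l x y)
      then obtain l' where "l = Suc l'" by (metis copy_place_Suc_imp)
      then have "x = att_fst (A ! k) \<and> att_fst (A ! k) = att_snd (A ! k) \<and> g = att_root (A ! k)"
        using copy(1) by (metis copy_place_Inl)
      moreover from this have "y \<noteq> att_fst (A ! k) \<and> i = k \<and> t = y"
        using copy(2) by (auto simp: copy_place_def split: if_splits)
      ultimately show ?thesis using copy(3,4) by blast
    qed auto
  next
    assume "\<exists>k x y. k < length A \<and> (x, y) \<in> att_edges (A ! k) \<and> x = att_fst (A ! k) \<and>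
      att_fst (A ! k) = att_snd (A ! k) \<and> g = att_root (A ! k) \<and> y \<noteq> att_fst (A ! k) \<and> i = k \<and> t = y"
    then obtain k x y where k: "k < length A" "(x, y) \<in> att_edges (A ! k)" "x = att_fst (A ! k)"
      "att_fst (A ! k) = att_snd (A ! k)" "g = att_root (A ! k)" "y \<noteq> att_fst (A ! k)" "i = k" "t = y"
      by blast
    then have "copy_place k (A ! k) (Suc j) x = Inl g" "copy_place k (A ! k) (Suc j) y = Inr (i, Suc j, t)"
      by (auto simp: copy_place_def)
    then show "(Inl g, Inr (i, Suc j, t)) \<in> normal_edges E0 A"
      using normal_edges_copyI[OF k(1,2), of "Suc j"] by simp
  qed
  have 2: "(Inr (i, Suc j, t), Inl g) \<in> normal_edges E0 A \<longleftrightarrow>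
    (\<exists>k x y. k < length A \<and> (x, y) \<in> att_edges (A ! k) \<and> y = att_fst (A ! k) \<and>
      att_fst (A ! k) = att_snd (A ! k) \<and> g = att_root (A ! k) \<and> x \<noteq> att_fst (A ! k) \<and> i = k \<and> t = x)" for j
  proof
    assume "(Inr (i, Suc j, t), Inl g) \<in> normal_edges E0 A"
    then show "\<exists>k x y. k < length A \<and> (x, y) \<in> att_edges (A ! k) \<and> y = att_fst (A ! k) \<and>
      att_fst (A ! k) = att_snd (A ! k) \<and> g = att_root (A ! k) \<and> x \<noteq> att_fst (A ! k) \<and> i = k \<and> t = x"
    proof (cases rule: normal_edgesE)
      case (copy k l x y)
      then obtain l' where "l = Suc l'" by (metis copy_place_Suc_imp)
      then have "y = att_fst (A ! k) \<and> att_fst (A ! k) = att_snd (A ! k) \<and> g = att_root (A ! k)"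
        using copy(2) by (metis copy_place_Inl)
      moreover from this have "x \<noteq> att_fst (A ! k) \<and> i = k \<and> t = x"
        using copy(1) by (auto simp: copy_place_def split: if_splits)
      ultimately show ?thesis using copy(3,4) by blast
    qed auto
  next
    assume "\<exists>k x y. k < length A \<and> (x, y) \<in> att_edges (A ! k) \<and> y = att_fst (A ! k) \<and>
      att_fst (A ! k) = att_snd (A ! k) \<and> g = att_root (A ! k) \<and> x \<noteq> att_fst (A ! k) \<and> i = k \<and> t = x"
    then obtain k x y where k: "k < length A" "(x, y) \<in> att_edges (A ! k)" "y = att_fst (A ! k)"
      "att_fst (A ! k) = att_snd (A ! k)" "g = att_root (A ! k)" "x \<noteq> att_fst (A ! k)" "i = k" "t = x"
      by blast
    then have "copy_place k (A ! k) (Suc j) y = Inl g" "copy_place k (A ! k) (Suc j) x = Inr (i, Suc j, t)"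
      by (auto simp: copy_place_def)
    then show "(Inr (i, Suc j, t), Inl g) \<in> normal_edges E0 A"
      using normal_edges_copyI[OF k(1,2), of "Suc j"] by simp
  qed
  show ?thesis using assms
  proof
    assume "F = normal_edges E0 A" then show ?thesis by (simp only: 1)
  next
    assume F: "F = (normal_edges E0 A)\<inverse>" show ?thesis unfolding F converse_iff by (simp only: 2)
  qed
qed

text \<open>Both ends belong to one template copy, and the normal form lowers a copy index by at
  most one.\<close>

lemma normal_edges_close:
  assumes "F = normal_edges E0 A \<or> F = (normal_edges E0 A)\<inverse>"
    and "(Inr (i, j, t), Inr (i', j', t')) \<in> F"
  shows "j' \<le> Suc j"
proof -
  have "(Inr (i, j, t), Inr (i', j', t')) \<in> normal_edges E0 A \<or>
    (Inr (i', j', t'), Inr (i, j, t)) \<in> normal_edges E0 A" using assms by auto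
  then show ?thesis
  proof
    assume "(Inr (i, j, t), Inr (i', j', t')) \<in> normal_edges E0 A"
    then show ?thesis
    proof (cases rule: normal_edgesE)
      case (copy k l x y)
      then show ?thesis by (metis copy_place_bounds order_trans)
    qed auto
  next
    assume "(Inr (i', j', t'), Inr (i, j, t)) \<in> normal_edges E0 A"
    then show ?thesis
    proof (cases rule: normal_edgesE)
      case (copy k l x y)
      then show ?thesis by (metis copy_place_bounds order_trans)
    qed auto
  qed
qed

lemma normal_edges_subset:
  assumes "E0 \<subseteq> G0 \<times> G0" "\<And>a. a \<in> set A \<Longrightarrow> valid_att G0 a"
  shows "normal_edges E0 A \<subseteq> normal_verts G0 A \<times> normal_verts G0 A"
proof -
  have "v \<in> normal_verts G0 A \<and> w \<in> normal_verts G0 A" if "(v, w) \<in> normal_edges E0 A" for v w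
    using that
  proof (cases rule: normal_edgesE)
    case core then show ?thesis using assms(1) by (auto simp: normal_verts_def)
  next
    case (copy k l x y)
    then have "valid_att G0 (A ! k)" using assms(2) by simp
    moreover from this have "x \<in> att_verts (A ! k)" "y \<in> att_verts (A ! k)"
      using copy(4) by (auto simp: valid_att_def)
    ultimately show ?thesis using copy copy_place_in_normal_verts by simp
  qed
  then show ?thesis by auto
qed

lemma normal_presentable:
  assumes fin: "finite G0" and E0: "E0 \<subseteq> G0 \<times> G0" and A: "\<And>a. a \<in> set A \<Longrightarrow> valid_att G0 a"
  shows "unary_FA_presentable (normal_verts G0 A) (normal_edges E0 A)"
proof -
  let ?V = "normal_verts G0 A" and ?E = "normal_edges E0 A"
  obtain m where m: "\<And>g. g \<in> G0 \<Longrightarrow> g < m" using fin[unfolded finite_nat_set_iff_bounded] by blast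
  have "finite (\<Union>a\<in>set A. att_verts a)" using A by (simp add: valid_att_def)
  then obtain b where b: "\<And>a t. a \<in> set A \<Longrightarrow> t \<in> att_verts a \<Longrightarrow> t < b"
    unfolding finite_nat_set_iff_bounded by blast
  \<comment> \<open>The successor keeps the period positive when there are no attachments.\<close>
  define K where "K = Suc (length A * b)"
  have K: "0 < K" by (simp add: K_def)
  \<comment> \<open>The core uses numbers below m; after that each round takes K consecutive
    numbers, with b of them reserved for each template. Raising the copy index by one therefore adds
    K to the code.\<close>
  define code where "code v = (case v of Inl g \<Rightarrow> g | Inr (i, j, t) \<Rightarrow> m + (j * K + (i * b + t)))" for v
  have code_simps: "code (Inl g) = g" "code (Inr (i, j, t)) = m + (j * K + (i * b + t))" for g i j t
    by (simp_all add: code_def)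
  have Inr_bd: "i < length A \<and> t < b" "i * b + t < K" if v: "Inr (i, j, t) \<in> ?V" for i j t
  proof -
    show 1: "i < length A \<and> t < b" using v b[of "A ! i" t] by (auto simp: normal_verts_def)
    then have "Suc i * b \<le> length A * b" by (intro mult_le_mono1) simp
    then show "i * b + t < K" using 1 by (simp add: K_def)
  qed
  have Inr_Suc: "Inr (i, Suc j, t) \<in> ?V \<longleftrightarrow> Inr (i, j, t) \<in> ?V" for i j t
    by (auto simp: normal_verts_def)
  have Inl_less: "g < m" if "Inl g \<in> ?V" for g using that m by (auto simp: normal_verts_def)
  have big: "\<exists>i j t. v = Inr (i, j, t)" if "v \<in> ?V" "m \<le> code v" for v
    using that Inl_less by (cases v) (force simp: code_simps)+
  have big1: "\<exists>i j t. v = Inr (i, Suc j, t)" if v: "v \<in> ?V" "m + K \<le> code v" for v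
  proof -
    obtain i j t where ijt: "v = Inr (i, j, t)" using big v by fastforce
    have "j \<noteq> 0" using Inr_bd(2)[of i j t] v by (cases j) (auto simp: ijt code_simps)
    then show ?thesis using ijt not0_implies_Suc by blast
  qed
  have unshift: "\<exists>i j t. v = Inr (i, Suc j, t) \<and> code (Inr (i, j, t)) = x"
    if v: "v \<in> ?V" "code v = x + K" "m \<le> x" for v x
  proof -
    obtain i j t where "v = Inr (i, Suc j, t)" using big1[OF v(1)] v by auto
    moreover from this have "code (Inr (i, j, t)) = x" using v(2) by (simp add: code_simps)
    ultimately show ?thesis by blast
  qed
  have inj: "inj_on code ?V"
  proof (rule inj_onI)
    fix v w assume vw: "v \<in> ?V" "w \<in> ?V" "code v = code w"
    show "v = w"
    proof (cases "code v < m")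
      case True
      then show ?thesis using vw by (cases v; cases w) (auto simp: code_simps)
    next
      case False
      then obtain i j t i' j' t' where r: "v = Inr (i, j, t)" "w = Inr (i', j', t')"
        using big vw by (metis not_less)
      note bd = Inr_bd[OF vw(1)[unfolded r(1)]] Inr_bd[OF vw(2)[unfolded r(2)]]
      have e: "j * K + (i * b + t) = j' * K + (i' * b + t')" using vw(3) by (simp add: r code_simps)
      have "j = (j * K + (i * b + t)) div K" "j' = (j' * K + (i' * b + t')) div K"
        using bd K by simp_all
      then have j: "j = j'" using e by simp
      then have e2: "i * b + t = i' * b + t'" using e by simp
      have "i = (i * b + t) div b" "i' = (i' * b + t') div b" using bd by simp_all
      then have "i = i'" using e2 by simp
      then show ?thesis using j e2 r by simp
    qed
  qed
  have EV: "?E \<subseteq> ?V \<times> ?V" using E0 A by (rule normal_edges_subset)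
  \<comment> \<open>Ends in the same or in neighbouring rounds have codes less than 2 K apart, so a
    larger distance forces the end with the smaller code into the core. The other end then lies
    beyond m + K, hence in round 1 or later, as \<open>normal_edges_Inl_Suc\<close>
    requires.\<close>
  define N where "N = m + 2 * K"
  have V: "eventually_periodic N K (\<lambda>x. x \<in> code ` ?V)"
    unfolding eventually_periodic_def
  proof (intro conjI allI impI K)
    fix x assume x: "N \<le> x"
    show "(x + K \<in> code ` ?V) = (x \<in> code ` ?V)"
    proof
      assume "x + K \<in> code ` ?V"
      then obtain v where "v \<in> ?V" "code v = x + K" by auto
      then show "x \<in> code ` ?V" using unshift[of v x] x Inr_Suc by (force simp: N_def)
    next
      assume "x \<in> code ` ?V"
      then obtain v where v: "v \<in> ?V" "code v = x" by auto
      then obtain i j t where r: "v = Inr (i, j, t)" using big x by (fastforce simp: N_def)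
      then have "Inr (i, Suc j, t) \<in> ?V" "code (Inr (i, Suc j, t)) = x + K"
        using v Inr_Suc by (auto simp: code_simps)
      then show "x + K \<in> code ` ?V" by (metis image_eqI)
    qed
  qed
  define R where "R F x y \<longleftrightarrow> (\<exists>v\<in>?V. \<exists>w\<in>?V. code v = x \<and> code w = y \<and> (v, w) \<in> F)" for F x y
  have R1: "R ?E (x + K) (y + K) = R ?E x y" if xy: "N \<le> x" "N \<le> y" for x y
  proof
    assume "R ?E (x + K) (y + K)"
    then obtain v w where vw: "v \<in> ?V" "w \<in> ?V" "code v = x + K" "code w = y + K" "(v, w) \<in> ?E"
      by (auto simp: R_def)
    have "m \<le> x" "m \<le> y" using xy by (simp_all add: N_def)
    then obtain i j t i' j' t' where r: "v = Inr (i, Suc j, t)" "code (Inr (i, j, t)) = x"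
      "w = Inr (i', Suc j', t')" "code (Inr (i', j', t')) = y"
      using unshift[OF vw(1,3)] unshift[OF vw(2,4)] by auto
    then have "(Inr (i, j, t), Inr (i', j', t')) \<in> ?E" using vw(5) normal_edges_Suc_Suc by simp
    then show "R ?E x y" unfolding R_def using r(2,4) vw(1,2) unfolding r(1,3) Inr_Suc by blast
  next
    assume "R ?E x y"
    then obtain v w where vw: "v \<in> ?V" "w \<in> ?V" "code v = x" "code w = y" "(v, w) \<in> ?E"
      by (auto simp: R_def)
    have "m \<le> x" "m \<le> y" using xy by (simp_all add: N_def)
    then obtain i j t i' j' t' where r: "v = Inr (i, j, t)" "w = Inr (i', j', t')"
      using big[OF vw(1)] big[OF vw(2)] vw by auto
    then have "(Inr (i, Suc j, t), Inr (i', Suc j', t')) \<in> ?E"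
      "code (Inr (i, Suc j, t)) = x + K" "code (Inr (i', Suc j', t')) = y + K"
      using vw normal_edges_Suc_Suc by (simp_all add: code_simps)
    then show "R ?E (x + K) (y + K)" unfolding R_def using EV by blast
  qed
  have R2: "R F x (y + K) = R F x y"
    if F: "F = ?E \<or> F = ?E\<inverse>" and xy: "x + N \<le> y" for F x y
  proof
    have FV: "F \<subseteq> ?V \<times> ?V" using F EV by auto
    have v: "\<exists>g. v = Inl g" if vw: "(v, w) \<in> F" "code v = x" "x + N \<le> code w" for v w
    proof (rule ccontr)
      assume "\<nexists>g. v = Inl g"
      then obtain i j t where r: "v = Inr (i, j, t)" by (metis prod_cases3 sum.exhaust)
      have "m \<le> code w" using vw(3) by (simp add: N_def)
      then obtain i' j' t' where r': "w = Inr (i', j', t')" using big[of w] vw(1) FV by auto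
      have "j' \<le> Suc j" using normal_edges_close[OF F] vw(1) r r' by blast
      then have "j' * K \<le> Suc j * K" by (rule mult_le_mono1)
      moreover have "i' * b + t' < K" using Inr_bd(2)[of i' j' t'] vw(1) FV r' by auto
      ultimately show False using vw(2,3) by (simp add: r r' code_simps N_def)
    qed
    { assume "R F x (y + K)"
      then obtain v w where vw: "v \<in> ?V" "w \<in> ?V" "code v = x" "code w = y + K" "(v, w) \<in> F"
        by (auto simp: R_def)
      obtain g where g: "v = Inl g" using v[OF vw(5,3)] vw(4) xy by auto
      have my: "m \<le> y" "m + K \<le> y" using xy by (simp_all add: N_def)
      obtain i j t where w: "w = Inr (i, Suc j, t)" "code (Inr (i, j, t)) = y"
        using unshift[OF vw(2,4) my(1)] by blast
      have wV: "Inr (i, j, t) \<in> ?V" using vw(2) unfolding w(1) Inr_Suc .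
      obtain j' where "j = Suc j'" using big1[OF wV] w(2) my(2) by auto
      then have "(v, Inr (i, j, t)) \<in> F" using vw(5) normal_edges_Inl_Suc[OF F] by (simp add: g w(1))
      then show "R F x y" unfolding R_def using vw(1,3) wV w(2) by blast }
    { assume "R F x y"
      then obtain v w where vw: "v \<in> ?V" "w \<in> ?V" "code v = x" "code w = y" "(v, w) \<in> F"
        by (auto simp: R_def)
      obtain g where g: "v = Inl g" using v[OF vw(5,3)] vw(4) xy by auto
      have my: "m + K \<le> y" using xy by (simp add: N_def)
      obtain i j t where w: "w = Inr (i, Suc j, t)" using big1[OF vw(2)] vw(4) my by auto
      have "(v, Inr (i, Suc (Suc j), t)) \<in> F"
        using vw(5) normal_edges_Inl_Suc[OF F] by (simp add: g w(1))
      moreover have "code (Inr (i, Suc (Suc j), t)) = y + K" using vw(4) by (simp add: w code_simps)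
      ultimately show "R F x (y + K)" unfolding R_def using vw(1,3) FV by blast }
  qed
  have R3: "R ?E (x + K) y = R ?E x y" if "y + N \<le> x" for x y
  proof -
    have "R (?E\<inverse>) u w = R ?E w u" for u w unfolding R_def by blast
    then show ?thesis using R2[of "?E\<inverse>" y x] that by simp
  qed
  have "eventually_periodic2 N K (R ?E)"
    unfolding eventually_periodic2_def using K R1 R2 R3 by auto
  then show ?thesis by (intro unary_FA_presentable_if_code[OF inj V]) (simp add: R_def[abs_def])
qed

section \<open>Rooted trees\<close>

lemma sym_adj: "(x, y) \<in> adj E \<Longrightarrow> (y, x) \<in> adj E"
  by (auto simp: adj_def)

lemma adj_in_verts: "directed_tree V E \<Longrightarrow> (x, y) \<in> adj E \<Longrightarrow> x \<in> V \<and> y \<in> V"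
  by (auto simp: adj_def directed_tree_def directed_graph_def)

lemma adj_irrefl: "directed_tree V E \<Longrightarrow> (x, x) \<notin> adj E"
  by (auto simp: adj_def directed_tree_def)

text \<open>A shortest walk from x to y that avoids the edge repeats no vertex and has at least two
  steps; the removed edge closes it to a cycle.\<close>

lemma tree_edge_is_bridge:
  assumes tree: "directed_tree V E" and xy: "(x, y) \<in> adj E"
  shows "(x, y) \<notin> (adj E - {(x, y), (y, x)})\<^sup>*"
proof
  define B where "B = adj E - {(x, y), (y, x)}"
  assume "(x, y) \<in> (adj E - {(x, y), (y, x)})\<^sup>*"
  then have ex: "\<exists>n. (x, y) \<in> B ^^ n" by (simp add: B_def rtrancl_power)
  define n where "n = (LEAST n. (x, y) \<in> B ^^ n)"
  have n: "(x, y) \<in> B ^^ n" unfolding n_def using ex by (rule LeastI_ex)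
  have min: "n \<le> k" if "(x, y) \<in> B ^^ k" for k unfolding n_def using that by (rule Least_le)
  obtain f where f: "f 0 = x" "f n = y" "\<And>i. i < n \<Longrightarrow> (f i, f (Suc i)) \<in> B"
    using n[unfolded relpow_fun_conv] by blast
  have walk: "(f a, f (a + k)) \<in> B ^^ k" if "a + k \<le> n" for a k
    using that by (induction k) (use f(3) in \<open>auto simp: relcomp_unfold\<close>)
  have inj: "f i \<noteq> f j" if "i < j" "j \<le> n" for i j
  proof
    assume "f i = f j"
    then have "(x, f j) \<in> B ^^ i" "(f j, y) \<in> B ^^ (n - j)"
      using walk[of 0 i] walk[of j "n - j"] that f(1,2) by simp_all
    then have "(x, y) \<in> B ^^ (i + (n - j))" unfolding relpow_add by auto
    then show False using min[of "i + (n - j)"] that by simp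
  qed
  have "x \<noteq> y" using adj_irrefl[OF tree] xy by auto
  then have "n \<noteq> 0" using f(1,2) by (intro notI) simp
  moreover have "n \<noteq> 1" using f(1,2) f(3)[of 0] by (auto simp: B_def)
  ultimately have n2: "2 \<le> n" by simp
  have fV: "f i \<in> V" if "i \<le> n" for i
  proof (cases "i = n")
    case True then show ?thesis using f(2) adj_in_verts[OF tree xy] by simp
  next
    case False
    then show ?thesis using f(3)[of i] that adj_in_verts[OF tree] by (auto simp: B_def)
  qed
  define cs where "cs = map f [0..<Suc n]"
  have "is_cycle V E cs"
    unfolding is_cycle_def
  proof (intro conjI allI impI)
    show "3 \<le> length cs" using n2 by (simp add: cs_def)
    show "distinct cs" unfolding cs_def distinct_map
      by (auto simp: inj_on_def simp del: upt_Suc) (metis inj less_Suc_eq_le linorder_neqE_nat)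
    show "set cs \<subseteq> V" using fV by (auto simp: cs_def simp del: upt_Suc)
    show "(cs ! i, cs ! Suc i) \<in> adj E" if "Suc i < length cs" for i
      using that f(3)[of i] by (auto simp: cs_def B_def simp del: upt_Suc)
    have "last cs = y" "hd cs = x" using f by (simp_all add: cs_def hd_map del: upt_Suc) (simp add: last_map)
    then show "(last cs, hd cs) \<in> adj E" using xy sym_adj by simp
  qed
  then show False using tree by (auto simp: directed_tree_def)
qed

text \<open>\<open>dist\<close> only has to decrease along \<open>par\<close>: it is the rank for
  all inductions that climb towards the root. The value of \<open>par r\<close> is arbitrary, whence
  the guards x \<noteq> r.\<close>

locale parent_tree =
  fixes V :: "'a set" and E :: "('a \<times> 'a) set" and r :: 'a and par :: "'a \<Rightarrow> 'a" and dist :: "'a \<Rightarrow> nat"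
  assumes tree: "directed_tree V E" and root_in: "r \<in> V"
    and par_adj: "x \<in> V \<Longrightarrow> x \<noteq> r \<Longrightarrow> (x, par x) \<in> adj E"
    and dist_par: "x \<in> V \<Longrightarrow> x \<noteq> r \<Longrightarrow> dist (par x) < dist x"
    and adj_par: "(x, y) \<in> adj E \<Longrightarrow> (x \<noteq> r \<and> y = par x) \<or> (y \<noteq> r \<and> x = par y)"

text \<open>\<open>dist\<close> is the distance from r in the underlying graph, and the parent is a
  neighbour one step closer to r. A second neighbour at no greater distance would give a detour
  around an edge, against \<open>tree_edge_is_bridge\<close>; this also excludes edges between
  vertices at equal distance.\<close>

lemma parent_tree_exists:
  assumes tree: "directed_tree V E" and r: "r \<in> V"
  shows "\<exists>par dist. parent_tree V E r par dist"
proof -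
  define d where "d x = (LEAST n. (r, x) \<in> adj E ^^ n)" for x
  have reach: "(r, x) \<in> adj E ^^ d x" if "x \<in> V" for x
  proof -
    have "\<exists>n. (r, x) \<in> adj E ^^ n"
      using tree r that by (auto simp: directed_tree_def rtrancl_power)
    then show ?thesis unfolding d_def by (rule LeastI_ex)
  qed
  have d_le: "d x \<le> n" if "(r, x) \<in> adj E ^^ n" for x n
    unfolding d_def using that by (rule Least_le)
  have prev: "\<exists>z. (z, x) \<in> adj E \<and> d x = Suc (d z)" if x: "x \<in> V" "x \<noteq> r" for x
  proof -
    have "d x \<noteq> 0" using reach[OF x(1)] x(2) by (cases "d x") auto
    then obtain m where m: "d x = Suc m" using not0_implies_Suc by blast
    then obtain z where z: "(r, z) \<in> adj E ^^ m" "(z, x) \<in> adj E" using reach[OF x(1)] by auto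
    have "(r, x) \<in> adj E ^^ Suc (d z)" using reach[of z] z(2) adj_in_verts[OF tree z(2)] by auto
    then have "d x \<le> Suc (d z)" by (rule d_le)
    moreover have "d z \<le> m" using z(1) by (rule d_le)
    ultimately show ?thesis using z(2) m by (intro exI[of _ z]) simp
  qed
  have uniq: "z = x" if xy: "(x, y) \<in> adj E" "d x \<le> d y" and z: "(z, y) \<in> adj E" "d y = Suc (d z)"
    for x y z
  proof (rule ccontr)
    assume "z \<noteq> x"
    define B where "B = adj E - {(x, y), (y, x)}"
    have "x \<noteq> y" "z \<noteq> y" using adj_irrefl[OF tree] xy z by auto
    have symB: "sym B" unfolding B_def sym_def using sym_adj by auto
    \<comment> \<open>A shortest walk from r to such a v has only vertices closer than y before its
      end, so it never meets y and cannot use the edge xy. The vertex x is listed separately because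
      it may be as far from r as y.\<close>
    have *: "(r, v) \<in> B\<^sup>*" if "v \<in> V" "v = x \<or> d v < d y" for v
      using that
    proof (induction "d v" arbitrary: v rule: less_induct)
      case less
      show ?case
      proof (cases "v = r")
        case False
        then obtain u where u: "(u, v) \<in> adj E" "d v = Suc (d u)" using prev less.prems(1) by blast
        have "d v \<le> d y" using less.prems(2) xy(2) by auto
        then have "(r, u) \<in> B\<^sup>*" using u adj_in_verts[OF tree u(1)] by (intro less.hyps) auto
        moreover have "v \<noteq> y" using less.prems(2) \<open>x \<noteq> y\<close> by auto
        then have "(u, v) \<in> B" using u \<open>d v \<le> d y\<close> by (auto simp: B_def)
        ultimately show ?thesis by (rule rtrancl_into_rtrancl)
      qed simp
    qed
    have "(r, x) \<in> B\<^sup>*" using * adj_in_verts[OF tree xy(1)] by blast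
    then have "(x, r) \<in> B\<^sup>*" using symB by (metis sym_rtrancl symD)
    moreover have "(r, z) \<in> B\<^sup>*" using * adj_in_verts[OF tree z(1)] z(2) by auto
    moreover have "(z, y) \<in> B" using z(1) \<open>z \<noteq> x\<close> \<open>z \<noteq> y\<close> by (auto simp: B_def)
    ultimately have "(x, y) \<in> B\<^sup>*" by (meson rtrancl_into_rtrancl rtrancl_trans)
    then show False using tree_edge_is_bridge[OF tree xy(1)] by (simp add: B_def)
  qed
  define par where "par x = (SOME z. (z, x) \<in> adj E \<and> d x = Suc (d z))" for x
  have par: "(par x, x) \<in> adj E \<and> d x = Suc (d (par x))" if "x \<in> V" "x \<noteq> r" for x
    unfolding par_def by (rule someI_ex) (use prev that in blast)
  have dr: "d r = 0" using d_le[of r 0] by simp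
  have half: "y \<noteq> r \<and> x = par y" if xy: "(x, y) \<in> adj E" "d x \<le> d y" for x y
  proof -
    have V: "x \<in> V" "y \<in> V" using adj_in_verts[OF tree xy(1)] by auto
    have "x \<noteq> y" using adj_irrefl[OF tree] xy by auto
    have "y \<noteq> r"
    proof
      assume "y = r"
      then have "d x = 0" using xy(2) dr by simp
      then have "x = r" using par[OF V(1)] by (cases "x = r") auto
      then show False using \<open>y = r\<close> \<open>x \<noteq> y\<close> by simp
    qed
    then show ?thesis using uniq[OF xy, of "par y"] par[OF V(2)] by simp
  qed
  have "parent_tree V E r par d"
  proof
    fix x assume "x \<in> V" "x \<noteq> r"
    then show "(x, par x) \<in> adj E" "d (par x) < d x" using par[of x] sym_adj by auto
  next
    fix x y assume xy: "(x, y) \<in> adj E"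
    show "x \<noteq> r \<and> y = par x \<or> y \<noteq> r \<and> x = par y"
      using half[OF xy] half[OF sym_adj[OF xy]] by (cases "d x \<le> d y") auto
  qed (use tree r in auto)
  then show ?thesis by blast
qed

context parent_tree
begin

lemma par_in: "x \<in> V \<Longrightarrow> x \<noteq> r \<Longrightarrow> par x \<in> V"
  using par_adj adj_in_verts[OF tree] by blast

section \<open>Ancestors\<close>

inductive anc :: "'a \<Rightarrow> 'a \<Rightarrow> bool" for w where
  anc_refl: "w \<in> V \<Longrightarrow> anc w w"
| anc_step: "z \<in> V \<Longrightarrow> z \<noteq> r \<Longrightarrow> anc w (par z) \<Longrightarrow> anc w z"

lemma anc_in: "anc w z \<Longrightarrow> w \<in> V \<and> z \<in> V"
  by (induction rule: anc.induct) auto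

lemma anc_trans: "anc v w \<Longrightarrow> anc u v \<Longrightarrow> anc u w"
proof (induction rule: anc.induct)
  case (anc_step z)
  then show ?case using anc.anc_step[of z u] by simp
qed

lemma anc_dist: "anc w z \<Longrightarrow> w = z \<or> dist w < dist z"
proof (induction rule: anc.induct)
  case (anc_step z)
  then show ?case using dist_par[of z] by auto
qed simp

lemma anc_antisym: "anc w z \<Longrightarrow> anc z w \<Longrightarrow> w = z"
  using anc_dist[of w z] anc_dist[of z w] by auto

lemma anc_proper: "anc w z \<Longrightarrow> w \<noteq> z \<Longrightarrow> z \<noteq> r \<and> anc w (par z)"
  by (induction rule: anc.induct) auto

lemma anc_par: "w \<in> V \<Longrightarrow> w \<noteq> r \<Longrightarrow> anc (par w) w"
  by (rule anc_step) (simp_all add: par_in anc_refl)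

lemma not_anc_par: "w \<in> V \<Longrightarrow> w \<noteq> r \<Longrightarrow> \<not> anc w (par w)"
  using anc_dist[of w "par w"] dist_par[of w] by auto

lemma anc_linear: "anc u z \<Longrightarrow> anc v z \<Longrightarrow> anc u v \<or> anc v u"
proof (induction rule: anc.induct)
  case (anc_step z)
  then show ?case using anc_proper[of v z] anc.anc_step[of z u] by blast
qed simp

lemma finite_ancs: "finite {w. anc w z}"
proof (induction "dist z" arbitrary: z rule: less_induct)
  case less
  show ?case
  proof (cases "z \<in> V \<and> z \<noteq> r")
    case True
    have "{w. anc w z} \<subseteq> insert z {w. anc w (par z)}" using anc_proper by auto
    then show ?thesis using less[OF dist_par] True by (meson finite_insert finite_subset)
  next
    case False
    then have "{w. anc w z} \<subseteq> {z}" using anc_proper anc_in by fastforce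
    then show ?thesis by (rule finite_subset) simp
  qed
qed

text \<open>A vertex of largest \<open>dist\<close> on the cycle would have both its neighbours as
  its parent, so opposite vertices coincide.\<close>

lemma no_four_cycle:
  assumes "(u, a) \<in> adj E" "(u, b) \<in> adj E" "(v, a) \<in> adj E" "(v, b) \<in> adj E" "u \<noteq> v"
  shows "a = b"
proof (rule ccontr)
  assume "a \<noteq> b"
  have *: "(dist y < dist x \<and> y = par x) \<or> (dist x < dist y \<and> x = par y)" if "(x, y) \<in> adj E" for x y
    using adj_par[OF that] adj_in_verts[OF tree that] dist_par by blast
  show False
    using *[OF assms(1)] *[OF assms(2)] *[OF assms(3)] *[OF assms(4)] \<open>u \<noteq> v\<close> \<open>a \<noteq> b\<close>
    by (metis less_trans less_irrefl)
qed

text \<open>Everything in X climbs to t without leaving X, which gives connectedness; the rest is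
  inherited. It is applied to the core with t = r and to a template with the parent of its head as
  t.\<close>

lemma directed_tree_induced:
  assumes X: "X \<subseteq> V" and t: "t \<in> X" and up: "\<And>x. x \<in> X \<Longrightarrow> x \<noteq> t \<Longrightarrow> x \<noteq> r \<and> par x \<in> X"
  shows "directed_tree X (E \<inter> X \<times> X)"
proof -
  let ?F = "E \<inter> X \<times> X"
  have symF: "sym ((adj ?F)\<^sup>*)" by (intro sym_rtrancl) (auto simp: sym_def adj_def)
  have toT: "(x, t) \<in> (adj ?F)\<^sup>*" if "x \<in> X" for x
    using that
  proof (induction "dist x" arbitrary: x rule: less_induct)
    case less
    show ?case
    proof (cases "x = t")
      case False
      then have x: "x \<noteq> r" "par x \<in> X" "x \<in> V" using up[OF less.prems] X less.prems by auto
      then have "(x, par x) \<in> adj ?F" using par_adj less.prems by (auto simp: adj_def)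
      then show ?thesis using less.hyps[OF dist_par] x by (meson converse_rtrancl_into_rtrancl)
    qed simp
  qed
  have conn: "(x, y) \<in> (adj ?F)\<^sup>*" if "x \<in> X" "y \<in> X" for x y
    using toT[OF that(1)] toT[OF that(2)] symF by (meson rtrancl_trans symD)
  have "\<not> is_cycle X ?F cs" for cs
  proof
    assume "is_cycle X ?F cs"
    then have "is_cycle V E cs" using X unfolding is_cycle_def adj_def by auto
    then show False using tree by (auto simp: directed_tree_def)
  qed
  then show ?thesis
    using tree t conn unfolding directed_tree_def directed_graph_def by blast
qed

end

section \<open>Periodic trees on the natural numbers\<close>

text \<open>P is threshold and period at the same time, for vertices and for edges; replacing a
  period by a large multiple makes this possible.\<close>

locale periodic_tree = parent_tree V E r par dist
  for V :: "nat set" and E :: "(nat \<times> nat) set" and r :: nat and par :: "nat \<Rightarrow> nat"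
    and dist :: "nat \<Rightarrow> nat" +
  fixes P :: nat
  assumes root_less: "r < P"
    and verts_add: "P \<le> x \<Longrightarrow> x + P \<in> V \<longleftrightarrow> x \<in> V"
    and edges_add: "P \<le> x \<Longrightarrow> P \<le> y \<Longrightarrow> (x + P, y + P) \<in> E \<longleftrightarrow> (x, y) \<in> E"
    and edges_add_right: "x + P \<le> y \<Longrightarrow> (x, y + P) \<in> E \<longleftrightarrow> (x, y) \<in> E"
    and edges_add_left: "y + P \<le> x \<Longrightarrow> (x + P, y) \<in> E \<longleftrightarrow> (x, y) \<in> E"
begin

lemma P_pos: "0 < P"
  using root_less by simp

lemma adj_add: "P \<le> x \<Longrightarrow> P \<le> y \<Longrightarrow> (x + P, y + P) \<in> adj E \<longleftrightarrow> (x, y) \<in> adj E"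
  using edges_add by (simp add: adj_def)

lemma adj_add_right: "x + P \<le> y \<Longrightarrow> (x, y + P) \<in> adj E \<longleftrightarrow> (x, y) \<in> adj E"
  using edges_add_right edges_add_left by (simp add: adj_def)

lemma adj_close:
  assumes xy: "(x, y) \<in> adj E" and "P \<le> x"
  shows "y < x + P"
proof (rule ccontr)
  assume "\<not> y < x + P"
  then have far: "x + P \<le> y" by simp
  \<comment> \<open>The 4-cycle is x, y + P, x + P, y + 2 P.\<close>
  have 1: "(x, y + P) \<in> adj E" using xy far adj_add_right by simp
  have 2: "(x, y + P + P) \<in> adj E" using 1 far adj_add_right[of x "y + P"] by simp
  have 3: "(x + P, y + P) \<in> adj E" using xy far \<open>P \<le> x\<close> adj_add by simp
  have 4: "(x + P, y + P + P) \<in> adj E" using 1 far \<open>P \<le> x\<close> adj_add[of x "y + P"] by simp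
  have "y + P = y + P + P" by (rule no_four_cycle[OF 1 2 3 4]) (use P_pos in simp)
  then show False using P_pos by simp
qed

section \<open>The shift and the parent map\<close>

text \<open>Used in contrapositive form: a vertex at or beyond \<open>hull L\<close> has no
  descendant below L. Such a bound exists because each of the vertices below L has finitely many
  ancestors.\<close>

definition hull :: "nat \<Rightarrow> nat" where
  "hull L = (SOME h. L \<le> h \<and> (\<forall>z<L. \<forall>w. anc w z \<longrightarrow> w < h))"

lemma hull: "L \<le> hull L \<and> (\<forall>z<L. \<forall>w. anc w z \<longrightarrow> w < hull L)"
proof -
  have "finite (\<Union>z\<in>{..<L}. {w. anc w z})" using finite_ancs by blast
  then obtain h where h: "\<forall>w\<in>(\<Union>z\<in>{..<L}. {w. anc w z}). w < h"
    unfolding finite_nat_set_iff_bounded by blast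
  have "L \<le> max L h \<and> (\<forall>z<L. \<forall>w. anc w z \<longrightarrow> w < max L h)"
  proof (intro conjI allI impI)
    fix z w assume "z < L" "anc w z"
    then have "w < h" using h by blast
    then show "w < max L h" by simp
  qed simp
  then show ?thesis unfolding hull_def by (rule someI)
qed

lemma hull_ge: "L \<le> hull L"
  using hull by blast

lemma anc_less_hull: "anc w z \<Longrightarrow> z < L \<Longrightarrow> w < hull L"
  using hull by blast

text \<open>The proof of \<open>no_reversal\<close> meets descendants of the form w + P and needs 2
  P \<le> w there, so that an edge between w and a vertex below P can be shifted at w alone. One
  more P accounts for the shift.\<close>

definition B :: nat where "B = hull (3 * P)"

lemma B_ge: "3 * P \<le> B"
  unfolding B_def by (rule hull_ge)

lemma B_desc: "B \<le> a \<Longrightarrow> anc a z \<Longrightarrow> 3 * P \<le> z"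
  using anc_less_hull[of a z "3 * P"] unfolding B_def by (meson not_le)

text \<open>If the shift by P reversed the edge from x to its parent, it would reverse all edges
  further up the branch, making x + P an ancestor of a vertex below 3P.  The induction climbs that
  branch with a = x + P fixed.\<close>
lemma no_reversal:
  assumes "c \<in> V" "P \<le> c" "c \<noteq> r" "P \<le> par c" "par (par c + P) = c + P" "anc a (c + P)" "B \<le> a"
  shows False
  using assms
proof (induction "dist c" arbitrary: c rule: less_induct)
  case less
  define w where "w = par c"
  have w: "w \<in> V" "P \<le> w" "dist w < dist c" using less.prems par_in dist_par by (auto simp: w_def)
  have wP: "w + P \<in> V" "w + P \<noteq> r" "par (w + P) = c + P"
    using w verts_add root_less less.prems by (auto simp: w_def)
  have aw: "anc a (w + P)" using wP less.prems(6) by - (rule anc_step, auto)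
  show False
  proof (cases "w < 2 * P")
    case True then show False using B_desc[OF less.prems(7) aw] by simp
  next
    case False
    then have w2: "2 * P \<le> w" by simp
    then have wr: "w \<noteq> r" using root_less by simp
    define v where "v = par w"
    have vw: "(v, w) \<in> adj E" "v \<in> V" "dist v < dist w"
      using sym_adj[OF par_adj[OF w(1) wr]] par_in[OF w(1) wr] dist_par[OF w(1) wr] by (auto simp: v_def)
    show False
    proof (cases "v < P")
      \<comment> \<open>The edge shifted at w joins v to w + P, whose parent is already c + P. So w
        + P must be the parent of v, and a has a descendant below P.\<close>
      case True
      then have "(v, w + P) \<in> adj E" using vw(1) w2 adj_add_right[of v w] by simp
      then have "v \<noteq> r \<and> w + P = par v" using adj_par[of v "w + P"] wP(3) True less.prems(2) by auto
      then have "anc a v" using aw vw(2) by - (rule anc_step, auto)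
      then show False using B_desc[OF less.prems(7)] True by fastforce
    next
      case False
      then have v: "P \<le> v" by simp
      have "(v + P, w + P) \<in> adj E" using vw(1) v w(2) adj_add by simp
      moreover have "v \<noteq> c" using vw(3) w(3) by auto
      ultimately have "par (v + P) = w + P" using adj_par[of "v + P" "w + P"] wP(3) by auto
      then show False using less.hyps[of w] w wr v aw less.prems(7) by (simp add: v_def)
    qed
  qed
qed

text \<open>The shift of the edge between x and its parent is an edge; only which end is the parent
  remains to be decided. A reversal is excluded by \<open>B_desc\<close> if the parent lies below P
  and stays fixed, and by \<open>no_reversal\<close> if it moves too.\<close>

lemma par_add_P:
  assumes x: "x \<in> V" "B \<le> x"
  shows "par (x + P) = (if par x < P then par x else par x + P)"
proof -
  have big: "3 * P \<le> x" using x B_ge by simp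
  have xr: "x \<noteq> r" and xPr: "x + P \<noteq> r" using big root_less by auto
  have xP: "x + P \<in> V" using x(1) big verts_add by simp
  have ad: "(par x, x) \<in> adj E" using sym_adj[OF par_adj[OF x(1) xr]] .
  show ?thesis
  proof (cases "par x < P")
    case True
    then have "(par x, x + P) \<in> adj E" using ad big adj_add_right[of "par x" x] by simp
    then consider "par (x + P) = par x" | "par x \<noteq> r" "x + P = par (par x)" using adj_par by metis
    then show ?thesis
    proof cases
      case 2
      then have "anc (x + P) (par x)" using anc_par[of "par x"] par_in[OF x(1) xr] by simp
      then show ?thesis using B_desc[of "x + P" "par x"] x(2) True by simp
    qed (use True in simp)
  next
    case False
    then have "(par x + P, x + P) \<in> adj E" using ad big adj_add by simp
    then consider "par (x + P) = par x + P" | "par (par x + P) = x + P" using adj_par by metis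
    then show ?thesis
    proof cases
      case 2
      then have False using no_reversal[of x "x + P"] x big xr False xP anc_refl by simp
      then show ?thesis ..
    qed (use False in simp)
  qed
qed

lemma verts_add_mult: "P \<le> x \<Longrightarrow> x + k * P \<in> V \<longleftrightarrow> x \<in> V"
proof (induction k)
  case (Suc k)
  then show ?case using verts_add[of "x + k * P"] by (simp add: algebra_simps)
qed simp

lemma par_add:
  assumes x: "x \<in> V" "B \<le> x"
  shows "par (x + k * P) = (if par x < P then par x else par x + k * P)"
proof (induction k)
  case (Suc k)
  have "x + k * P \<in> V" using x B_ge verts_add_mult by simp
  then have "par (x + k * P + P) = (if par (x + k * P) < P then par (x + k * P) else par (x + k * P) + P)"
    using par_add_P x by simp
  then show ?case using Suc by (simp add: algebra_simps)
qed simp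

lemma edges_add_mult: "P \<le> x \<Longrightarrow> P \<le> y \<Longrightarrow> (x + k * P, y + k * P) \<in> E \<longleftrightarrow> (x, y) \<in> E"
proof (induction k)
  case (Suc k)
  then show ?case using edges_add[of "x + k * P" "y + k * P"] by (simp add: algebra_simps)
qed simp

lemma edges_add_right_mult: "x + P \<le> y \<Longrightarrow> (x, y + k * P) \<in> E \<longleftrightarrow> (x, y) \<in> E"
proof (induction k)
  case (Suc k)
  then show ?case using edges_add_right[of x "y + k * P"] by (simp add: algebra_simps)
qed simp

lemma edges_add_left_mult: "y + P \<le> x \<Longrightarrow> (x + k * P, y) \<in> E \<longleftrightarrow> (x, y) \<in> E"
proof (induction k)
  case (Suc k)
  then show ?case using edges_add_left[of y "x + k * P"] by (simp add: algebra_simps)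
qed simp

lemma par_edge_add:
  assumes x: "x \<in> V" "B \<le> x"
  shows "(x + k * P, par (x + k * P)) \<in> E \<longleftrightarrow> (x, par x) \<in> E"
    and "(par (x + k * P), x + k * P) \<in> E \<longleftrightarrow> (par x, x) \<in> E"
proof -
  have big: "3 * P \<le> x" using x(2) B_ge by simp
  have "((x + k * P, par (x + k * P)) \<in> E \<longleftrightarrow> (x, par x) \<in> E) \<and>
    ((par (x + k * P), x + k * P) \<in> E \<longleftrightarrow> (par x, x) \<in> E)"
  proof (cases "par x < P")
    case True
    then show ?thesis using par_add[OF x, of k] big edges_add_right_mult[of "par x" x k]
        edges_add_left_mult[of "par x" x k] by simp
  next
    case False
    then show ?thesis using par_add[OF x, of k] big edges_add_mult[of "par x" x k]
        edges_add_mult[of x "par x" k] by simp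
  qed
  then show "(x + k * P, par (x + k * P)) \<in> E \<longleftrightarrow> (x, par x) \<in> E"
    and "(par (x + k * P), x + k * P) \<in> E \<longleftrightarrow> (par x, x) \<in> E" by simp_all
qed

section \<open>The shift and the ancestor relation\<close>

text \<open>All descendants of a vertex beyond \<open>l0\<close> are at least B + P, so they can be
  shifted back by P and still satisfy the hypothesis of \<open>par_add_P\<close>.\<close>

definition l0 :: nat where "l0 = hull (B + P)"

lemma l0_ge: "B + P \<le> l0"
  unfolding l0_def by (rule hull_ge)

lemma l0_bounds: "P \<le> l0" "B \<le> l0" "r < l0"
  using l0_ge root_less by auto

lemma l0_desc: "l0 \<le> w \<Longrightarrow> anc w z \<Longrightarrow> B + P \<le> z"
  using anc_less_hull[of w z "B + P"] unfolding l0_def by (meson not_le)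

lemma anc_add_P:
  assumes "anc w z" "l0 \<le> w"
  shows "anc (w + P) (z + P)"
  using assms
proof (induction rule: anc.induct)
  case anc_refl
  then show ?case using verts_add l0_bounds by - (rule anc.anc_refl, auto)
next
  case (anc_step z)
  have "anc w z" using anc_step by - (rule anc.anc_step, auto)
  then have z: "B + P \<le> z" "B + P \<le> par z" using l0_desc anc_step by blast+
  then have "z + P \<in> V" "z + P \<noteq> r" using anc_step.hyps(1) verts_add root_less by auto
  moreover have "par (z + P) = par z + P" using par_add_P[OF anc_step.hyps(1)] z by simp
  ultimately show ?case using anc_step by - (rule anc.anc_step, auto)
qed

text \<open>The subtree at w + P acquires nothing new: it is exactly a translate of the subtree at
  w. This is what makes all copies of a template equal.\<close>

lemma anc_sub_P:
  assumes "anc (w + P) z'" "l0 \<le> w"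
  shows "\<exists>z. z' = z + P \<and> anc w z"
  using assms
proof (induction rule: anc.induct)
  case anc_refl
  then have "w \<in> V" using verts_add l0_bounds by auto
  then show ?case using anc.anc_refl by blast
next
  case (anc_step z')
  then obtain z1 where z1: "par z' = z1 + P" "anc w z1" by blast
  have "anc (w + P) z'" using anc_step by - (rule anc.anc_step, auto)
  then have "B + P \<le> z'" using l0_desc[of "w + P"] anc_step by simp
  then obtain z where z: "z' = z + P" "B \<le> z" by (metis add.commute add_le_cancel_left le_Suc_ex trans_le_add2 le_iff_add)
  have zV: "z \<in> V" using anc_step.hyps(1) z verts_add B_ge by simp
  have zr: "z \<noteq> r" using z(2) B_ge root_less by auto
  have "par z = z1" using par_add_P[OF zV z(2)] z1(1) z(1) by (auto split: if_splits)
  then have "anc w z" using zV zr z1(2) by - (rule anc.anc_step, auto)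
  then show ?case using z(1) by blast
qed

lemma anc_add_iff_P: "l0 \<le> w \<Longrightarrow> anc (w + P) (z + P) \<longleftrightarrow> anc w z"
  using anc_add_P anc_sub_P[of w "z + P"] by auto

lemma anc_add_iff: "l0 \<le> w \<Longrightarrow> anc (w + k * P) (z + k * P) \<longleftrightarrow> anc w z"
proof (induction k)
  case (Suc k)
  then show ?case using anc_add_iff_P[of "w + k * P" "z + k * P"] by (simp add: algebra_simps)
qed simp

lemma anc_sub: "l0 \<le> w \<Longrightarrow> anc (w + k * P) z' \<Longrightarrow> \<exists>z. z' = z + k * P \<and> anc w z"
proof (induction k arbitrary: z')
  case (Suc k)
  have "anc (w + k * P + P) z'" using Suc.prems by (simp add: algebra_simps)
  then obtain z1 where "z' = z1 + P" "anc (w + k * P) z1" using anc_sub_P Suc.prems by fastforce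
  then show ?case using Suc by fastforce
qed simp

section \<open>Star and axial vertices\<close>

text \<open>The pigeonhole argument in \<open>far_vertex\<close> finds shifts e P with 0 < e \<le>
  P, where e depends on the branch. The factorial makes Q a common multiple, so one shift serves all
  branches.\<close>

definition Q :: nat where "Q = fact P * P"

lemma Q_pos: "0 < Q"
  using P_pos by (simp add: Q_def)

lemma mult_Q: "k * Q = k * fact P * P"
  by (simp add: Q_def)

definition star :: "nat \<Rightarrow> bool" where
  "star s \<longleftrightarrow> s \<in> V \<and> l0 \<le> s \<and> par s < P"

definition axial :: "nat \<Rightarrow> bool" where
  "axial w \<longleftrightarrow> l0 \<le> w \<and> anc w (w + Q)"

lemma star_add: "l0 \<le> s \<Longrightarrow> star (s + k * P) \<longleftrightarrow> star s"
  using par_add[of s k] l0_bounds verts_add_mult[of s k] by (auto simp: star_def split: if_splits)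

text \<open>The parent of z is still a descendant of s and hence beyond B + P.\<close>

lemma star_desc: "star s \<Longrightarrow> anc s z \<Longrightarrow> z \<noteq> s \<Longrightarrow> P \<le> par z"
  using anc_proper[of s z] l0_desc[of s "par z"] by (auto simp: star_def)

lemma star_antichain:
  assumes "star s" "star s'" "anc s z" "anc s' z"
  shows "s = s'"
proof -
  have *: "s = s'" if "star s" "star s'" "anc s s'" for s s'
    using star_desc[of s s'] that by (fastforce simp: star_def)
  show ?thesis using anc_linear[OF assms(3,4)] *[of s s'] *[of s' s] assms(1,2) by auto
qed

text \<open>Otherwise s and s + Q would be two star vertices above w + Q, one through w and the
  other by the shift, against \<open>star_antichain\<close>.\<close>

lemma star_no_axial:
  assumes "star s" "axial w"
  shows "\<not> anc s w"
proof
  assume "anc s w"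
  then have "anc (s + Q) (w + Q)" using anc_add_iff[of s "fact P" w] assms(1) by (simp add: star_def Q_def)
  moreover have "star (s + Q)" using assms(1) star_add[of s "fact P"] by (simp add: star_def Q_def)
  moreover have "anc s (w + Q)" using \<open>anc s w\<close> assms(2) anc_trans by (auto simp: axial_def)
  ultimately have "s = s + Q" using star_antichain assms(1) by blast
  then show False using Q_pos by simp
qed

text \<open>On a common branch y would have to be above s by \<open>star_no_axial\<close>, hence
  above the parent of s. But that parent is below P, while descendants of y are far out.\<close>

lemma axial_not_above_star:
  assumes "axial y" "star s" "anc y z" "anc s z"
  shows False
proof -
  have "\<not> anc s y" using assms star_no_axial by blast
  then have "anc y s" "y \<noteq> s" using anc_linear[OF assms(3,4)] assms(2) anc_refl by (auto simp: star_def)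
  then have "anc y (par s)" using anc_proper by blast
  then have "B + P \<le> par s" using l0_desc assms(1) by (auto simp: axial_def)
  then show False using assms(2) by (simp add: star_def)
qed

text \<open>w is the vertex from which the climb from z drops below M for the first time. The clause
  about intermediate vertices is used later to decide which of two ancestors of z is the higher
  one.\<close>

lemma last_exit:
  assumes "z \<in> V" "M \<le> z" "r < M"
  shows "\<exists>w. anc w z \<and> M \<le> w \<and> w \<noteq> r \<and> par w < M \<and> (\<forall>v. anc w v \<longrightarrow> anc v z \<longrightarrow> M \<le> v)"
  using assms
proof (induction "dist z" arbitrary: z rule: less_induct)
  case less
  have zr: "z \<noteq> r" using less.prems by auto
  show ?case
  proof (cases "par z < M")
    case True
    then show ?thesis using less.prems zr anc_refl[of z] anc_antisym[of z] by blast
  next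
    case False
    then obtain w where w: "anc w (par z)" "M \<le> w" "w \<noteq> r" "par w < M"
      "\<forall>v. anc w v \<longrightarrow> anc v (par z) \<longrightarrow> M \<le> v"
      using less.hyps[of "par z"] dist_par[OF less.prems(1) zr] par_in[OF less.prems(1) zr] less.prems
      by auto
    have "anc w z" using w(1) less.prems(1) zr by (rule anc_step[rotated 2])
    moreover have "M \<le> v" if "anc w v" "anc v z" for v
      using that w(5) anc_proper[of v z] less.prems(2) by (cases "v = z") auto
    ultimately show ?thesis using w by blast
  qed
qed

text \<open>A vertex far out either lies below a star vertex or its branch leaves P + 1 consecutive windows
  of length P; two of the exit points then agree modulo P.\<close>
lemma far_vertex:
  assumes "z \<in> V" "l0 \<le> M" "M + P * P \<le> z"
  shows "\<exists>w. anc w z \<and> M \<le> w \<and> (star w \<or> axial w) \<and> (\<forall>v. anc w v \<longrightarrow> anc v z \<longrightarrow> M \<le> v)"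
proof -
  \<comment> \<open>There are P + 1 thresholds M + k P with k \<le> P, and the assumption on z puts
    all of them at or below z.\<close>
  have "\<exists>w. anc w z \<and> M + k * P \<le> w \<and> w \<noteq> r \<and> par w < M + k * P \<and>
      (\<forall>v. anc w v \<longrightarrow> anc v z \<longrightarrow> M + k * P \<le> v)" if "k \<le> P" for k
  proof (rule last_exit)
    have "k * P \<le> P * P" using that by (rule mult_le_mono1)
    then show "M + k * P \<le> z" using assms(3) by linarith
  qed (use assms l0_bounds in auto)
  then obtain c where c: "\<And>k. k \<le> P \<Longrightarrow> anc (c k) z \<and> M + k * P \<le> c k \<and> c k \<noteq> r \<and>
      par (c k) < M + k * P \<and> (\<forall>v. anc (c k) v \<longrightarrow> anc v z \<longrightarrow> M + k * P \<le> v)" by metis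
  have between: "\<forall>v. anc (c k) v \<longrightarrow> anc v z \<longrightarrow> M \<le> v" if "k \<le> P" for k
    using c[OF that] by (meson add_leD1)
  have cM: "M \<le> c k" "l0 \<le> c k" "c k \<in> V" if "k \<le> P" for k
    using c[OF that] assms(2) anc_in by (auto intro: order_trans)
  show ?thesis
  proof (cases "\<exists>k\<le>P. par (c k) < P")
    case True
    then obtain k where "k \<le> P" "par (c k) < P" by blast
    then have "star (c k)" using cM by (simp add: star_def)
    then show ?thesis using c[OF \<open>k \<le> P\<close>] between[OF \<open>k \<le> P\<close>] cM[OF \<open>k \<le> P\<close>] by blast
  next
    case False
    then have far: "P \<le> par (c k)" if "k \<le> P" for k using that by (meson not_le)
    \<comment> \<open>By \<open>adj_close\<close> the exit point exceeds its parent by less than P,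
      and the parent is below the threshold. So only P offsets above the threshold are
      possible.\<close>
    have window: "c k - (M + k * P) < P" if "k \<le> P" for k
    proof -
      have "c k \<in> V" "c k \<noteq> r" using c[OF that] cM(3)[OF that] by simp_all
      then have "(par (c k), c k) \<in> adj E" by (rule sym_adj[OF par_adj])
      then have "c k < par (c k) + P" using adj_close far[OF that] by simp
      then show ?thesis using c[OF that] by linarith
    qed
    have "\<not> inj_on (\<lambda>k. c k - (M + k * P)) {..P}"
    proof (rule pigeonhole)
      have "(\<lambda>k. c k - (M + k * P)) ` {..P} \<subseteq> {..<P}" using window by auto
      then have "card ((\<lambda>k. c k - (M + k * P)) ` {..P}) \<le> P" using card_mono[of "{..<P}"] by force
      then show "card ((\<lambda>k. c k - (M + k * P)) ` {..P}) < card {..P}" by simp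
    qed
    then obtain i' j' where "i' \<le> P" "j' \<le> P" "i' \<noteq> j'" "c i' - (M + i' * P) = c j' - (M + j' * P)"
      by (auto simp: inj_on_def)
    then obtain i j where ij: "i < j" "j \<le> P" "c i - (M + i * P) = c j - (M + j * P)"
      by (metis linorder_neqE_nat)
    obtain e where e: "j = i + e" "0 < e" using ij(1) less_imp_add_positive by blast
    have ci: "M + i * P \<le> c i" "M + j * P \<le> c j" using c[of i] c[of j] ij by auto
    have cj: "c j = c i + e * P" using ij(3) ci e(1) by (simp add: add_mult_distrib) 
    have "c i \<noteq> c j" using cj e(2) P_pos by simp
    \<comment> \<open>The branch drops below the higher threshold first. If c j were the higher
      vertex, the parent of c i would lie between c j and z and so above the threshold for j,
      although it is below the one for i.\<close>
    have "anc (c i) (c j)"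
    proof (rule ccontr)
      assume "\<not> anc (c i) (c j)"
      then have "anc (c j) (c i)" using anc_linear c[of i] c[of j] ij by (meson less_imp_le order_trans)
      then have up: "anc (c j) (par (c i))" using anc_proper[of "c j" "c i"] \<open>c i \<noteq> c j\<close> by auto
      have "anc (par (c i)) z"
        using anc_trans[of "c i" z "par (c i)"] anc_par[of "c i"] c[of i] cM(3)[of i] ij by auto
      then have "M + j * P \<le> par (c i)" using c[of j] up ij(2) by blast
      moreover have "par (c i) < M + i * P" using c[of i] ij by auto
      moreover have "i * P \<le> j * P" using ij(1) by simp
      ultimately show False by linarith
    qed
    then have step: "anc (c i) (c i + e * P)" using cj by simp
    have l: "l0 \<le> c i" using cM ij by simp
    have steps: "anc (c i) (c i + n * (e * P))" for n
    proof (induction n)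
      case 0 then show ?case using anc_in[OF step] anc_refl by simp
    next
      case (Suc n)
      have "anc (c i + e * P) (c i + n * (e * P) + e * P)"
        using Suc anc_add_iff[OF l, of e] by simp
      then show ?case using anc_trans step by (simp add: algebra_simps)
    qed
    have "e dvd (fact P :: nat)" using e ij by (intro dvd_fact) auto
    then obtain n where "fact P = n * e" by (metis dvd_def mult.commute)
    then have "anc (c i) (c i + Q)" using steps[of n] by (simp add: Q_def mult.assoc)
    then have "axial (c i)" using l by (simp add: axial_def)
    then show ?thesis using c[of i] between[of i] cM(1)[of i] ij by (meson less_imp_le order_trans)
  qed
qed

text \<open>Apply \<open>far_vertex\<close> with M = s + 1 to a descendant z far out. The vertex w
  found is not above s, since nothing between w and z is as small as s, so w lies below s. An axial
  w contradicts \<open>star_no_axial\<close>, and a star w would equal s.\<close>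

lemma star_finite:
  assumes s: "star s"
  shows "finite {z. anc s z}"
proof -
  have "z < s + 1 + P * P" if z: "anc s z" for z
  proof (rule ccontr)
    assume "\<not> z < s + 1 + P * P"
    then obtain w where w: "anc w z" "s + 1 \<le> w" "star w \<or> axial w"
      "\<forall>v. anc w v \<longrightarrow> anc v z \<longrightarrow> s + 1 \<le> v"
      using far_vertex[of z "s + 1"] s anc_in[OF z] by (auto simp: star_def)
    have "\<not> anc w s" using w(4) z by auto
    then have "anc s w" using anc_linear[OF z w(1)] by blast
    then have "\<not> axial w" using star_no_axial s by blast
    then have "s = w" using w(3) star_antichain[OF s _ z w(1)] by blast
    then show False using w(2) by simp
  qed
  then have "{z. anc s z} \<subseteq> {..<s + 1 + P * P}" by auto
  then show ?thesis by (rule finite_subset) simp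
qed

end

section \<open>Decomposition of a periodic tree\<close>

context periodic_tree
begin

section \<open>Heads, pieces and the core\<close>

definition min_axial :: "nat \<Rightarrow> bool" where
  "min_axial y \<longleftrightarrow> axial y \<and> (\<forall>w. axial w \<longrightarrow> anc w y \<longrightarrow> w = y)"

definition heads :: "nat set" where
  "heads = {y. star y \<and> y < l0 + Q} \<union> {y. min_axial y}"

text \<open>One definition serves both kinds of heads: for a star head the negative condition
  follows from the positive one, since distinct star vertices have no common descendants.\<close>

definition piece :: "nat \<Rightarrow> nat \<Rightarrow> nat set" where
  "piece y j = {z. anc (y + j * Q) z \<and> \<not> anc (y + Suc j * Q) z}"

text \<open>Since w may be z itself and ancestors of ancestors count, the core is closed under
  parents. It is finite because \<open>far_vertex\<close> gives every far vertex a forbidden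
  ancestor.\<close>

definition core :: "nat set" where
  "core = {z \<in> V. \<forall>w. anc w z \<longrightarrow> \<not> star w \<and> \<not> axial w}"

lemma axial_add_Q: "l0 \<le> y \<Longrightarrow> axial (y + Q) \<longleftrightarrow> axial y"
  using anc_add_iff[of y "fact P" "y + Q"] by (simp add: axial_def Q_def)

lemma anc_add_iff_Q: "l0 \<le> w \<Longrightarrow> anc (w + j * Q) (z + j * Q) \<longleftrightarrow> anc w z"
  using anc_add_iff[of w "j * fact P" z] by (simp add: mult_Q)

lemma axial_chain: "axial y \<Longrightarrow> i \<le> j \<Longrightarrow> anc (y + i * Q) (y + j * Q)"
proof (induction j)
  case 0
  then show ?case using anc_in anc_refl by (auto simp: axial_def)
next
  case (Suc j)
  have step: "anc (y + j * Q) (y + Suc j * Q)"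
    using Suc.prems(1) anc_add_iff_Q[of y j "y + Q"] by (simp add: axial_def add_ac)
  show ?case
  proof (cases "i = Suc j")
    case True
    then show ?thesis using anc_in[OF step] anc_refl by simp
  next
    case False
    then have "anc (y + i * Q) (y + j * Q)" using Suc by simp
    then show ?thesis using anc_trans step by blast
  qed
qed

lemma axial_add: "axial y \<Longrightarrow> axial (y + j * Q)"
proof (induction j)
  case (Suc j)
  then show ?case using axial_add_Q[of "y + j * Q"] by (simp add: axial_def algebra_simps)
qed simp

lemma star_add_Q: "l0 \<le> s \<Longrightarrow> star (s + j * Q) \<longleftrightarrow> star s"
  by (simp add: mult_Q star_add)

lemma min_axial_exists:
  assumes "axial w"
  shows "\<exists>y. min_axial y \<and> anc y w"
  using assms
proof (induction "dist w" arbitrary: w rule: less_induct)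
  case less
  show ?case
  proof (cases "min_axial w")
    case True
    moreover have "w \<in> V" using less.prems anc_in by (auto simp: axial_def)
    ultimately show ?thesis using anc_refl by blast
  next
    case False
    then obtain v where v: "axial v" "anc v w" "v \<noteq> w" using less.prems by (auto simp: min_axial_def)
    then have "dist v < dist w" using anc_dist by blast
    then obtain y where "min_axial y" "anc y v" using less.hyps v(1) by blast
    then show ?thesis using anc_trans v(2) by blast
  qed
qed

text \<open>Otherwise y - Q would still be axial and a proper ancestor of y.\<close>

lemma min_axial_less: "min_axial y \<Longrightarrow> y < l0 + Q"
proof (rule ccontr)
  assume y: "min_axial y" "\<not> y < l0 + Q"
  define w where "w = y - Q"
  have w: "y = w + Q" "l0 \<le> w" using y(2) by (auto simp: w_def)
  then have "axial w" using y(1) axial_add_Q by (simp add: min_axial_def)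
  moreover from this have "anc w y" by (simp add: w(1) axial_def)
  ultimately have "w = y" using y(1) by (simp add: min_axial_def)
  then show False using w(1) Q_pos by simp
qed

lemma heads_bounds: "y \<in> heads \<Longrightarrow> l0 \<le> y \<and> y < l0 + Q \<and> y \<in> V \<and> y \<noteq> r"
  using min_axial_less anc_in l0_bounds by (auto simp: heads_def star_def min_axial_def axial_def)

lemma finite_heads: "finite heads"
  by (rule finite_subset[of _ "{..<l0 + Q}"]) (use heads_bounds in auto)

lemma min_axial_not_star: "min_axial y \<Longrightarrow> \<not> star y"
  using axial_not_above_star[of y y y] anc_refl by (auto simp: min_axial_def star_def)

lemma heads_par: "y \<in> heads \<Longrightarrow> par y < P \<longleftrightarrow> star y"
  using heads_bounds by (auto simp: star_def)

lemma star_head_disjoint: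
  assumes "star y" "anc (y + j * Q) z"
  shows "\<not> anc (y + Suc j * Q) z"
proof
  assume "anc (y + Suc j * Q) z"
  moreover have "l0 \<le> y" using assms(1) by (simp add: star_def)
  then have "star (y + j * Q)" "star (y + Suc j * Q)" using assms(1) star_add_Q by blast+
  ultimately have "y + j * Q = y + Suc j * Q" using star_antichain assms(2) by blast
  then show False using Q_pos by simp
qed

lemma piece_star: "star y \<Longrightarrow> piece y j = {z. anc (y + j * Q) z}"
  using star_head_disjoint by (auto simp: piece_def)

lemma anc_head_multiple:
  assumes "min_axial y" "anc (y + j * Q) z"
  shows "anc y z"
  using assms axial_chain[of y 0 j] anc_trans by (auto simp: min_axial_def)

text \<open>Two star heads: the antichain property determines y + j Q, and the window of length Q
  separates y from j. Two axial heads: both are above z, hence comparable, hence equal by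
  minimality, and the chain of translates determines j. Mixed cases contradict
  \<open>axial_not_above_star\<close>.\<close>

lemma piece_unique:
  assumes y: "y \<in> heads" "y' \<in> heads" and z: "z \<in> piece y j" "z \<in> piece y' j'"
  shows "y = y' \<and> j = j'"
proof -
  have zz: "anc (y + j * Q) z" "anc (y' + j' * Q) z" using z by (auto simp: piece_def)
  have mixed: False if "star u" "min_axial v" "anc (u + i * Q) z" "anc (v + k * Q) z" for u v i k
  proof -
    have "star (u + i * Q)" using that star_add_Q by (auto simp: star_def)
    then show False
      using axial_not_above_star[of v "u + i * Q" z] anc_head_multiple[OF that(2,4)] that
      by (auto simp: min_axial_def)
  qed
  consider "star y" "star y'" | "min_axial y" "min_axial y'" | "star y" "min_axial y'" | "min_axial y" "star y'"
    using y by (auto simp: heads_def)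
  then show ?thesis
  proof cases
    case 1
    then have "y + j * Q = y' + j' * Q"
      using star_antichain[OF _ _ zz] star_add_Q by (auto simp: star_def)
    then have e: "(y - l0) + j * Q = (y' - l0) + j' * Q" and lt: "y - l0 < Q" "y' - l0 < Q"
      using heads_bounds[OF y(1)] heads_bounds[OF y(2)] by auto
    have "((y - l0) + j * Q) div Q = j" "((y' - l0) + j' * Q) div Q = j'" using lt by simp_all
    then have "j = j'" using e by simp
    moreover from this have "y - l0 = y' - l0" using e by simp
    then have "y = y'" using heads_bounds[OF y(1)] heads_bounds[OF y(2)] by linarith
    ultimately show ?thesis by simp
  next
    case 2
    then have "anc y z" "anc y' z" using zz anc_head_multiple by blast+
    then have "y = y'" using anc_linear 2 by (metis min_axial_def)
    have *: False if "i < k" "\<not> anc (y + Suc i * Q) z" "anc (y + k * Q) z" for i k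
      using that 2 axial_chain[of y "Suc i" k] anc_trans by (auto simp: min_axial_def)
    have "j = j'"
      using *[of j j'] *[of j' j] z \<open>y = y'\<close> by (auto simp: piece_def) (meson linorder_neqE_nat)
    then show ?thesis using \<open>y = y'\<close> by simp
  next
    case 3 then show ?thesis using mixed zz by blast
  next
    case 4 then show ?thesis using mixed zz by blast
  qed
qed

lemma piece_in: "z \<in> piece y j \<Longrightarrow> z \<in> V"
  using anc_in by (auto simp: piece_def)

lemma core_piece_disjoint: "y \<in> heads \<Longrightarrow> z \<in> piece y j \<Longrightarrow> z \<notin> core"
proof
  assume y: "y \<in> heads" "z \<in> piece y j" "z \<in> core"
  then have "star (y + j * Q) \<or> axial (y + j * Q)"
    using star_add_Q axial_add by (auto simp: heads_def star_def min_axial_def)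
  then show False using y by (auto simp: core_def piece_def)
qed

lemma piece_cover:
  assumes "z \<in> V" "z \<notin> core"
  shows "\<exists>y\<in>heads. \<exists>j. z \<in> piece y j"
proof -
  obtain w where w: "anc w z" "star w \<or> axial w" using assms by (auto simp: core_def)
  show ?thesis
  proof (cases "star w")
    case True
    define y where "y = l0 + (w - l0) mod Q"
    define j where "j = (w - l0) div Q"
    have "l0 \<le> w" using True by (simp add: star_def)
    then have wy: "w = y + j * Q" unfolding y_def j_def using mod_div_mult_eq[of "w - l0" Q] by simp
    have "l0 \<le> y" "y < l0 + Q" using Q_pos by (auto simp: y_def)
    then have "star y" using True star_add_Q wy by simp
    then have "y \<in> heads" using \<open>y < l0 + Q\<close> by (simp add: heads_def)
    moreover have "z \<in> piece y j" using w(1) wy piece_star[OF \<open>star y\<close>] by simp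
    ultimately show ?thesis by blast
  next
    case False
    then obtain y where y: "min_axial y" "anc y w" using w(2) min_axial_exists by blast
    have yz: "anc y z" using anc_trans y(2) w(1) by blast
    have "inj (\<lambda>j. y + j * Q)" using Q_pos by (auto simp: inj_def)
    then have fin: "finite {j. anc (y + j * Q) z}"
      using finite_vimageI[OF finite_ancs[of z]] by (simp add: vimage_def)
    \<comment> \<open>z belongs to the piece of the lowest translate of y above it, which exists
      because z has finitely many ancestors.\<close>
    define j where "j = Max {j. anc (y + j * Q) z}"
    have "{j. anc (y + j * Q) z} \<noteq> {}" using yz by (auto intro!: exI[of _ 0])
    then have "j \<in> {j. anc (y + j * Q) z}" unfolding j_def using fin Max_in by blast
    moreover have "\<not> anc (y + Suc j * Q) z"
    proof
      assume "anc (y + Suc j * Q) z"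
      then have "Suc j \<le> j" unfolding j_def using fin by (intro Max_ge) auto
      then show False by simp
    qed
    ultimately have "z \<in> piece y j" by (simp add: piece_def)
    then show ?thesis using y(1) by (auto simp: heads_def)
  qed
qed

lemma core_in: "core \<subseteq> V"
  by (auto simp: core_def)

lemma finite_core: "finite core"
proof -
  have "z < l0 + P * P" if z: "z \<in> core" for z
  proof (rule ccontr)
    assume "\<not> z < l0 + P * P"
    then have "l0 + P * P \<le> z" by simp
    then obtain w where "anc w z" "star w \<or> axial w" using far_vertex[of z l0] core_in z by blast
    then show False using z by (auto simp: core_def)
  qed
  then have "core \<subseteq> {..<l0 + P * P}" by auto
  then show ?thesis by (rule finite_subset) simp
qed

lemma root_in_core: "r \<in> core"
proof -
  have "w = r" if "anc w r" for w using anc_proper[OF that] by blast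
  moreover have "\<not> star r" "\<not> axial r" using l0_bounds by (auto simp: star_def axial_def)
  ultimately show ?thesis using root_in unfolding core_def by blast
qed

lemma core_par: "z \<in> core \<Longrightarrow> z \<noteq> r \<Longrightarrow> par z \<in> core"
  using par_in anc_par anc_trans by (auto simp: core_def) blast+

text \<open>The parent of a head is the vertex to which its attachment is glued. For a star head it
  is too small to lie below anything beyond \<open>l0\<close>; for an axial head a forbidden
  ancestor of it would contradict minimality or \<open>star_no_axial\<close>.\<close>

lemma heads_par_in_core:
  assumes y: "y \<in> heads"
  shows "par y \<in> core"
proof -
  note b = heads_bounds[OF y]
  have "\<not> star w \<and> \<not> axial w" if w: "anc w (par y)" for w
  proof (cases "star y")
    case True
    then have "par y < P" by (simp add: star_def)
    then have "\<not> B + P \<le> par y" by simp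
    then have "w < l0" using l0_desc[of w "par y"] w not_le by blast
    then show ?thesis by (simp add: star_def axial_def)
  next
    case False
    then have m: "min_axial y" using y by (simp add: heads_def)
    have wy: "anc w y" using w b by - (rule anc_step, auto)
    have "w \<noteq> y" using w b not_anc_par by blast
    then show ?thesis using m wy star_no_axial by (auto simp: min_axial_def)
  qed
  then show ?thesis using b par_in by (auto simp: core_def)
qed

lemma piece_shift:
  assumes y: "y \<in> heads"
  shows "piece y j = (\<lambda>z. z + j * Q) ` piece y 0"
proof -
  have l: "l0 \<le> y" "l0 \<le> y + Q" using heads_bounds[OF y] by auto
  have 1: "anc (y + j * Q) (z + j * Q) \<longleftrightarrow> anc y z" for z
    using anc_add_iff_Q[OF l(1)] .
  have 2: "anc (y + Suc j * Q) (z + j * Q) \<longleftrightarrow> anc (y + Q) z" for z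
    using anc_add_iff_Q[OF l(2), of j z] by (simp add: add_ac)
  have 3: "\<exists>z0. z = z0 + j * Q" if "anc (y + j * Q) z" for z
    using anc_sub[OF l(1), of "j * fact P" z] that unfolding mult_Q by blast
  have mem: "z + j * Q \<in> piece y j \<longleftrightarrow> z \<in> piece y 0" for z
    using 1 2 by (simp add: piece_def)
  show ?thesis
  proof (intro equalityI subsetI)
    fix z assume z: "z \<in> piece y j"
    then obtain z0 where "z = z0 + j * Q" using 3 by (auto simp: piece_def)
    then show "z \<in> (\<lambda>z. z + j * Q) ` piece y 0" using z mem by simp
  qed (use mem in auto)
qed

lemma head_in_piece: "y \<in> heads \<Longrightarrow> y \<in> piece y 0"
proof -
  assume y: "y \<in> heads"
  have "anc y y" using heads_bounds[OF y] anc_refl by blast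
  moreover have "\<not> anc (y + Q) y"
  proof (cases "star y")
    case True
    then show ?thesis using star_head_disjoint[of y 0 y] \<open>anc y y\<close> by simp
  next
    case False
    then have "anc y (y + Q)" using y by (auto simp: heads_def min_axial_def axial_def)
    then show ?thesis using anc_antisym Q_pos by fastforce
  qed
  ultimately show ?thesis by (simp add: piece_def)
qed

lemma piece_anc: "z \<in> piece y 0 \<Longrightarrow> anc y z"
  by (simp add: piece_def)

lemma piece_bound: "y \<in> heads \<Longrightarrow> z \<in> piece y 0 \<Longrightarrow> B + P \<le> z \<and> z \<noteq> r"
  using l0_desc[of y z] heads_bounds piece_anc l0_ge root_less by fastforce

lemma piece_par:
  assumes "y \<in> heads" "z \<in> piece y 0" "z \<noteq> y"
  shows "par z \<in> piece y 0"
proof -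
  have z: "anc y z" "\<not> anc (y + Q) z" using assms(2) by (auto simp: piece_def)
  then have p: "z \<noteq> r" "anc y (par z)" using anc_proper assms(3) by blast+
  have "\<not> anc (y + Q) (par z)"
  proof
    assume "anc (y + Q) (par z)"
    then have "anc (y + Q) z" using anc_in[OF z(1)] p(1) by - (rule anc_step, auto)
    then show False using z by simp
  qed
  then show ?thesis using p by (simp add: piece_def)
qed

text \<open>In the axial case a far z in the piece has an axial ancestor w that is itself too far
  out to be above y or y + Q. Then y is above w, so w and y + Q are both above w + Q and hence
  comparable. It follows that y + Q is above w and thus above z, so z is not in the piece.\<close>

lemma finite_piece:
  assumes y: "y \<in> heads"
  shows "finite (piece y 0)"
proof (cases "star y")
  case True
  then show ?thesis using star_finite piece_star[of y 0] by simp
next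
  case False
  then have m: "min_axial y" using y by (simp add: heads_def)
  define M where "M = max l0 (hull (y + Q + 1))"
  have "z < M + P * P" if z: "z \<in> piece y 0" for z
  proof (rule ccontr)
    assume "\<not> z < M + P * P"
    then have "M + P * P \<le> z" by simp
    moreover have "l0 \<le> M" by (simp add: M_def)
    ultimately obtain w where w: "anc w z" "M \<le> w" "star w \<or> axial w"
      using far_vertex[of z M] piece_in[OF z] by blast
    have yz: "anc y z" using z by (rule piece_anc)
    have wl: "l0 \<le> w" and not_anc: "\<not> anc w v" if "v \<le> y + Q" for v
      using w(2) anc_less_hull[of w v "y + Q + 1"] that by (auto simp: M_def)
    have "\<not> star w" using axial_not_above_star[of y w z] m yz w(1) by (auto simp: min_axial_def)
    then have aw: "axial w" using w(3) by simp
    have "anc y w" using anc_linear[OF yz w(1)] not_anc[of y] by auto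
    then have "anc (y + Q) (w + Q)"
      using anc_add_iff[of y "fact P" w] heads_bounds[OF y] by (simp add: Q_def)
    moreover have "anc w (w + Q)" using aw by (simp add: axial_def)
    ultimately have "anc (y + Q) w" using anc_linear not_anc[of "y + Q"] by blast
    then have "anc (y + Q) z" using anc_trans w(1) by blast
    then show False using z by (simp add: piece_def)
  qed
  then have "piece y 0 \<subseteq> {..<M + P * P}" by auto
  then show ?thesis by (rule finite_subset) simp
qed

section \<open>Templates of the heads\<close>

lemma par_head_not_in_piece: "y \<in> heads \<Longrightarrow> par y \<notin> piece y 0"
  using not_anc_par heads_bounds piece_anc by blast

lemma par_head_star:
  assumes "star y"
  shows "par (y + j * Q) = par y"
  using par_add[of y "j * fact P"] assms l0_bounds by (simp add: star_def mult_Q)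

text \<open>The parent of an axial head is not below P and so moves with the shift.
  \<open>par (y + Q)\<close> is the vertex of piece 0 from which piece 1 hangs, which is why it is
  chosen as t1.\<close>

lemma par_head_axial:
  assumes "min_axial y"
  shows "par (y + Q) \<in> piece y 0" and "par (y + Suc j * Q) = par (y + Q) + j * Q"
proof -
  have y: "y \<in> heads" using assms by (simp add: heads_def)
  note b = heads_bounds[OF y]
  have "\<not> par y < P" using heads_par[OF y] min_axial_not_star[OF assms] by simp
  then have p: "par (y + k * Q) = par y + k * Q" for k
    using par_add[of y "k * fact P"] b l0_bounds by (simp add: mult_Q)
  show "par (y + Suc j * Q) = par (y + Q) + j * Q" using p[of "Suc j"] p[of 1] by simp
  have a: "anc y (y + Q)" using assms by (simp add: min_axial_def axial_def)
  then have "y + Q \<in> V" "y + Q \<noteq> r" "anc y (par (y + Q))"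
    using anc_in anc_proper[OF a] Q_pos by auto
  then show "par (y + Q) \<in> piece y 0" using not_anc_par[of "y + Q"] by (simp add: piece_def)
qed

text \<open>This covers both kinds of heads: if y is a star vertex, then par (y + Q) = par y.\<close>
definition head_template :: "nat \<Rightarrow> attachment" where
  "head_template y = (let T = insert (par y) (piece y 0) in (T, E \<inter> T \<times> T, par y, par (y + Q), par y))"

lemma head_template_sel [simp]:
  "att_verts (head_template y) = insert (par y) (piece y 0)"
  "att_edges (head_template y) = E \<inter> insert (par y) (piece y 0) \<times> insert (par y) (piece y 0)"
  "att_fst (head_template y) = par y" "att_snd (head_template y) = par (y + Q)"
  "att_root (head_template y) = par y"
  by (simp_all add: head_template_def Let_def)

text \<open>Adding the parent of y on top of the piece provides the leaf: its only neighbour there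
  is y, as any other vertex of the piece has its parent in the piece.\<close>

lemma head_template_is_template:
  assumes y: "y \<in> heads"
  defines "T \<equiv> insert (par y) (piece y 0)"
  shows "template T (E \<inter> T \<times> T) (par y) (par (y + Q))"
  unfolding template_def
proof (intro conjI)
  note b = heads_bounds[OF y]
  have yV: "y \<in> V" "y \<noteq> r" "par y \<in> V" using b par_in by auto
  have up: "x \<noteq> r \<and> par x \<in> T" if "x \<in> T" "x \<noteq> par y" for x
    using that piece_bound[OF y, of x] piece_par[OF y, of x] by (cases "x = y") (auto simp: T_def)
  show "finite T" using finite_piece[OF y] by (simp add: T_def)
  show "directed_tree T (E \<inter> T \<times> T)"
    by (rule directed_tree_induced[of _ "par y"]) (use yV piece_in up in \<open>auto simp: T_def\<close>)
  show "par y \<in> T" by (simp add: T_def)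
  show "par (y + Q) \<in> T"
    using y par_head_star[of y 1] par_head_axial(1)[of y] by (auto simp: heads_def T_def)
  have "{x \<in> T. (par y, x) \<in> adj (E \<inter> T \<times> T)} = {y}"
  proof (intro equalityI subsetI)
    fix x assume "x \<in> {x \<in> T. (par y, x) \<in> adj (E \<inter> T \<times> T)}"
    then have x: "x \<in> T" "(par y, x) \<in> adj E" by (auto simp: adj_def)
    then have "x \<noteq> par y" using adj_irrefl[OF tree] by auto
    then have xp: "x \<in> piece y 0" using x(1) by (simp add: T_def)
    consider "par y \<noteq> r" "x = par (par y)" | "par y = par x" using adj_par[OF x(2)] by blast
    then have "x = y"
    proof cases
      case 1
      then have "anc y (par y)"
        using anc_trans[OF anc_par[OF yV(3)] ] piece_anc[OF xp] by simp
      then show ?thesis using not_anc_par yV by blast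
    next
      case 2
      then show ?thesis using piece_par[OF y xp] par_head_not_in_piece[OF y] by auto
    qed
    then show "x \<in> {y}" by simp
  next
    fix x assume "x \<in> {y}"
    moreover have "y \<in> T" "par y \<in> T" using head_in_piece[OF y] by (auto simp: T_def)
    moreover have "(par y, y) \<in> adj E" by (rule sym_adj[OF par_adj[OF yV(1,2)]])
    ultimately show "x \<in> {x \<in> T. (par y, x) \<in> adj (E \<inter> T \<times> T)}" by (auto simp: adj_def)
  qed
  then show "leaf T (E \<inter> T \<times> T) (par y)" by (simp add: leaf_def T_def)
qed

lemma head_template_valid: "y \<in> heads \<Longrightarrow> valid_att core (head_template y)"
  using head_template_is_template[of y] heads_par_in_core[of y]
  by (auto simp: valid_att_def template_def)

lemma head_template_star:
  "y \<in> heads \<Longrightarrow> star y \<Longrightarrow> case head_template y of (T, \<eta>, t0, t1, g) \<Rightarrow> shallow_star T \<eta> t0 t1 \<and> g \<in> core"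
  using head_template_is_template[of y] heads_par_in_core[of y] par_head_star[of y 1]
  by (simp add: head_template_def Let_def shallow_star_def)

lemma head_template_axial:
  "min_axial y \<Longrightarrow> case head_template y of (T, \<eta>, t0, t1, g) \<Rightarrow> periodic_path T \<eta> t0 t1 \<and> g \<in> core"
  using head_template_is_template[of y] heads_par_in_core[of y] par_head_axial(1)[of y]
    par_head_not_in_piece[of y]
  by (auto simp: head_template_def Let_def periodic_path_def heads_def)

lemma core_tree: "directed_tree core (E \<inter> core \<times> core)"
  by (rule directed_tree_induced[of _ r]) (use core_in root_in_core core_par in auto)

text \<open>The j-th copy of the piece below y sits below y + jQ.\<close>
lemma iso_normal:
  assumes ys: "set ys = heads" "distinct ys"
  shows "graph_iso (normal_verts core (map head_template ys))
    (normal_edges (E \<inter> core \<times> core) (map head_template ys)) V E"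
proof -
  let ?A = "map head_template ys"
  let ?NV = "normal_verts core ?A" and ?NE = "normal_edges (E \<inter> core \<times> core) ?A"
  have hd: "ys ! i \<in> heads" if "i < length ys" for i using ys(1) that nth_mem by blast
  define f where "f v = (case v of Inl g \<Rightarrow> g | Inr (i, j, t) \<Rightarrow> t + j * Q)"
    for v :: "nat + nat \<times> nat \<times> nat"
  have f_simps [simp]: "f (Inl g) = g" "f (Inr (i, j, t)) = t + j * Q" for g i j t
    by (simp_all add: f_def)
  have NV: "v \<in> ?NV \<longleftrightarrow> (\<exists>g\<in>core. v = Inl g) \<or>
      (\<exists>i j t. v = Inr (i, j, t) \<and> i < length ys \<and> t \<in> piece (ys ! i) 0)" for v
    using par_head_not_in_piece[OF hd] by (fastforce simp: normal_verts_def)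
  have f_Inr: "t + j * Q \<in> piece (ys ! i) j" if "i < length ys" "t \<in> piece (ys ! i) 0" for i j t
    using piece_shift[OF hd[OF that(1)]] that(2) by blast
  have inj: "inj_on f ?NV"
  proof (rule inj_onI)
    fix v w assume vw: "v \<in> ?NV" "w \<in> ?NV" "f v = f w"
    have mixed: False if "g \<in> core" "i < length ys" "t \<in> piece (ys ! i) 0" "g = t + j * Q" for g i j t
      using that core_piece_disjoint[OF hd f_Inr] by blast
    consider g g' where "v = Inl g" "w = Inl g'"
      | g i j t where "v = Inl g" "w = Inr (i, j, t)" "g \<in> core" "i < length ys" "t \<in> piece (ys ! i) 0"
      | g i j t where "w = Inl g" "v = Inr (i, j, t)" "g \<in> core" "i < length ys" "t \<in> piece (ys ! i) 0"
      | i j t i' j' t' where "v = Inr (i, j, t)" "w = Inr (i', j', t')" "i < length ys" "i' < length ys"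
          "t \<in> piece (ys ! i) 0" "t' \<in> piece (ys ! i') 0"
      using vw(1,2) unfolding NV by blast
    then show "v = w"
    proof cases
      case 1 then show ?thesis using vw(3) by simp
    next
      case 2
      then have "g = t + j * Q" using vw(3) by simp
      then show ?thesis using mixed[OF 2(3,4,5)] by blast
    next
      case 3
      then have "g = t + j * Q" using vw(3) by simp
      then show ?thesis using mixed[OF 3(3,4,5)] by blast
    next
      case 4
      then have e: "t + j * Q = t' + j' * Q" using vw(3) by simp
      have "ys ! i = ys ! i' \<and> j = j'"
        using piece_unique[OF hd[OF 4(3)] hd[OF 4(4)] f_Inr[OF 4(3,5), of j]] f_Inr[OF 4(4,6), of j'] e
        by simp
      moreover from this have "i = i'" using ys(2) 4 nth_eq_iff_index_eq by blast
      ultimately show ?thesis using 4 e by simp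
    qed
  qed
  have img: "f ` ?NV = V"
  proof (intro equalityI subsetI)
    fix x assume "x \<in> f ` ?NV"
    then obtain v where v: "v \<in> ?NV" "x = f v" by blast
    then consider g where "v = Inl g" "g \<in> core"
      | i j t where "v = Inr (i, j, t)" "i < length ys" "t \<in> piece (ys ! i) 0" using NV by blast
    then show "x \<in> V"
      by cases (use v(2) core_in piece_in[OF f_Inr] in auto)
  next
    fix x assume x: "x \<in> V"
    show "x \<in> f ` ?NV"
    proof (cases "x \<in> core")
      case True
      then have "Inl x \<in> ?NV" "x = f (Inl x)" using NV by auto
      then show ?thesis by blast
    next
      case False
      then obtain y j where y: "y \<in> heads" "x \<in> piece y j" using piece_cover x by blast
      then obtain t where t: "t \<in> piece y 0" "x = t + j * Q" using piece_shift by blast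
      obtain i where i: "i < length ys" "ys ! i = y" using y(1) ys(1) by (metis in_set_conv_nth)
      then have "Inr (i, j, t) \<in> ?NV" "x = f (Inr (i, j, t))" using NV t by auto
      then show ?thesis by blast
    qed
  qed
  \<comment> \<open>In a path t0 of copy j + 1 is t1 of copy j and is placed at par (y + Q) + j Q,
    the parent of y + (j + 1) Q. In a star all translates of y have the same parent.\<close>
  have place_head: "f (copy_place i (?A ! i) j (par y)) = par (y + j * Q)" if i: "i < length ys" "y = ys ! i" for i j y
  proof -
    have y: "y \<in> heads" using hd i by simp
    have "star y \<or> min_axial y" using y by (auto simp: heads_def)
    then show ?thesis
    proof
      assume "star y"
      then show ?thesis using par_head_star[of y j] par_head_star[of y 1] i by (simp add: copy_place_def)
    next
      assume m: "min_axial y"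
      have "par y \<noteq> par (y + Q)" using par_head_axial(1)[OF m] par_head_not_in_piece[OF y] by auto
      then show ?thesis using par_head_axial(2)[OF m, of "j - 1"] i by (cases j) (simp_all add: copy_place_def)
    qed
  qed
  have place_piece: "f (copy_place i (?A ! i) j t) = t + j * Q"
    if i: "i < length ys" "t \<in> piece (ys ! i) 0" for i j t
    using i par_head_not_in_piece[OF hd[OF i(1)]] by (auto simp: copy_place_def)
  \<comment> \<open>The placement turns parents within the template into parents in V, also at the
    head, so an edge can be followed from its lower end.\<close>
  have place_par: "f (copy_place i (?A ! i) j (par t)) = par (t + j * Q)"
    if i: "i < length ys" "t \<in> piece (ys ! i) 0" for i j t
  proof (cases "t = ys ! i")
    case True
    then show ?thesis using place_head[OF i(1)] by simp
  next
    case False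
    have p: "par t \<in> piece (ys ! i) 0" using piece_par[OF hd[OF i(1)] i(2) False] .
    then have "B + P \<le> par t" using piece_bound[OF hd[OF i(1)]] by blast
    then have "\<not> par t < P" using P_pos by simp
    moreover have "t \<in> V" "B \<le> t" using piece_bound[OF hd[OF i(1)] i(2)] piece_in[OF i(2)] by auto
    ultimately have "par (t + j * Q) = par t + j * Q" using par_add[of t "j * fact P"] by (simp add: mult_Q)
    then show ?thesis using place_piece[OF i(1) p] by simp
  qed
  have piece_edge: "(t + j * Q, par (t + j * Q)) \<in> E \<longleftrightarrow> (t, par t) \<in> E"
      "(par (t + j * Q), t + j * Q) \<in> E \<longleftrightarrow> (par t, t) \<in> E"
    if i: "i < length ys" "t \<in> piece (ys ! i) 0" for i j t
  proof -
    have "t \<in> V" "B \<le> t" using piece_bound[OF hd[OF i(1)] i(2)] piece_in[OF i(2)] by auto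
    then show "(t + j * Q, par (t + j * Q)) \<in> E \<longleftrightarrow> (t, par t) \<in> E"
      "(par (t + j * Q), t + j * Q) \<in> E \<longleftrightarrow> (par t, t) \<in> E"
      using par_edge_add[of t "j * fact P"] by (simp_all add: mult_Q)
  qed
  have edge_cases: "(x \<noteq> r \<and> y = par x) \<or> (y \<noteq> r \<and> x = par y)" if "(x, y) \<in> E" for x y
    using adj_par[of x y] that by (simp add: adj_def)
  have EV: "E \<subseteq> V \<times> V" using tree by (simp add: directed_tree_def directed_graph_def)
  have fE: "(\<lambda>(v, w). (f v, f w)) ` ?NE = E"
  proof (intro equalityI subsetI)
    fix e assume "e \<in> (\<lambda>(v, w). (f v, f w)) ` ?NE"
    then obtain v w where vw: "(v, w) \<in> ?NE" "e = (f v, f w)" by auto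
    from vw(1) show "e \<in> E"
    proof (cases rule: normal_edgesE)
      case core then show ?thesis using vw(2) by simp
    next
      case (copy i j x y)
      then have i: "i < length ys" by simp
      define h where "h = ys ! i"
      have h: "h \<in> heads" using hd[OF i] by (simp add: h_def)
      have xy: "(x, y) \<in> E" "x \<in> insert (par h) (piece h 0)" "y \<in> insert (par h) (piece h 0)"
        using copy(4) i by (auto simp: h_def)
      \<comment> \<open>The lower end of a template edge lies in the piece: the only other vertex is
        the parent of h, whose own parent is closer to the root than every vertex of the
        template.\<close>
      have up: "x \<in> piece h 0" if "x \<noteq> r" "y = par x" "(x, y) \<in> E \<or> (y, x) \<in> E" "x \<in> insert (par h) (piece h 0)"
        "y \<in> insert (par h) (piece h 0)" for x y
      proof (rule ccontr)
        assume "x \<notin> piece h 0"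
        then have x: "x = par h" using that(4) by simp
        have hV: "h \<in> V" "h \<noteq> r" "par h \<in> V" using heads_bounds[OF h] par_in by auto
        have "dist y < dist x" using dist_par[OF hV(3)] that(1,2) x by simp
        moreover have "y \<noteq> par h \<Longrightarrow> dist h \<le> dist y"
          using that(5) anc_dist[OF piece_anc, of y h] by auto
        ultimately show False using dist_par[OF hV(1,2)] x by fastforce
      qed
      show ?thesis
        using edge_cases[OF xy(1)]
      proof
        assume "x \<noteq> r \<and> y = par x"
        then have "x \<in> piece (ys ! i) 0" "y = par x" using up xy by (auto simp: h_def)
        then have "e = (x + j * Q, par (x + j * Q))" "(x + j * Q, par (x + j * Q)) \<in> E"
          using vw(2) copy(1,2) place_piece[OF i] place_par[OF i] piece_edge[OF i] xy(1) by auto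
        then show ?thesis by simp
      next
        assume "y \<noteq> r \<and> x = par y"
        then have "y \<in> piece (ys ! i) 0" "x = par y" using up[of y x] xy by (auto simp: h_def)
        then have "e = (par (y + j * Q), y + j * Q)" "(par (y + j * Q), y + j * Q) \<in> E"
          using vw(2) copy(1,2) place_piece[OF i] place_par[OF i] piece_edge[OF i] xy(1) by auto
        then show ?thesis by simp
      qed
    qed
  next
    fix e assume e: "e \<in> E"
    obtain x y where xy: "e = (x, y)" by force
    have child: "(c \<in> core \<and> par c \<in> core) \<or> (\<exists>i j t. i < length ys \<and> t \<in> piece (ys ! i) 0 \<and> c = t + j * Q)"
      if cV: "c \<in> V" "c \<noteq> r" for c
    proof (cases "c \<in> core")
      case True then show ?thesis using core_par cV by blast
    next
      case False
      then obtain h j where h: "h \<in> heads" "c \<in> piece h j" using piece_cover cV by blast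
      then obtain t where "t \<in> piece h 0" "c = t + j * Q" using piece_shift by blast
      moreover obtain i where "i < length ys" "ys ! i = h" using h(1) ys(1) by (metis in_set_conv_nth)
      ultimately show ?thesis by blast
    qed
    have tmpl: "(copy_place i (?A ! i) j u, copy_place i (?A ! i) j v) \<in> ?NE"
      if "i < length ys" "(u, v) \<in> E" "u \<in> insert (par (ys ! i)) (piece (ys ! i) 0)"
        "v \<in> insert (par (ys ! i)) (piece (ys ! i) 0)" for i j u v
      using that by (intro normal_edges_copyI) auto
    have parT: "par t \<in> insert (par (ys ! i)) (piece (ys ! i) 0)"
      if "i < length ys" "t \<in> piece (ys ! i) 0" for i t
      using piece_par[OF hd[OF that(1)] that(2)] by (cases "t = ys ! i") auto
    have in_core: "e \<in> (\<lambda>(v, w). (f v, f w)) ` ?NE" if "x \<in> core" "y \<in> core"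
    proof -
      have "(Inl x, Inl y) \<in> ?NE" using e xy that by (simp add: normal_edges_def)
      moreover have "e = (\<lambda>(v, w). (f v, f w)) (Inl x, Inl y)" by (simp add: xy)
      ultimately show ?thesis by blast
    qed
    have V: "x \<in> V" "y \<in> V" using e xy EV by auto
    show "e \<in> (\<lambda>(v, w). (f v, f w)) ` ?NE"
      using edge_cases[OF e[unfolded xy]]
    proof
      assume c: "x \<noteq> r \<and> y = par x"
      consider "x \<in> core" "par x \<in> core"
        | i j t where "i < length ys" "t \<in> piece (ys ! i) 0" "x = t + j * Q"
        using child[OF V(1)] c by blast
      then show ?thesis
      proof cases
        case 1 then show ?thesis using in_core c by simp
      next
        case t: (2 i j t)
        have "(t, par t) \<in> E" using e xy c t piece_edge(1)[OF t(1,2)] by simp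
        then have "(copy_place i (?A ! i) j t, copy_place i (?A ! i) j (par t)) \<in> ?NE"
          using tmpl t parT by blast
        moreover have "e = (\<lambda>(v, w). (f v, f w)) (copy_place i (?A ! i) j t, copy_place i (?A ! i) j (par t))"
          using place_piece[OF t(1,2)] place_par[OF t(1,2)] c t(3) xy by simp
        ultimately show ?thesis by blast
      qed
    next
      assume c: "y \<noteq> r \<and> x = par y"
      consider "y \<in> core" "par y \<in> core"
        | i j t where "i < length ys" "t \<in> piece (ys ! i) 0" "y = t + j * Q"
        using child[OF V(2)] c by blast
      then show ?thesis
      proof cases
        case 1 then show ?thesis using in_core c by simp
      next
        case t: (2 i j t)
        have "(par t, t) \<in> E" using e xy c t piece_edge(2)[OF t(1,2)] by simp
        then have "(copy_place i (?A ! i) j (par t), copy_place i (?A ! i) j t) \<in> ?NE"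
          using tmpl t parT by blast
        moreover have "e = (\<lambda>(v, w). (f v, f w)) (copy_place i (?A ! i) j (par t), copy_place i (?A ! i) j t)"
          using place_piece[OF t(1,2)] place_par[OF t(1,2)] c t(3) xy by simp
        ultimately show ?thesis by blast
      qed
    qed
  qed
  have NE: "?NE \<subseteq> ?NV \<times> ?NV"
    by (rule normal_edges_subset) (use head_template_valid ys(1) in auto)
  have "(v, w) \<in> ?NE \<longleftrightarrow> (f v, f w) \<in> E" if vw: "v \<in> ?NV" "w \<in> ?NV" for v w
  proof
    assume "(v, w) \<in> ?NE"
    from imageI[OF this, of "\<lambda>(v, w). (f v, f w)"] show "(f v, f w) \<in> E" unfolding fE by simp
  next
    assume "(f v, f w) \<in> E"
    then have "(f v, f w) \<in> (\<lambda>(v, w). (f v, f w)) ` ?NE" unfolding fE .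
    then obtain v' w' where 1: "(v', w') \<in> ?NE" "f v = f v'" "f w = f w'" by auto
    then have "v' \<in> ?NV" "w' \<in> ?NV" using NE by auto
    then have "v' = v" "w' = w" using inj_onD[OF inj 1(2)] inj_onD[OF inj 1(3)] vw by simp_all
    then show "(v, w) \<in> ?NE" using 1 by simp
  qed
  moreover have "bij_betw f ?NV V" using inj img by (simp add: bij_betw_def)
  ultimately show ?thesis unfolding graph_iso_def by blast
qed

lemma assembled:
  "\<exists>(G0 :: nat set) (E0 :: (nat \<times> nat) set) (As :: attachment list) (Ps :: attachment list).
       finite G0 \<and> directed_tree G0 E0 \<and>
       (\<forall>(T, \<eta>, t0, t1, g) \<in> set As. shallow_star T \<eta> t0 t1 \<and> g \<in> G0) \<and>
       (\<forall>(T, \<eta>, t0, t1, g) \<in> set Ps. periodic_path T \<eta> t0 t1 \<and> g \<in> G0) \<and>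
       graph_iso V E (fst (assemble G0 E0 (As @ Ps))) (snd (assemble G0 E0 (As @ Ps)))"
proof -
  have "finite {y \<in> heads. star y}" "finite {y. min_axial y}"
    using finite_heads by (auto simp: heads_def)
  then obtain ss ps where ss: "set ss = {y \<in> heads. star y}" "distinct ss"
    and ps: "set ps = {y. min_axial y}" "distinct ps"
    using finite_distinct_list by meson
  define As where "As = map head_template ss"
  define Ps where "Ps = map head_template ps"
  have set_ys: "set (ss @ ps) = heads" using ss ps by (auto simp: heads_def)
  have "distinct (ss @ ps)" using ss ps min_axial_not_star by auto
  then have "graph_iso (normal_verts core (As @ Ps)) (normal_edges (E \<inter> core \<times> core) (As @ Ps)) V E"
    using iso_normal[OF set_ys] by (simp add: As_def Ps_def)
  moreover have "graph_iso (fst (assemble core (E \<inter> core \<times> core) (As @ Ps)))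
      (snd (assemble core (E \<inter> core \<times> core) (As @ Ps)))
      (normal_verts core (As @ Ps)) (normal_edges (E \<inter> core \<times> core) (As @ Ps))"
  proof (rule assemble_iso_normal)
    show "valid_att core a" if "a \<in> set (As @ Ps)" for a
      using that head_template_valid set_ys by (auto simp: As_def Ps_def)
  qed auto
  ultimately have "graph_iso V E (fst (assemble core (E \<inter> core \<times> core) (As @ Ps)))
      (snd (assemble core (E \<inter> core \<times> core) (As @ Ps)))"
    using graph_iso_trans graph_iso_sym by blast
  moreover have "\<forall>a\<in>set As. case a of (T, \<eta>, t0, t1, g) \<Rightarrow> shallow_star T \<eta> t0 t1 \<and> g \<in> core"
    unfolding As_def using ss(1) head_template_star by auto
  moreover have "\<forall>a\<in>set Ps. case a of (T, \<eta>, t0, t1, g) \<Rightarrow> periodic_path T \<eta> t0 t1 \<and> g \<in> core"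
    unfolding Ps_def using ps(1) head_template_axial by auto
  ultimately show ?thesis using finite_core core_tree by blast
qed

end

section \<open>Presentable trees are periodic\<close>

lemma directed_tree_iso:
  assumes iso: "graph_iso V E W F" and tree: "directed_tree V E" and F: "F \<subseteq> W \<times> W"
  shows "directed_tree W F"
proof -
  obtain f where f: "bij_betw f V W" "\<And>x y. x \<in> V \<Longrightarrow> y \<in> V \<Longrightarrow> (x, y) \<in> E \<longleftrightarrow> (f x, f y) \<in> F"
    using iso by (auto simp: graph_iso_def)
  obtain g where g: "bij_betw g W V" "\<And>x y. x \<in> W \<Longrightarrow> y \<in> W \<Longrightarrow> (x, y) \<in> F \<longleftrightarrow> (g x, g y) \<in> E"
    using graph_iso_sym[OF iso] by (auto simp: graph_iso_def)
  have gV: "g x \<in> V" if "x \<in> W" for x using g(1) that bij_betw_apply by fast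
  have fE: "(f x, f y) \<in> adj F" if "(x, y) \<in> adj E" for x y
    using adj_in_verts[OF tree that] that f(2) by (auto simp: adj_def)
  have gF: "(g x, g y) \<in> adj E" if "(x, y) \<in> adj F" for x y
    using F that g(2) by (auto simp: adj_def)
  have "(x, y) \<in> (adj F)\<^sup>*" if xy: "x \<in> W" "y \<in> W" for x y
  proof -
    obtain u v where uv: "u \<in> V" "v \<in> V" "x = f u" "y = f v"
      using f(1) xy by (auto simp: bij_betw_def)
    then have "(u, v) \<in> (adj E)\<^sup>*" using tree by (simp add: directed_tree_def)
    then have "(f u, f v) \<in> (adj F)\<^sup>*"
      by (induction rule: rtrancl_induct) (use fE in \<open>auto intro: rtrancl_into_rtrancl\<close>)
    then show ?thesis by (simp add: uv)
  qed
  moreover have "\<not> is_cycle W F cs" for cs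
  proof
    assume cs: "is_cycle W F cs"
    then have "cs \<noteq> []" by (auto simp: is_cycle_def)
    then have "is_cycle V E (map g cs)"
      using cs gF gV inj_on_subset[OF bij_betw_imp_inj_on[OF g(1)]]
      by (auto simp: is_cycle_def distinct_map last_map hd_map)
    then show False using tree by (auto simp: directed_tree_def)
  qed
  moreover have "(x, x) \<notin> F" "(x, y) \<in> F \<Longrightarrow> (y, x) \<notin> F" for x y
  proof -
    show "(x, x) \<notin> F"
      using F g(2)[of x x] tree by (auto simp: directed_tree_def)
    assume "(x, y) \<in> F"
    moreover from this have "x \<in> W" "y \<in> W" using F by auto
    ultimately show "(y, x) \<notin> F" using g(2)[of x y] g(2)[of y x] tree by (auto simp: directed_tree_def)
  qed
  moreover have "W \<noteq> {}" using f(1) tree by (auto simp: directed_tree_def bij_betw_def)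
  ultimately show ?thesis using F by (simp add: directed_tree_def directed_graph_def)
qed

lemma unit_list_eq_replicate: "u = replicate (length u) ()"
  by (induction u) auto

lemma conv_unary_set:
  "{conv u v | u v. S u v} =
    {conv u v | u v. S (replicate (length u) ()) (replicate (length v) ())}"
  by (simp add: unit_list_eq_replicate[symmetric])

text \<open>With one name per vertex the equality relation disappears. What has to be shown is that
  being a shortest name is an eventually periodic property.\<close>

lemma presentable_iso_periodic_tree:
  fixes V :: "'a set"
  assumes tree: "directed_tree V E" and pres: "unary_FA_presentable V E"
  shows "\<exists>D F r par dist P. periodic_tree D F r par dist P \<and> graph_iso V E D F"
proof -
  obtain L :: "unit list set" and \<phi> where L: "\<phi> ` L = V"
    and reg1: "regular {conv u v | u v. u \<in> L \<and> v \<in> L \<and> \<phi> u = \<phi> v}"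
    and reg2: "regular {conv u v | u v. u \<in> L \<and> v \<in> L \<and> (\<phi> u, \<phi> v) \<in> E}"
    using pres by (auto simp: unary_FA_presentable_def)
  define a :: "nat \<Rightarrow> unit list" where "a x = replicate x ()" for x
  define R1 where "R1 x y \<longleftrightarrow> a x \<in> L \<and> a y \<in> L \<and> \<phi> (a x) = \<phi> (a y)" for x y
  define R2 where "R2 x y \<longleftrightarrow> a x \<in> L \<and> a y \<in> L \<and> (\<phi> (a x), \<phi> (a y)) \<in> E" for x y
  have "\<exists>N p. eventually_periodic2 N p R1"
    by (rule eventually_periodic2_if_regular_conv)
      (use reg1[unfolded conv_unary_set[of "\<lambda>u v. u \<in> L \<and> v \<in> L \<and> \<phi> u = \<phi> v"]]
        in \<open>simp add: R1_def a_def\<close>)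
  then obtain N1 p1 where per1: "eventually_periodic2 N1 p1 R1" by blast
  have "\<exists>N p. eventually_periodic2 N p R2"
    by (rule eventually_periodic2_if_regular_conv)
      (use reg2[unfolded conv_unary_set[of "\<lambda>u v. u \<in> L \<and> v \<in> L \<and> (\<phi> u, \<phi> v) \<in> E"]]
        in \<open>simp add: R2_def a_def\<close>)
  then obtain N2 p2 where per2: "eventually_periodic2 N2 p2 R2" by blast
  have p12: "0 < p1" "0 < p2" using per1 per2 by (auto simp: eventually_periodic2_def)
  define N where "N = max N1 N2"
  define p where "p = p1 * p2"
  have p: "0 < p" using p12 by (simp add: p_def)
  have R1: "eventually_periodic2 N p R1"
    using eventually_periodic2_weaken[OF per1 _ p12(2), of N] by (simp add: N_def p_def mult.commute)
  have R2: "eventually_periodic2 N p R2"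
    using eventually_periodic2_weaken[OF per2 _ p12(1), of N] by (simp add: N_def p_def)
  define D where "D = {x. R1 x x \<and> (\<forall>y<x. \<not> R1 y x)}"
  define F where "F = {(x, y). x \<in> D \<and> y \<in> D \<and> R2 x y}"
  have "bij_betw (\<phi> \<circ> a) D V"
    unfolding bij_betw_def
  proof
    show "inj_on (\<phi> \<circ> a) D"
    proof (rule inj_onI)
      fix x y assume xy: "x \<in> D" "y \<in> D" "(\<phi> \<circ> a) x = (\<phi> \<circ> a) y"
      then have "R1 x y" "R1 y x" by (auto simp: D_def R1_def)
      then have "\<not> x < y" "\<not> y < x" using xy(1,2) by (auto simp: D_def)
      then show "x = y" by simp
    qed
    show "(\<phi> \<circ> a) ` D = V"
    proof (intro equalityI subsetI)
      fix v assume "v \<in> V"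
      then obtain u where u: "u \<in> L" "v = \<phi> u" using L by blast
      have ua: "u = a (length u)" unfolding a_def by (rule unit_list_eq_replicate)
      define x where "x = (LEAST x. R1 x (length u))"
      have "R1 (length u) (length u)" using u ua by (simp add: R1_def)
      then have x: "R1 x (length u)" unfolding x_def by (rule LeastI)
      have "\<not> R1 y x" if "y < x" for y
      proof
        assume "R1 y x"
        then have "R1 y (length u)" using x by (simp add: R1_def)
        then show False using that not_less_Least unfolding x_def by blast
      qed
      then have "x \<in> D" using x by (simp add: D_def R1_def)
      moreover have "v = (\<phi> \<circ> a) x" using x u(2) ua by (simp add: R1_def)
      ultimately show "v \<in> (\<phi> \<circ> a) ` D" by blast
    qed (use L in \<open>auto simp: D_def R1_def\<close>)
  qed
  moreover have "\<forall>x\<in>D. \<forall>y\<in>D. (x, y) \<in> F \<longleftrightarrow> ((\<phi> \<circ> a) x, (\<phi> \<circ> a) y) \<in> E"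
    by (auto simp: F_def D_def R1_def R2_def)
  ultimately have "graph_iso D F V E" unfolding graph_iso_def by blast
  then have iso: "graph_iso V E D F" by (rule graph_iso_sym)
  have treeD: "directed_tree D F"
    by (rule directed_tree_iso[OF iso tree]) (auto simp: F_def)
  \<comment> \<open>A shorter name y of x + p is either at least N + p, and can be shifted back
    together with x + p, or it satisfies y + N \<le> x by this choice of M, and x + p is shifted
    alone.\<close>
  define M where "M = 2 * N + p"
  note r1 = R1[unfolded eventually_periodic2_def]
  have D_per: "x + p \<in> D \<longleftrightarrow> x \<in> D" if x: "M \<le> x" for x
  proof -
    have "R1 (x + p) (x + p) \<longleftrightarrow> R1 x x" using r1 x by (simp add: M_def)
    moreover have "(\<exists>y<x + p. R1 y (x + p)) \<longleftrightarrow> (\<exists>y<x. R1 y x)"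
    proof
      assume "\<exists>y<x + p. R1 y (x + p)"
      then obtain y where y: "y < x + p" "R1 y (x + p)" by blast
      show "\<exists>y<x. R1 y x"
      proof (cases "N + p \<le> y")
        case True
        define z where "z = y - p"
        have z: "y = z + p" "N \<le> z" using True by (auto simp: z_def)
        have "N \<le> x" using x by (simp add: M_def)
        then have "R1 z x" using r1 y(2) z by auto
        then show ?thesis using y(1) z(1) by (intro exI[of _ z]) simp
      next
        case False
        then have "y + N \<le> x" "y < x" using x p by (auto simp: M_def)
        then have "R1 y x" using r1 y(2) by blast
        then show ?thesis using \<open>y < x\<close> by blast
      qed
    next
      assume "\<exists>y<x. R1 y x"
      then obtain y where y: "y < x" "R1 y x" by blast
      show "\<exists>y<x + p. R1 y (x + p)"
      proof (cases "N \<le> y")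
        case True
        then have "R1 (y + p) (x + p)" using r1 y by auto
        then show ?thesis using y(1) by (intro exI[of _ "y + p"]) simp
      next
        case False
        then have "y + N \<le> x" using x by (simp add: M_def)
        then have "R1 y (x + p)" using r1 y(2) by blast
        then show ?thesis using y(1) by (intro exI[of _ y]) simp
      qed
    qed
    ultimately show ?thesis by (auto simp: D_def)
  qed
  have Dp: "eventually_periodic M p (\<lambda>x. x \<in> D)"
    using D_per p by (simp add: eventually_periodic_def)
  have "M \<ge> N" by (simp add: M_def)
  then have r2: "eventually_periodic2 M p R2"
    using eventually_periodic2_weaken[OF R2, of M 1] by simp
  have Fp: "eventually_periodic2 M p (\<lambda>x y. (x, y) \<in> F)"
    unfolding eventually_periodic2_def F_def
    using D_per r2[unfolded eventually_periodic2_def] by auto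
  obtain r where r: "r \<in> D" using treeD by (auto simp: directed_tree_def)
  \<comment> \<open>The factor k makes the new period P exceed both the threshold M and the
    root.\<close>
  define k where "k = M + r + 1"
  define P where "P = k * p"
  have "k \<le> P" using p by (simp add: P_def)
  then have P: "M \<le> P" "r < P" by (auto simp: k_def)
  have k: "0 < k" by (simp add: k_def)
  note per = eventually_periodic_weaken[OF Dp P(1) k, folded P_def, unfolded eventually_periodic_def]
    eventually_periodic2_weaken[OF Fp P(1) k, folded P_def, unfolded eventually_periodic2_def]
  obtain par dist where "parent_tree D F r par dist" using parent_tree_exists[OF treeD r] by blast
  then interpret parent_tree D F r par dist .
  have "periodic_tree D F r par dist P"
    by unfold_locales (use P(2) per in auto)
  then show ?thesis using iso by blast
qed

theorem theorem6p9:
  fixes V :: "'a set" and E :: "('a \<times> 'a) set"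
  assumes "directed_tree V E"
  shows "unary_FA_presentable V E \<longleftrightarrow>
    (\<exists>(G0 :: nat set) (E0 :: (nat \<times> nat) set) (As :: attachment list) (Ps :: attachment list).
       finite G0 \<and> directed_tree G0 E0 \<and>
       (\<forall>(T, \<eta>, t0, t1, g) \<in> set As. shallow_star T \<eta> t0 t1 \<and> g \<in> G0) \<and>
       (\<forall>(T, \<eta>, t0, t1, g) \<in> set Ps. periodic_path T \<eta> t0 t1 \<and> g \<in> G0) \<and>
       graph_iso V E (fst (assemble G0 E0 (As @ Ps))) (snd (assemble G0 E0 (As @ Ps))))"
proof
  assume pres: "unary_FA_presentable V E"
  obtain D F r par dist P where "periodic_tree D F r par dist P" and iso: "graph_iso V E D F"
    using presentable_iso_periodic_tree[OF assms pres] by blast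
  then interpret periodic_tree D F r par dist P by simp
  show "\<exists>(G0 :: nat set) (E0 :: (nat \<times> nat) set) (As :: attachment list) (Ps :: attachment list).
       finite G0 \<and> directed_tree G0 E0 \<and>
       (\<forall>(T, \<eta>, t0, t1, g) \<in> set As. shallow_star T \<eta> t0 t1 \<and> g \<in> G0) \<and>
       (\<forall>(T, \<eta>, t0, t1, g) \<in> set Ps. periodic_path T \<eta> t0 t1 \<and> g \<in> G0) \<and>
       graph_iso V E (fst (assemble G0 E0 (As @ Ps))) (snd (assemble G0 E0 (As @ Ps)))"
  proof -
    obtain G0 E0 As Ps where a: "finite G0" "directed_tree G0 E0"
      "\<forall>(T, \<eta>, t0, t1, g) \<in> set As. shallow_star T \<eta> t0 t1 \<and> g \<in> G0"
      "\<forall>(T, \<eta>, t0, t1, g) \<in> set Ps. periodic_path T \<eta> t0 t1 \<and> g \<in> G0"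
      "graph_iso D F (fst (assemble G0 E0 (As @ Ps))) (snd (assemble G0 E0 (As @ Ps)))"
      using assembled by (elim exE conjE) (rule that)
    show ?thesis
      by (intro exI conjI) (fact a(1), fact a(2), fact a(3), fact a(4), rule graph_iso_trans[OF iso a(5)])
  qed
next
  assume "\<exists>(G0 :: nat set) (E0 :: (nat \<times> nat) set) (As :: attachment list) (Ps :: attachment list).
       finite G0 \<and> directed_tree G0 E0 \<and>
       (\<forall>(T, \<eta>, t0, t1, g) \<in> set As. shallow_star T \<eta> t0 t1 \<and> g \<in> G0) \<and>
       (\<forall>(T, \<eta>, t0, t1, g) \<in> set Ps. periodic_path T \<eta> t0 t1 \<and> g \<in> G0) \<and>
       graph_iso V E (fst (assemble G0 E0 (As @ Ps))) (snd (assemble G0 E0 (As @ Ps)))"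
  then obtain G0 :: "nat set" and E0 and As Ps :: "attachment list" where
    G0: "finite G0" "directed_tree G0 E0"
    and As: "\<forall>(T, \<eta>, t0, t1, g) \<in> set As. shallow_star T \<eta> t0 t1 \<and> g \<in> G0"
    and Ps: "\<forall>(T, \<eta>, t0, t1, g) \<in> set Ps. periodic_path T \<eta> t0 t1 \<and> g \<in> G0"
    and iso: "graph_iso V E (fst (assemble G0 E0 (As @ Ps))) (snd (assemble G0 E0 (As @ Ps)))"
    by (elim exE conjE) (rule that)
  have E0: "E0 \<subseteq> G0 \<times> G0" using G0(2) by (simp add: directed_tree_def directed_graph_def)
  have valid: "valid_att G0 a" if "a \<in> set (As @ Ps)" for a
  proof -
    have "case a of (T, \<eta>, t0, t1, g) \<Rightarrow> template T \<eta> t0 t1 \<and> g \<in> G0"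
      using that As Ps by (auto simp: shallow_star_def periodic_path_def)
    then show ?thesis
      by (cases a) (auto simp: valid_att_def template_def directed_tree_def directed_graph_def)
  qed
  have "graph_iso (normal_verts G0 (As @ Ps)) (normal_edges E0 (As @ Ps)) V E"
    using graph_iso_trans[OF iso assemble_iso_normal[OF E0 valid]] by (rule graph_iso_sym)
  then show "unary_FA_presentable V E"
    by (rule unary_FA_presentable_iso) (rule normal_presentable[OF G0(1) E0 valid])
qed

end
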